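(* Let $X$ and $Y$ be completely regular topological spaces. The following are equivalent: (1) $\mathfrak{B}(\mathcal{O}X)$ and $\mathfrak{B}(\mathcal{O}Y)$ are isomorphic. (2) $\mathrm{H}_{nf}(X)$ and $\mathrm{H}_{nf}(Y)$ are Riesz isomorphic. (3) $\mathcal{NL}(X)$ and $\mathcal{NL}(Y)$ are Riesz isomorphic. (4) $\mathrm{C}(X)$ and $\mathrm{C}(Y)$ have Riesz isomorphic universal completions.
   Context: $\mathfrak{B}(\mathcal{O}X)$ is the complete Boolean algebra of regular open subsets of $X$ (the Booleanization of the frame $\mathcal{O}X$ of open sets). $\mathrm{C}(X)$ is the Riesz space of continuous real functions on $X$. Interval-valued functions: $\overline{\mathbb{IR}}$ is the set of nonempty compact intervals $[\underline{a},\overline{a}]$ of $\overline{\mathbb{R}}=[-\infty,+\infty]$, ordered by reverse inclusion, with its Scott topology, generated by the sets $\{\boldsymbol{a}\mid\underline{a}>p\}$ and $\{\boldsymbol{a}\mid\overline{a}<q\}$, $p,q\in\mathbb{Q}$. For $f\colon X\to\overline{\mathbb{IR}}$ write $f(x)=[\underline{f}(x),\overline{f}(x)]$; $f$ is continuous iff $\underline{f}$ is lower semicontinuous and $\overline{f}$ is upper semicontinuous. $\mathrm{C}(X,\overline{\mathbb{IR}})$ is the set of continuous functions, with two partial orders: $f\le g$ iff $\underline{f}\le\underline{g}$ and $\overline{f}\le\overline{g}$ pointwise; and $f\sqsubseteq g$ iff $f(x)\supseteq g(x)$ for all $x$. $f$ is Hausdorff continuous if it is maximal for $\sqsubseteq$,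 and nearly finite if $\{x\mid\underline{f}(x)\in\mathbb{R}\text{ and }\overline{f}(x)\in\mathbb{R}\}$ is dense. $\mathrm{H}_{nf}(X)$ is the set of nearly finite Hausdorff continuous functions, ordered by $\le$. Riesz structure on $\mathrm{H}_{nf}(X)$: for a frame $M$, $\mathrm{C}(M)$ is the Riesz space of frame homomorphisms $\mathfrak{L}(\mathbb{R})\to M$, where $\mathfrak{L}(\mathbb{R})$ is the frame presented by generators $(p,-),(-,p)$ ($p\in\mathbb{Q}$) and relations $(p,-)\wedge(-,q)=0$ if $p\ge q$; $(p,-)\vee(-,q)=1$ if $p<q$; $(p,-)=\bigvee_{q>p}(q,-)$; $(-,p)=\bigvee_{q<p}(-,q)$; $\bigvee_p(p,-)=1=\bigvee_p(-,p)$. It is ordered by $f\le g$ iff $f(p,-)\le g(p,-)$ for all $p$, with $(f+g)(p,-)=\bigvee_{r}f(r,-)\wedge g(p-r,-)$, $(f+g)(-,q)=\bigvee_{s}f(-,s)\wedge g(-,q-s)$, $(-f)(p,-)=f(-,-p)$, $(-f)(-,q)=f(-q,-)$, and for $\lambda>0$ $(\lambda f)(p,-)=\bigvee\{f(r,-)\mid \lambda r>p\}$, $(\lambda f)(-,q)=\bigvee\{f(-,s)\mid\lambda s<q\}$. The map sending $f\in\mathrm{H}_{nf}(X)$ to the homomorphism $(p,-)\mapsto\mathrm{int}\,\mathrm{cl}\{x\mid\underline{f}(x)>p\}$, $(-,q)\mapsto\mathrm{int}\,\mathrm{cl}\{x\mid\overline{f}(x)<q\}$ is an order isomorphism $\mathrm{H}_{nf}(X)\to\mathrm{C}(\mathfrak{B}(\mathcal{O}X))$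 (known), and $\mathrm{H}_{nf}(X)$ carries the Riesz space operations transported along it. $\mathcal{NL}(X)$: for $u\colon X\to\overline{\mathbb{R}}$ let $\mathrm{I}(u)(x)=\sup_{V}\inf_{y\in V}u(y)$ and $\mathrm{S}(u)(x)=\inf_{V}\sup_{y\in V}u(y)$, $V$ ranging over the neighbourhoods of $x$ (lower and upper Baire operators). $u$ is normal lower semicontinuous if $\mathrm{I}(\mathrm{S}(u))=u$, and nearly finite if $\{x\mid u(x)\in\mathbb{R}\}$ is dense in $X$. $\mathcal{NL}(X)$ is the set of nearly finite normal lower semicontinuous functions with the pointwise order and the operations $\lambda\odot u=\mathrm{I}\mathrm{S}(\lambda u)$, $u\oplus v=\mathrm{I}\mathrm{S}(u+v)$, where $\lambda u$ and $u+v$ are computed pointwise (at points where the pointwise expression is undefined, any value in $\overline{\mathbb{R}}$ may be used; the result does not depend on the choice). It is a Riesz space. A Riesz space is universally complete if it is Dedekind complete (nonempty subsets bounded above have suprema) and laterally complete (every nonempty set of pairwise disjoint positive elements has a supremum). A universal completion of $R$ is a universally complete Riesz space $\mathcal{U}(R)$ with a Riesz space embedding $\mu\colon R\to\mathcal{U}(R)$ such that $f=\bigvee\{\mu(g)\mid g\in R,\ 0\le\mu(g)\le f\}$ for all $f\in\mathcal{U}(R)^+$; for Archimedean $R$ it exists and is unique up to isomorphism. *)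

theory Defs
  imports "HOL-Analysis.Analysis" "HOL-Algebra.Complete_Lattice"
begin

section \<open>Riesz spaces\<close>

text \<open>
  Riesz spaces live on carrier sets and extend \<open>gorder\<close>, so that joins, meets and least upper
  bounds are those of the underlying ordered structure.  The field \<open>eq\<close> is always equality.
\<close>

record 'a riesz = "'a gorder" +
  vzero :: 'a
  vadd :: "['a, 'a] \<Rightarrow> 'a" (infixl \<open>\<boxplus>\<index>\<close> 65)
  vscale :: "[real, 'a] \<Rightarrow> 'a" (infixr \<open>\<boxdot>\<index>\<close> 75)

locale riesz_space = lattice R for R :: "'a riesz" (structure) +
  assumes zero_closed: "vzero R \<in> carrier R"
    and add_closed: "\<lbrakk>x \<in> carrier R; y \<in> carrier R\<rbrakk> \<Longrightarrow> x \<boxplus> y \<in> carrier R"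
    and scale_closed: "x \<in> carrier R \<Longrightarrow> c \<boxdot> x \<in> carrier R"
    and add_assoc: "\<lbrakk>x \<in> carrier R; y \<in> carrier R; z \<in> carrier R\<rbrakk> \<Longrightarrow> (x \<boxplus> y) \<boxplus> z = x \<boxplus> (y \<boxplus> z)"
    and add_comm: "\<lbrakk>x \<in> carrier R; y \<in> carrier R\<rbrakk> \<Longrightarrow> x \<boxplus> y = y \<boxplus> x"
    and zero_add: "x \<in> carrier R \<Longrightarrow> vzero R \<boxplus> x = x"
    and add_inverse: "x \<in> carrier R \<Longrightarrow> \<exists>y\<in>carrier R. x \<boxplus> y = vzero R"
    and scale_add_right: "\<lbrakk>x \<in> carrier R; y \<in> carrier R\<rbrakk> \<Longrightarrow> c \<boxdot> (x \<boxplus> y) = c \<boxdot> x \<boxplus> c \<boxdot> y"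
    and scale_add_left: "x \<in> carrier R \<Longrightarrow> (c + d) \<boxdot> x = c \<boxdot> x \<boxplus> d \<boxdot> x"
    and scale_scale: "x \<in> carrier R \<Longrightarrow> c \<boxdot> d \<boxdot> x = (c * d) \<boxdot> x"
    and scale_one: "x \<in> carrier R \<Longrightarrow> 1 \<boxdot> x = x"
    and add_mono: "\<lbrakk>x \<in> carrier R; y \<in> carrier R; z \<in> carrier R; x \<sqsubseteq> y\<rbrakk> \<Longrightarrow> x \<boxplus> z \<sqsubseteq> y \<boxplus> z"
    and scale_mono: "\<lbrakk>x \<in> carrier R; y \<in> carrier R; 0 \<le> c; x \<sqsubseteq> y\<rbrakk> \<Longrightarrow> c \<boxdot> x \<sqsubseteq> c \<boxdot> y"

definition riesz_hom :: "'a riesz \<Rightarrow> 'b riesz \<Rightarrow> ('a \<Rightarrow> 'b) \<Rightarrow> bool" where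
  "riesz_hom R S h \<longleftrightarrow>
     h \<in> carrier R \<rightarrow> carrier S \<and>
     (\<forall>x\<in>carrier R. \<forall>y\<in>carrier R. h (x \<boxplus>\<^bsub>R\<^esub> y) = h x \<boxplus>\<^bsub>S\<^esub> h y) \<and>
     (\<forall>c. \<forall>x\<in>carrier R. h (c \<boxdot>\<^bsub>R\<^esub> x) = c \<boxdot>\<^bsub>S\<^esub> h x) \<and>
     (\<forall>x\<in>carrier R. \<forall>y\<in>carrier R. h (x \<squnion>\<^bsub>R\<^esub> y) = h x \<squnion>\<^bsub>S\<^esub> h y) \<and>
     (\<forall>x\<in>carrier R. \<forall>y\<in>carrier R. h (x \<sqinter>\<^bsub>R\<^esub> y) = h x \<sqinter>\<^bsub>S\<^esub> h y)"

definition riesz_embedding :: "'a riesz \<Rightarrow> 'b riesz \<Rightarrow> ('a \<Rightarrow> 'b) \<Rightarrow> bool" where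
  "riesz_embedding R S h \<longleftrightarrow> riesz_hom R S h \<and> inj_on h (carrier R)"

definition riesz_isomorphic :: "'a riesz \<Rightarrow> 'b riesz \<Rightarrow> bool" where
  "riesz_isomorphic R S \<longleftrightarrow> (\<exists>h. riesz_hom R S h \<and> bij_betw h (carrier R) (carrier S))"

definition dedekind_complete :: "'a riesz \<Rightarrow> bool" where
  "dedekind_complete R \<longleftrightarrow>
     (\<forall>A. A \<subseteq> carrier R \<and> A \<noteq> {} \<and> Upper R A \<noteq> {} \<longrightarrow> (\<exists>s. is_lub R s A))"

definition laterally_complete :: "'a riesz \<Rightarrow> bool" where
  "laterally_complete R \<longleftrightarrow>
     (\<forall>A. A \<subseteq> carrier R \<and> A \<noteq> {} \<and> (\<forall>x\<in>A. vzero R \<sqsubseteq>\<^bsub>R\<^esub> x) \<and>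
          (\<forall>x\<in>A. \<forall>y\<in>A. x \<noteq> y \<longrightarrow> x \<sqinter>\<^bsub>R\<^esub> y = vzero R)
        \<longrightarrow> (\<exists>s. is_lub R s A))"

definition universally_complete :: "'a riesz \<Rightarrow> bool" where
  "universally_complete R \<longleftrightarrow> riesz_space R \<and> dedekind_complete R \<and> laterally_complete R"

definition universal_completion :: "'a riesz \<Rightarrow> 'b riesz \<Rightarrow> ('a \<Rightarrow> 'b) \<Rightarrow> bool" where
  "universal_completion R U \<mu> \<longleftrightarrow>
     universally_complete U \<and> riesz_embedding R U \<mu> \<and>
     (\<forall>f\<in>carrier U. vzero U \<sqsubseteq>\<^bsub>U\<^esub> f \<longrightarrow>
        is_lub U f {\<mu> g |g. g \<in> carrier R \<and> vzero U \<sqsubseteq>\<^bsub>U\<^esub> \<mu> g \<and> \<mu> g \<sqsubseteq>\<^bsub>U\<^esub> f})"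

text \<open>
  HOL cannot quantify over the type on which a universal completion lives.  The types used here
  are no restriction: an element \<open>f\<close> of a universal completion of \<open>R\<close> is determined by the sets
  of those \<open>g\<close> in \<open>R\<close> with \<open>0 \<le> \<mu> g \<le> f\<^sup>+\<close> and with \<open>0 \<le> \<mu> g \<le> f\<^sup>-\<close>, so every universal
  completion, on whatever type, has an isomorphic copy on pairs of sets of elements of \<open>R\<close>; see
  \<open>universal_completion_copy\<close> and \<open>isomorphic_universal_completionsI\<close> below.
\<close>

definition isomorphic_universal_completions :: "'a riesz \<Rightarrow> 'b riesz \<Rightarrow> bool" where
  "isomorphic_universal_completions R S \<longleftrightarrow>
     (\<exists>(U :: ('a set \<times> 'a set) riesz) \<mu> (V :: ('b set \<times> 'b set) riesz) \<nu>.
        universal_completion R U \<mu> \<and> universal_completion S V \<nu> \<and> riesz_isomorphic U V)"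


context riesz_space
begin

lemma neg_closed: "x \<in> carrier R \<Longrightarrow> (- 1) \<boxdot> x \<in> carrier R"
  by (rule scale_closed)

lemma add_zero: "x \<in> carrier R \<Longrightarrow> x \<boxplus> vzero R = x"
  using add_comm zero_add zero_closed by metis

lemma add_right_cancel:
  assumes "x \<in> carrier R" "y \<in> carrier R" "n \<in> carrier R" "x \<boxplus> n = y \<boxplus> n"
  shows "x = y"
proof -
  obtain m where m: "m \<in> carrier R" "n \<boxplus> m = vzero R"
    using add_inverse assms by blast
  have "(x \<boxplus> n) \<boxplus> m = (y \<boxplus> n) \<boxplus> m"
    using assms by simp
  then show ?thesis
    using assms(1-3) m by (simp add: add_assoc add_zero)
qed

lemma add_neg:
  assumes "x \<in> carrier R"
  shows "x \<boxplus> (- 1) \<boxdot> x = vzero R"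
proof -
  have z: "0 \<boxdot> x \<boxplus> 0 \<boxdot> x = vzero R \<boxplus> 0 \<boxdot> x"
    using assms scale_add_left[of x 0 0] by (simp add: zero_add scale_closed)
  have "0 \<boxdot> x = vzero R"
    by (rule add_right_cancel[OF _ _ _ z]) (use assms in \<open>auto intro: scale_closed zero_closed\<close>)
  then show ?thesis
    using assms scale_add_left[of x 1 "- 1"] by (simp add: scale_one)
qed

lemma pos_part_eq:
  assumes u: "u \<in> carrier R"
  shows "u \<squnion> vzero R = u \<boxplus> ((- 1) \<boxdot> u \<squnion> vzero R)"
proof -
  let ?m = "(- 1) \<boxdot> u"
  let ?n = "?m \<squnion> vzero R"
  have m: "?m \<in> carrier R" and n: "?n \<in> carrier R"
    using u by (auto intro: scale_closed zero_closed join_closed)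
  have "u \<squnion> vzero R \<sqsubseteq> u \<boxplus> ?n"
  proof (rule join_le)
    have "vzero R \<boxplus> u \<sqsubseteq> ?n \<boxplus> u"
      using u m n by (intro add_mono) (auto intro: zero_closed join_right)
    then show "u \<sqsubseteq> u \<boxplus> ?n"
      using u n by (simp add: zero_add add_comm)
    have "?m \<boxplus> u \<sqsubseteq> ?n \<boxplus> u"
      using u m n by (intro add_mono) (auto intro: zero_closed join_left)
    then show "vzero R \<sqsubseteq> u \<boxplus> ?n"
      using u m n by (simp add: add_comm[of _ u] add_neg)
  qed (use u n in \<open>auto intro: zero_closed add_closed\<close>)
  moreover have "u \<boxplus> ?n \<sqsubseteq> u \<squnion> vzero R"
  proof -
    let ?z = "u \<squnion> vzero R"
    have z: "?z \<in> carrier R"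
      using u by (auto intro: zero_closed join_closed)
    have zm: "?z \<boxplus> ?m \<in> carrier R"
      using z m by (rule add_closed)
    have "?n \<sqsubseteq> ?z \<boxplus> ?m"
    proof (rule join_le)
      have "vzero R \<boxplus> ?m \<sqsubseteq> ?z \<boxplus> ?m"
        using u m z by (intro add_mono) (auto intro: zero_closed join_right)
      then show "?m \<sqsubseteq> ?z \<boxplus> ?m"
        using m by (simp add: zero_add)
      have "u \<boxplus> ?m \<sqsubseteq> ?z \<boxplus> ?m"
        using u m z by (intro add_mono) (auto intro: zero_closed join_left)
      then show "vzero R \<sqsubseteq> ?z \<boxplus> ?m"
        using u by (simp add: add_neg)
    qed (use m zm in \<open>auto intro: zero_closed\<close>)
    then have "?n \<boxplus> u \<sqsubseteq> (?z \<boxplus> ?m) \<boxplus> u"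
      using n zm u by (intro add_mono)
    also have "(?z \<boxplus> ?m) \<boxplus> u = ?z"
      using z m u by (simp add: add_assoc add_comm[of ?m u] add_neg add_zero)
    finally show ?thesis
      using u n by (simp add: add_comm)
  qed
  ultimately show ?thesis
    using u n by (intro le_antisym) (auto intro: zero_closed add_closed join_closed)
qed

lemma eq_if_parts_eq:
  assumes "u \<in> carrier R" "w \<in> carrier R"
    and "u \<squnion> vzero R = w \<squnion> vzero R" "(- 1) \<boxdot> u \<squnion> vzero R = (- 1) \<boxdot> w \<squnion> vzero R"
  shows "u = w"
proof (rule add_right_cancel)
  show "u \<boxplus> ((- 1) \<boxdot> u \<squnion> vzero R) = w \<boxplus> ((- 1) \<boxdot> u \<squnion> vzero R)"
    using assms pos_part_eq by metis
qed (use assms in \<open>auto intro: scale_closed zero_closed join_closed\<close>)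

end

definition riesz_copy :: "'a riesz \<Rightarrow> ('a \<Rightarrow> 'b) \<Rightarrow> 'b riesz" where
  "riesz_copy U e =
     (let d = inv_into (carrier U) e
      in \<lparr>carrier = e ` carrier U,
          eq = (=),
          le = (\<lambda>x y. d x \<sqsubseteq>\<^bsub>U\<^esub> d y),
          vzero = e (vzero U),
          vadd = (\<lambda>x y. e (d x \<boxplus>\<^bsub>U\<^esub> d y)),
          vscale = (\<lambda>c x. e (c \<boxdot>\<^bsub>U\<^esub> d x))\<rparr>)"

context
  fixes U :: "'u riesz" and e :: "'u \<Rightarrow> 'v"
  assumes U: "riesz_space U" and inj: "inj_on e (carrier U)"
begin

interpretation riesz_space U by (rule U)

lemma copy_simps:
  "carrier (riesz_copy U e) = e ` carrier U"
  "vzero (riesz_copy U e) = e (vzero U)"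
  "\<lbrakk>x \<in> carrier U; y \<in> carrier U\<rbrakk> \<Longrightarrow> e x \<sqsubseteq>\<^bsub>riesz_copy U e\<^esub> e y \<longleftrightarrow> x \<sqsubseteq>\<^bsub>U\<^esub> y"
  "\<lbrakk>x \<in> carrier U; y \<in> carrier U\<rbrakk> \<Longrightarrow> e x \<boxplus>\<^bsub>riesz_copy U e\<^esub> e y = e (x \<boxplus>\<^bsub>U\<^esub> y)"
  "x \<in> carrier U \<Longrightarrow> c \<boxdot>\<^bsub>riesz_copy U e\<^esub> e x = e (c \<boxdot>\<^bsub>U\<^esub> x)"
  using inj by (simp_all add: riesz_copy_def Let_def)

lemma copy_partial_order: "partial_order (riesz_copy U e)"
proof (unfold_locales, goal_cases)
  case (5 x y)
  then show ?case
    by (auto simp: copy_simps riesz_copy_def Let_def inj intro!: arg_cong[of _ _ e] le_antisym)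
next
  case (6 x y z)
  then show ?case
    by (auto simp: copy_simps intro: le_trans)
qed (auto simp: copy_simps riesz_copy_def Let_def inj inv_into_f_f[OF inj])

interpretation C: partial_order "riesz_copy U e" by (rule copy_partial_order)

lemma copy_Upper:
  assumes "A \<subseteq> carrier U"
  shows "Upper (riesz_copy U e) (e ` A) = e ` Upper U A"
proof -
  have A: "e ` A \<inter> e ` carrier U = e ` A" "A \<inter> carrier U = A"
    using assms by blast+
  have le: "e x \<sqsubseteq>\<^bsub>riesz_copy U e\<^esub> e u \<longleftrightarrow> x \<sqsubseteq>\<^bsub>U\<^esub> u" if "x \<in> A" "u \<in> carrier U" for x u
    using that assms by (intro copy_simps) blast+
  show ?thesis
  proof (intro equalityI subsetI)
    fix y
    assume y: "y \<in> Upper (riesz_copy U e) (e ` A)"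
    then obtain u where u: "u \<in> carrier U" "y = e u"
      by (auto simp: Upper_def copy_simps(1))
    have "e x \<sqsubseteq>\<^bsub>riesz_copy U e\<^esub> e u" if "x \<in> A" for x
      using y u(2) A(1) that by (auto simp: Upper_def copy_simps(1))
    then have "u \<in> Upper U A"
      using le u(1) by (simp add: Upper_def)
    then show "y \<in> e ` Upper U A"
      using u(2) by blast
  next
    fix y
    assume "y \<in> e ` Upper U A"
    then obtain u where u: "u \<in> Upper U A" "y = e u"
      by blast
    then have "u \<in> carrier U" "\<And>x. x \<in> A \<Longrightarrow> x \<sqsubseteq>\<^bsub>U\<^esub> u"
      using A(2) by (auto simp: Upper_def)
    then show "y \<in> Upper (riesz_copy U e) (e ` A)"
      using le u(2) unfolding Upper_def copy_simps(1) A(1) by auto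
  qed
qed

lemma copy_Lower:
  assumes "A \<subseteq> carrier U"
  shows "Lower (riesz_copy U e) (e ` A) = e ` Lower U A"
proof -
  have A: "e ` A \<inter> e ` carrier U = e ` A" "A \<inter> carrier U = A"
    using assms by blast+
  have le: "e u \<sqsubseteq>\<^bsub>riesz_copy U e\<^esub> e x \<longleftrightarrow> u \<sqsubseteq>\<^bsub>U\<^esub> x" if "x \<in> A" "u \<in> carrier U" for x u
    using that assms by (intro copy_simps) blast+
  show ?thesis
  proof (intro equalityI subsetI)
    fix y
    assume y: "y \<in> Lower (riesz_copy U e) (e ` A)"
    then obtain u where u: "u \<in> carrier U" "y = e u"
      by (auto simp: Lower_def copy_simps(1))
    have "e u \<sqsubseteq>\<^bsub>riesz_copy U e\<^esub> e x" if "x \<in> A" for x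
      using y u(2) A(1) that by (auto simp: Lower_def copy_simps(1))
    then have "u \<in> Lower U A"
      using le u(1) by (simp add: Lower_def)
    then show "y \<in> e ` Lower U A"
      using u(2) by blast
  next
    fix y
    assume "y \<in> e ` Lower U A"
    then obtain u where u: "u \<in> Lower U A" "y = e u"
      by blast
    then have "u \<in> carrier U" "\<And>x. x \<in> A \<Longrightarrow> u \<sqsubseteq>\<^bsub>U\<^esub> x"
      using A(2) by (auto simp: Lower_def)
    then show "y \<in> Lower (riesz_copy U e) (e ` A)"
      using le u(2) unfolding Lower_def copy_simps(1) A(1) by auto
  qed
qed

lemma copy_lub:
  assumes "A \<subseteq> carrier U" "s \<in> carrier U"
  shows "is_lub (riesz_copy U e) (e s) (e ` A) \<longleftrightarrow> is_lub U s A"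
proof -
  have B: "Upper U A \<subseteq> carrier U"
    by (rule Upper_closed)
  have "e s \<in> e ` Upper U A \<longleftrightarrow> s \<in> Upper U A"
    by (rule inj_on_image_mem_iff[OF inj assms(2) B])
  moreover have "e s \<sqsubseteq>\<^bsub>riesz_copy U e\<^esub> e x \<longleftrightarrow> s \<sqsubseteq>\<^bsub>U\<^esub> x" if "x \<in> Upper U A" for x
    using subsetD[OF B that] assms(2) by (simp add: copy_simps(3))
  ultimately show ?thesis
    unfolding copy_Upper[OF assms(1)] least_def copy_simps(1)
    using B image_mono[OF B, of e] by simp
qed

lemma copy_glb:
  assumes "A \<subseteq> carrier U" "s \<in> carrier U"
  shows "is_glb (riesz_copy U e) (e s) (e ` A) \<longleftrightarrow> is_glb U s A"
proof -
  have B: "Lower U A \<subseteq> carrier U"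
    by (rule Lower_closed)
  have "e s \<in> e ` Lower U A \<longleftrightarrow> s \<in> Lower U A"
    by (rule inj_on_image_mem_iff[OF inj assms(2) B])
  moreover have "e x \<sqsubseteq>\<^bsub>riesz_copy U e\<^esub> e s \<longleftrightarrow> x \<sqsubseteq>\<^bsub>U\<^esub> s" if "x \<in> Lower U A" for x
    using subsetD[OF B that] assms(2) by (simp add: copy_simps(3))
  ultimately show ?thesis
    unfolding copy_Lower[OF assms(1)] greatest_def copy_simps(1)
    using B image_mono[OF B, of e] by simp
qed

lemma join_lub:
  assumes "x \<in> carrier U" "y \<in> carrier U"
  shows "is_lub U (x \<squnion>\<^bsub>U\<^esub> y) {x, y}"
  using sup_of_two_exists[OF assms] unfolding join_def sup_def by (rule someI_ex)

lemma meet_glb: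
  assumes "x \<in> carrier U" "y \<in> carrier U"
  shows "is_glb U (x \<sqinter>\<^bsub>U\<^esub> y) {x, y}"
  using inf_of_two_exists[OF assms] unfolding meet_def inf_def by (rule someI_ex)

lemma copy_join_lub:
  assumes "x \<in> carrier U" "y \<in> carrier U"
  shows "is_lub (riesz_copy U e) (e (x \<squnion>\<^bsub>U\<^esub> y)) {e x, e y}"
  using copy_lub[of "{x, y}" "x \<squnion>\<^bsub>U\<^esub> y"] join_lub[OF assms] assms by simp

lemma copy_meet_glb:
  assumes "x \<in> carrier U" "y \<in> carrier U"
  shows "is_glb (riesz_copy U e) (e (x \<sqinter>\<^bsub>U\<^esub> y)) {e x, e y}"
  using copy_glb[of "{x, y}" "x \<sqinter>\<^bsub>U\<^esub> y"] meet_glb[OF assms] assms by simp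

lemma copy_join:
  assumes "x \<in> carrier U" "y \<in> carrier U"
  shows "e x \<squnion>\<^bsub>riesz_copy U e\<^esub> e y = e (x \<squnion>\<^bsub>U\<^esub> y)"
  unfolding join_def[of "riesz_copy U e"] sup_def[of "riesz_copy U e"]
  by (rule some_equality) (fact copy_join_lub[OF assms], rule C.least_unique[OF _ copy_join_lub[OF assms]])

lemma copy_meet:
  assumes "x \<in> carrier U" "y \<in> carrier U"
  shows "e x \<sqinter>\<^bsub>riesz_copy U e\<^esub> e y = e (x \<sqinter>\<^bsub>U\<^esub> y)"
  unfolding meet_def[of "riesz_copy U e"] inf_def[of "riesz_copy U e"]
  by (rule some_equality) (fact copy_meet_glb[OF assms], rule C.greatest_unique[OF _ copy_meet_glb[OF assms]])

lemma copy_riesz_space: "riesz_space (riesz_copy U e)"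
proof (unfold_locales, goal_cases)
  case (1 x y)
  then obtain a b where "a \<in> carrier U" "b \<in> carrier U" "x = e a" "y = e b"
    by (auto simp: copy_simps)
  then show ?case
    using copy_join_lub by blast
next
  case (2 x y)
  then obtain a b where "a \<in> carrier U" "b \<in> carrier U" "x = e a" "y = e b"
    by (auto simp: copy_simps)
  then show ?case
    using copy_meet_glb by blast
next
  case (7 x y)
  then obtain a b where "a \<in> carrier U" "b \<in> carrier U" "x = e a" "y = e b"
    by (auto simp: copy_simps)
  then show ?case
    using add_comm by (simp add: copy_simps)
next
  case (9 x)
  then obtain a where a: "a \<in> carrier U" "x = e a"
    by (auto simp: copy_simps)
  then obtain b where "b \<in> carrier U" "a \<boxplus>\<^bsub>U\<^esub> b = vzero U"
    using add_inverse by blast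
  with a show ?case
    by (auto simp: copy_simps intro!: bexI[of _ b])
qed (auto simp: copy_simps zero_closed add_closed scale_closed zero_add scale_one scale_scale
       add_assoc scale_add_left scale_add_right add_mono scale_mono)

lemma copy_hom: "riesz_hom U (riesz_copy U e) e"
  by (auto simp: riesz_hom_def copy_simps copy_join copy_meet)

lemma copy_isomorphic: "riesz_isomorphic U (riesz_copy U e)"
  using copy_hom inj by (auto simp: riesz_isomorphic_def bij_betw_def copy_simps)

lemma copy_dedekind_complete:
  assumes "dedekind_complete U"
  shows "dedekind_complete (riesz_copy U e)"
  unfolding dedekind_complete_def
proof (intro allI impI, elim conjE)
  fix A
  assume A: "A \<subseteq> carrier (riesz_copy U e)" "A \<noteq> {}" "Upper (riesz_copy U e) A \<noteq> {}"
  then obtain B where B: "B \<subseteq> carrier U" "A = e ` B"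
    by (auto simp: copy_simps subset_image_iff)
  with A have "B \<noteq> {}" "Upper U B \<noteq> {}"
    by (auto simp: copy_Upper)
  with assms B obtain s where s: "is_lub U s B"
    unfolding dedekind_complete_def by blast
  then have "s \<in> carrier U"
    by (simp add: least_def Upper_def)
  with s B show "\<exists>s. is_lub (riesz_copy U e) s A"
    using copy_lub by blast
qed

lemma copy_laterally_complete:
  assumes "laterally_complete U"
  shows "laterally_complete (riesz_copy U e)"
  unfolding laterally_complete_def
proof (intro allI impI, elim conjE)
  fix A
  assume A: "A \<subseteq> carrier (riesz_copy U e)" "A \<noteq> {}"
    "\<forall>x\<in>A. vzero (riesz_copy U e) \<sqsubseteq>\<^bsub>riesz_copy U e\<^esub> x"
    "\<forall>x\<in>A. \<forall>y\<in>A. x \<noteq> y \<longrightarrow> x \<sqinter>\<^bsub>riesz_copy U e\<^esub> y = vzero (riesz_copy U e)"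
  then obtain B where B: "B \<subseteq> carrier U" "A = e ` B"
    by (auto simp: copy_simps subset_image_iff)
  have "B \<noteq> {}"
    using A B by auto
  moreover have "\<forall>x\<in>B. vzero U \<sqsubseteq>\<^bsub>U\<^esub> x"
    using A(3) B by (auto simp: copy_simps zero_closed subset_iff)
  moreover have "x \<sqinter>\<^bsub>U\<^esub> y = vzero U" if "x \<in> B" "y \<in> B" "x \<noteq> y" for x y
  proof -
    have xy: "x \<in> carrier U" "y \<in> carrier U"
      using B that by auto
    then have "e x \<noteq> e y"
      using inj that by (auto dest: inj_onD)
    then have "e (x \<sqinter>\<^bsub>U\<^esub> y) = e (vzero U)"
      using A(4) B that xy copy_meet[OF xy] by (simp add: copy_simps)
    then show ?thesis
      using inj xy by (auto dest: inj_onD intro: zero_closed meet_closed)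
  qed
  ultimately obtain s where s: "is_lub U s B"
    using assms B unfolding laterally_complete_def by blast
  then have "s \<in> carrier U"
    by (simp add: least_def Upper_def)
  with s B show "\<exists>s. is_lub (riesz_copy U e) s A"
    using copy_lub by blast
qed

lemma copy_universal_completion:
  assumes "universal_completion R U \<mu>"
  shows "universal_completion R (riesz_copy U e) (e \<circ> \<mu>)"
proof -
  have uc: "dedekind_complete U" "laterally_complete U"
    and emb: "riesz_hom R U \<mu>" "inj_on \<mu> (carrier R)"
    and dense: "\<And>f. \<lbrakk>f \<in> carrier U; vzero U \<sqsubseteq>\<^bsub>U\<^esub> f\<rbrakk> \<Longrightarrow>
      is_lub U f {\<mu> g |g. g \<in> carrier R \<and> vzero U \<sqsubseteq>\<^bsub>U\<^esub> \<mu> g \<and> \<mu> g \<sqsubseteq>\<^bsub>U\<^esub> f}"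
    using assms
    by (auto simp: universal_completion_def universally_complete_def riesz_embedding_def)
  have \<mu>: "\<mu> g \<in> carrier U" if "g \<in> carrier R" for g
    using emb that by (auto simp: riesz_hom_def)
  have "riesz_hom R (riesz_copy U e) (e \<circ> \<mu>)"
    using emb(1) \<mu> by (auto simp: riesz_hom_def copy_simps copy_join copy_meet)
  moreover have "inj_on (e \<circ> \<mu>) (carrier R)"
    using emb(2) \<mu> inj by (auto intro!: comp_inj_on intro: inj_on_subset)
  moreover have "is_lub (riesz_copy U e) f
      {(e \<circ> \<mu>) g |g. g \<in> carrier R \<and> vzero (riesz_copy U e) \<sqsubseteq>\<^bsub>riesz_copy U e\<^esub> (e \<circ> \<mu>) g \<and>
        (e \<circ> \<mu>) g \<sqsubseteq>\<^bsub>riesz_copy U e\<^esub> f}"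
    if f: "f \<in> carrier (riesz_copy U e)" "vzero (riesz_copy U e) \<sqsubseteq>\<^bsub>riesz_copy U e\<^esub> f" for f
  proof -
    obtain a where a: "a \<in> carrier U" "f = e a"
      using f by (auto simp: copy_simps)
    let ?A = "{\<mu> g |g. g \<in> carrier R \<and> vzero U \<sqsubseteq>\<^bsub>U\<^esub> \<mu> g \<and> \<mu> g \<sqsubseteq>\<^bsub>U\<^esub> a}"
    have "vzero U \<sqsubseteq>\<^bsub>U\<^esub> a"
      using f a by (simp add: copy_simps zero_closed)
    then have "is_lub (riesz_copy U e) (e a) (e ` ?A)"
      using a \<mu> dense by (subst copy_lub) auto
    also have "e ` ?A = {(e \<circ> \<mu>) g |g. g \<in> carrier R \<and>
        vzero (riesz_copy U e) \<sqsubseteq>\<^bsub>riesz_copy U e\<^esub> (e \<circ> \<mu>) g \<and> (e \<circ> \<mu>) g \<sqsubseteq>\<^bsub>riesz_copy U e\<^esub> f}"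
      using a \<mu> by (auto 0 4 simp: copy_simps zero_closed)
    finally show ?thesis
      using a by simp
  qed
  ultimately show ?thesis
    using uc copy_riesz_space copy_dedekind_complete copy_laterally_complete
    by (simp add: universal_completion_def universally_complete_def riesz_embedding_def)
qed

end

lemma universal_completion_copy:
  fixes R :: "'r riesz" and U :: "'u riesz"
  assumes "universal_completion R U \<mu>"
  shows "\<exists>(U' :: ('r set \<times> 'r set) riesz) \<mu>'.
    universal_completion R U' \<mu>' \<and> riesz_isomorphic U U'"
proof -
  have U: "riesz_space U"
    and dense: "\<And>f. \<lbrakk>f \<in> carrier U; vzero U \<sqsubseteq>\<^bsub>U\<^esub> f\<rbrakk> \<Longrightarrow>
      is_lub U f {\<mu> g |g. g \<in> carrier R \<and> vzero U \<sqsubseteq>\<^bsub>U\<^esub> \<mu> g \<and> \<mu> g \<sqsubseteq>\<^bsub>U\<^esub> f}"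
    using assms by (auto simp: universal_completion_def universally_complete_def)
  interpret riesz_space U by (rule U)
  define P where "P f = {g \<in> carrier R. vzero U \<sqsubseteq>\<^bsub>U\<^esub> \<mu> g \<and> \<mu> g \<sqsubseteq>\<^bsub>U\<^esub> f}" for f
  have lub: "is_lub U f (\<mu> ` P f)" if "f \<in> carrier U" "vzero U \<sqsubseteq>\<^bsub>U\<^esub> f" for f
  proof -
    have "\<mu> ` P f = {\<mu> g |g. g \<in> carrier R \<and> vzero U \<sqsubseteq>\<^bsub>U\<^esub> \<mu> g \<and> \<mu> g \<sqsubseteq>\<^bsub>U\<^esub> f}"
      by (auto simp: P_def)
    then show ?thesis
      using dense that by simp
  qed
  define e where "e u = (P (u \<squnion>\<^bsub>U\<^esub> vzero U), P ((- 1) \<boxdot>\<^bsub>U\<^esub> u \<squnion>\<^bsub>U\<^esub> vzero U))" for u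
  have P_inj: "a \<squnion>\<^bsub>U\<^esub> vzero U = b \<squnion>\<^bsub>U\<^esub> vzero U"
    if "a \<in> carrier U" "b \<in> carrier U" "P (a \<squnion>\<^bsub>U\<^esub> vzero U) = P (b \<squnion>\<^bsub>U\<^esub> vzero U)" for a b
  proof -
    have "is_lub U (c \<squnion>\<^bsub>U\<^esub> vzero U) (\<mu> ` P (c \<squnion>\<^bsub>U\<^esub> vzero U))" if "c \<in> carrier U" for c
      using that by (intro lub) (auto intro: zero_closed join_right join_closed)
    then show ?thesis
      using that least_unique by metis
  qed
  have "inj_on e (carrier U)"
    by (rule inj_onI) (auto simp: e_def intro!: eq_if_parts_eq P_inj scale_closed)
  then show ?thesis
    using copy_universal_completion[OF U _ assms] copy_isomorphic[OF U] by blast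
qed

lemma riesz_isomorphic_trans:
  assumes "riesz_isomorphic R S" "riesz_isomorphic S T"
  shows "riesz_isomorphic R T"
proof -
  obtain h k where h: "riesz_hom R S h" "bij_betw h (carrier R) (carrier S)"
    and k: "riesz_hom S T k" "bij_betw k (carrier S) (carrier T)"
    using assms by (auto simp: riesz_isomorphic_def)
  have "riesz_hom R T (k \<circ> h)"
    using h(1) k(1) by (auto simp: riesz_hom_def Pi_iff)
  then show ?thesis
    using bij_betw_trans[OF h(2) k(2)] by (auto simp: riesz_isomorphic_def)
qed

lemma riesz_isomorphic_sym:
  assumes "riesz_space R" "riesz_isomorphic R S"
  shows "riesz_isomorphic S R"
proof -
  interpret riesz_space R by (rule assms(1))
  obtain h where h: "riesz_hom R S h" and bij: "bij_betw h (carrier R) (carrier S)"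
    using assms(2) by (auto simp: riesz_isomorphic_def)
  define k where "k = inv_into (carrier R) h"
  have k: "k x \<in> carrier R" "h (k x) = x" if "x \<in> carrier S" for x
    using bij that by (auto simp: k_def bij_betw_def inv_into_into f_inv_into_f)
  have kI: "k y = x" if "x \<in> carrier R" "y = h x" for x y
    using bij that by (auto simp: k_def bij_betw_def)
  have "riesz_hom S R k"
    using h k unfolding riesz_hom_def
    by (auto intro!: kI simp: add_closed scale_closed)
  moreover have "bij_betw k (carrier S) (carrier R)"
    unfolding k_def by (rule bij_betw_inv_into[OF bij])
  ultimately show ?thesis
    by (auto simp: riesz_isomorphic_def)
qed

lemma isomorphic_universal_completionsI:
  assumes "universal_completion R U \<mu>" "universal_completion S V \<nu>" "riesz_isomorphic U V"
  shows "isomorphic_universal_completions R S"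
proof -
  have "riesz_space U"
    using assms by (simp add: universal_completion_def universally_complete_def)
  then show ?thesis
    using universal_completion_copy[OF assms(1)] universal_completion_copy[OF assms(2)] assms(3)
    unfolding isomorphic_universal_completions_def
    by (meson riesz_isomorphic_sym riesz_isomorphic_trans)
qed


section \<open>Regular open sets\<close>

definition regular_opens :: "'a topology \<Rightarrow> 'a set gorder" where
  "regular_opens X =
     \<lparr>carrier = {U. openin X U \<and> X interior_of (X closure_of U) = U}, eq = (=), le = (\<subseteq>)\<rparr>"

text \<open>Complements in a Boolean algebra are unique, so they are preserved automatically.\<close>

definition boolean_isomorphic :: "'a gorder \<Rightarrow> 'b gorder \<Rightarrow> bool" where
  "boolean_isomorphic L M \<longleftrightarrow>
     (\<exists>h. bij_betw h (carrier L) (carrier M) \<and>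
        h \<bottom>\<^bsub>L\<^esub> = \<bottom>\<^bsub>M\<^esub> \<and> h \<top>\<^bsub>L\<^esub> = \<top>\<^bsub>M\<^esub> \<and>
        (\<forall>x\<in>carrier L. \<forall>y\<in>carrier L. h (x \<squnion>\<^bsub>L\<^esub> y) = h x \<squnion>\<^bsub>M\<^esub> h y) \<and>
        (\<forall>x\<in>carrier L. \<forall>y\<in>carrier L. h (x \<sqinter>\<^bsub>L\<^esub> y) = h x \<sqinter>\<^bsub>M\<^esub> h y))"


section \<open>Continuous real functions on a space\<close>

text \<open>Functions on \<open>X\<close> are represented by functions that are \<open>undefined\<close> outside \<open>topspace X\<close>.\<close>

definition cont_riesz :: "'a topology \<Rightarrow> ('a \<Rightarrow> real) riesz" where
  "cont_riesz X =
     \<lparr>carrier = {f \<in> extensional (topspace X). continuous_map X euclideanreal f},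
      eq = (=),
      le = (\<lambda>f g. \<forall>x\<in>topspace X. f x \<le> g x),
      vzero = (\<lambda>x\<in>topspace X. 0),
      vadd = (\<lambda>f g. \<lambda>x\<in>topspace X. f x + g x),
      vscale = (\<lambda>c f. \<lambda>x\<in>topspace X. c * f x)\<rparr>"


section \<open>Continuous real functions on a frame\<close>

text \<open>
  By the universal property of the presentation of the frame of reals, a frame homomorphism
  \<open>f\<close> from it to \<open>M\<close> is a pair of maps \<open>p \<mapsto> f(p,-)\<close> and \<open>q \<mapsto> f(-,q)\<close> on the generators that turns
  the defining relations into identities of \<open>M\<close>.
\<close>

type_synonym 'm frame_real = "(rat \<Rightarrow> 'm) \<times> (rat \<Rightarrow> 'm)"

definition frame_reals :: "'m gorder \<Rightarrow> 'm frame_real set" where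
  "frame_reals M = {(l, u).
     range l \<subseteq> carrier M \<and> range u \<subseteq> carrier M \<and>
     (\<forall>p q. q \<le> p \<longrightarrow> l p \<sqinter>\<^bsub>M\<^esub> u q = \<bottom>\<^bsub>M\<^esub>) \<and>
     (\<forall>p q. p < q \<longrightarrow> l p \<squnion>\<^bsub>M\<^esub> u q = \<top>\<^bsub>M\<^esub>) \<and>
     (\<forall>p. l p = \<Squnion>\<^bsub>M\<^esub>{l q |q. p < q}) \<and>
     (\<forall>p. u p = \<Squnion>\<^bsub>M\<^esub>{u q |q. q < p}) \<and>
     \<Squnion>\<^bsub>M\<^esub>(range l) = \<top>\<^bsub>M\<^esub> \<and> \<Squnion>\<^bsub>M\<^esub>(range u) = \<top>\<^bsub>M\<^esub>}"

definition frame_real_le :: "'m gorder \<Rightarrow> 'm frame_real \<Rightarrow> 'm frame_real \<Rightarrow> bool" where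
  "frame_real_le M f g \<longleftrightarrow> (\<forall>p. fst f p \<sqsubseteq>\<^bsub>M\<^esub> fst g p)"

definition frame_real_zero :: "'m gorder \<Rightarrow> 'm frame_real" where
  "frame_real_zero M =
     (\<lambda>p. if p < 0 then \<top>\<^bsub>M\<^esub> else \<bottom>\<^bsub>M\<^esub>, \<lambda>q. if 0 < q then \<top>\<^bsub>M\<^esub> else \<bottom>\<^bsub>M\<^esub>)"

definition frame_real_add :: "'m gorder \<Rightarrow> 'm frame_real \<Rightarrow> 'm frame_real \<Rightarrow> 'm frame_real" where
  "frame_real_add M f g =
     (\<lambda>p. \<Squnion>\<^bsub>M\<^esub>{fst f r \<sqinter>\<^bsub>M\<^esub> fst g (p - r) |r. True},
      \<lambda>q. \<Squnion>\<^bsub>M\<^esub>{snd f s \<sqinter>\<^bsub>M\<^esub> snd g (q - s) |s. True})"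

definition frame_real_neg :: "'m frame_real \<Rightarrow> 'm frame_real" where
  "frame_real_neg f = (\<lambda>p. snd f (- p), \<lambda>q. fst f (- q))"

definition frame_real_scale_pos :: "'m gorder \<Rightarrow> real \<Rightarrow> 'm frame_real \<Rightarrow> 'm frame_real" where
  "frame_real_scale_pos M c f =
     (\<lambda>p. \<Squnion>\<^bsub>M\<^esub>{fst f r |r. c * real_of_rat r > real_of_rat p},
      \<lambda>q. \<Squnion>\<^bsub>M\<^esub>{snd f s |s. c * real_of_rat s < real_of_rat q})"

definition frame_real_scale :: "'m gorder \<Rightarrow> real \<Rightarrow> 'm frame_real \<Rightarrow> 'm frame_real" where
  "frame_real_scale M c f =
     (if c > 0 then frame_real_scale_pos M c f
      else if c = 0 then frame_real_zero M
      else frame_real_neg (frame_real_scale_pos M (- c) f))"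

definition frame_real_riesz :: "'m gorder \<Rightarrow> 'm frame_real riesz" where
  "frame_real_riesz M =
     \<lparr>carrier = frame_reals M, eq = (=), le = frame_real_le M,
      vzero = frame_real_zero M, vadd = frame_real_add M, vscale = frame_real_scale M\<rparr>"


section \<open>Nearly finite Hausdorff continuous functions\<close>

definition ext_intervals :: "ereal set set" where
  "ext_intervals = {{a..b} |a b. a \<le> b}"

text \<open>
  The whole space is listed explicitly among the generating sets, since the interval
  \<open>[-\<infinity>, \<infinity>]\<close> lies in none of the others.
\<close>

definition interval_topology :: "ereal set topology" where
  "interval_topology = topology_generated_by
     ({ext_intervals} \<union>
      range (\<lambda>p :: rat. {a \<in> ext_intervals. Inf a > ereal (real_of_rat p)}) \<union>
      range (\<lambda>q :: rat. {a \<in> ext_intervals. Sup a < ereal (real_of_rat q)}))"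

definition interval_cont :: "'a topology \<Rightarrow> ('a \<Rightarrow> ereal set) set" where
  "interval_cont X = {f \<in> extensional (topspace X). continuous_map X interval_topology f}"

definition interval_le :: "'a topology \<Rightarrow> ('a \<Rightarrow> ereal set) \<Rightarrow> ('a \<Rightarrow> ereal set) \<Rightarrow> bool" where
  "interval_le X f g \<longleftrightarrow> (\<forall>x\<in>topspace X. Inf (f x) \<le> Inf (g x) \<and> Sup (f x) \<le> Sup (g x))"

definition interval_refines :: "'a topology \<Rightarrow> ('a \<Rightarrow> ereal set) \<Rightarrow> ('a \<Rightarrow> ereal set) \<Rightarrow> bool" where
  "interval_refines X f g \<longleftrightarrow> (\<forall>x\<in>topspace X. g x \<subseteq> f x)"

definition hausdorff_continuous :: "'a topology \<Rightarrow> ('a \<Rightarrow> ereal set) \<Rightarrow> bool" where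
  "hausdorff_continuous X f \<longleftrightarrow>
     f \<in> interval_cont X \<and> (\<forall>g\<in>interval_cont X. interval_refines X f g \<longrightarrow> g = f)"

definition nearly_finite_interval :: "'a topology \<Rightarrow> ('a \<Rightarrow> ereal set) \<Rightarrow> bool" where
  "nearly_finite_interval X f \<longleftrightarrow>
     X closure_of {x \<in> topspace X. \<bar>Inf (f x)\<bar> \<noteq> \<infinity> \<and> \<bar>Sup (f x)\<bar> \<noteq> \<infinity>} = topspace X"

definition Hnf :: "'a topology \<Rightarrow> ('a \<Rightarrow> ereal set) set" where
  "Hnf X = {f. hausdorff_continuous X f \<and> nearly_finite_interval X f}"

definition Hnf_to_frame :: "'a topology \<Rightarrow> ('a \<Rightarrow> ereal set) \<Rightarrow> 'a set frame_real" where
  "Hnf_to_frame X f =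
     (\<lambda>p. X interior_of (X closure_of {x \<in> topspace X. Inf (f x) > ereal (real_of_rat p)}),
      \<lambda>q. X interior_of (X closure_of {x \<in> topspace X. Sup (f x) < ereal (real_of_rat q)}))"

text \<open>
  \<open>Hnf_to_frame X\<close> is an order isomorphism onto the continuous real functions on the frame
  \<open>regular_opens X\<close>; the linear operations are transported along it.
\<close>

definition Hnf_riesz :: "'a topology \<Rightarrow> ('a \<Rightarrow> ereal set) riesz" where
  "Hnf_riesz X =
     (let F = frame_real_riesz (regular_opens X);
          \<Phi> = Hnf_to_frame X;
          \<Psi> = inv_into (Hnf X) \<Phi>
      in \<lparr>carrier = Hnf X,
          eq = (=),
          le = interval_le X,
          vzero = \<Psi> (vzero F),
          vadd = (\<lambda>f g. \<Psi> (\<Phi> f \<boxplus>\<^bsub>F\<^esub> \<Phi> g)),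
          vscale = (\<lambda>c f. \<Psi> (c \<boxdot>\<^bsub>F\<^esub> \<Phi> f))\<rparr>)"


section \<open>Nearly finite normal lower semicontinuous functions\<close>

definition nhds_in :: "'a topology \<Rightarrow> 'a \<Rightarrow> 'a set set" where
  "nhds_in X x = {V. V \<subseteq> topspace X \<and> x \<in> X interior_of V}"

definition lower_baire :: "'a topology \<Rightarrow> ('a \<Rightarrow> ereal) \<Rightarrow> 'a \<Rightarrow> ereal" where
  "lower_baire X u = (\<lambda>x\<in>topspace X. SUP V\<in>nhds_in X x. INF y\<in>V. u y)"

definition upper_baire :: "'a topology \<Rightarrow> ('a \<Rightarrow> ereal) \<Rightarrow> 'a \<Rightarrow> ereal" where
  "upper_baire X u = (\<lambda>x\<in>topspace X. INF V\<in>nhds_in X x. SUP y\<in>V. u y)"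

definition NL :: "'a topology \<Rightarrow> ('a \<Rightarrow> ereal) set" where
  "NL X = {u \<in> extensional (topspace X).
     lower_baire X (upper_baire X u) = u \<and>
     X closure_of {x \<in> topspace X. \<bar>u x\<bar> \<noteq> \<infinity>} = topspace X}"

text \<open>
  Undefined pointwise expressions may be given any value; here they get the values of the total
  operations on \<open>ereal\<close>, namely \<open>\<infinity> + (- \<infinity>) = \<infinity>\<close> and \<open>0 * (\<plusminus> \<infinity>) = 0\<close>.
\<close>

definition NL_riesz :: "'a topology \<Rightarrow> ('a \<Rightarrow> ereal) riesz" where
  "NL_riesz X =
     \<lparr>carrier = NL X,
      eq = (=),
      le = (\<lambda>u v. \<forall>x\<in>topspace X. u x \<le> v x),
      vzero = (\<lambda>x\<in>topspace X. 0),
      vadd = (\<lambda>u v. lower_baire X (upper_baire X (\<lambda>x\<in>topspace X. u x + v x))),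
      vscale = (\<lambda>c u. lower_baire X (upper_baire X (\<lambda>x\<in>topspace X. ereal c * u x)))\<rparr>"

end

theory Submission
  imports Defs
begin

text \<open>
  All the Riesz spaces in question are quotients of one and the same space of real functions on \<open>X\<close>,
  with pointwise operations: the functions that are, for every \<open>e > 0\<close>, constant up to \<open>e\<close> on the
  members of a \<open>\<pi>\<close>-base of \<open>X\<close>.  Two of them are identified if, for every \<open>e > 0\<close>, they differ by at
  most \<open>e\<close> on a dense open set.  Such a function \<open>f\<close> represents the normal lower semicontinuous
  function \<open>I S f\<close>, the Hausdorff continuous function \<open>[I S f, S I S f]\<close>, and the frame homomorphism
  determined by the sets \<open>int cl {f > p}\<close>.  Hence, for fixed \<open>X\<close>, these three Riesz spaces are
  isomorphic, and the last one depends only on the regular open sets.  If \<open>X\<close> is completely regular,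
  the quotient is a universal completion of \<open>C(X)\<close>.  Conversely, every universal completion \<open>U\<close> of
  \<open>C(X)\<close> determines the regular open sets, because two positive elements of \<open>U\<close> are disjoint if and
  only if their supports, the unions of the cozero sets of the continuous functions below them, are.
\<close>

section \<open>Regular open sets\<close>

text \<open>\<open>X\<close> may fail to be a Baire space, so the dense open sets that belong to
  different errors \<open>e\<close> can have empty intersection, and no single dense set serves all
  \<open>e\<close>. On the rationals, the function sending a reduced fraction p/q with q > 0 to 1/q
  is positive everywhere and continuous nowhere, yet it represents zero. Hence the error is fixed in
  advance, a given nonempty open set is shrunk to a piece on which finitely many estimates hold, and
  open sets are compared by which open sets they meet; open sets that meet the same open sets have
  the same regularization. Real-valued representatives keep infinite values out: a nearly finite
  function is finite and nearly constant on such pieces, and its values off them disappear in the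
  quotient. Condition (4) speaks of some pair of universal completions, so the regular open sets are
  recovered from an isomorphism between arbitrary ones. As the spaces in (2) and (3) are themselves
  universal completions, this one argument settles all implications towards (1).\<close>

lemma is_lub_iff:
  assumes "A \<subseteq> carrier L"
  shows "is_lub L s A \<longleftrightarrow> s \<in> carrier L \<and> (\<forall>x\<in>A. x \<sqsubseteq>\<^bsub>L\<^esub> s) \<and>
    (\<forall>y\<in>carrier L. (\<forall>x\<in>A. x \<sqsubseteq>\<^bsub>L\<^esub> y) \<longrightarrow> s \<sqsubseteq>\<^bsub>L\<^esub> y)"
  using assms by (auto simp: least_def Upper_def subset_iff)

lemma is_glb_iff:
  assumes "A \<subseteq> carrier L"
  shows "is_glb L s A \<longleftrightarrow> s \<in> carrier L \<and> (\<forall>x\<in>A. s \<sqsubseteq>\<^bsub>L\<^esub> x) \<and>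
    (\<forall>y\<in>carrier L. (\<forall>x\<in>A. y \<sqsubseteq>\<^bsub>L\<^esub> x) \<longrightarrow> y \<sqsubseteq>\<^bsub>L\<^esub> s)"
  using assms by (auto simp: greatest_def Lower_def subset_iff)

context partial_order
begin

lemma sup_eqI: "is_lub L s A \<Longrightarrow> \<Squnion>A = s"
  unfolding sup_def by (rule some_equality) (auto intro: least_unique)

lemma inf_eqI: "is_glb L s A \<Longrightarrow> \<Sqinter>A = s"
  unfolding inf_def by (rule some_equality) (auto intro: greatest_unique)

lemma bottom_eqI: "b \<in> carrier L \<Longrightarrow> (\<And>x. x \<in> carrier L \<Longrightarrow> b \<sqsubseteq> x) \<Longrightarrow> \<bottom> = b"
  unfolding bottom_def by (rule some_equality) (auto simp: least_def)

lemma top_eqI: "b \<in> carrier L \<Longrightarrow> (\<And>x. x \<in> carrier L \<Longrightarrow> x \<sqsubseteq> b) \<Longrightarrow> \<top> = b"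
  unfolding top_def by (rule some_equality) (auto simp: greatest_def)

end

section \<open>Regularization, tested by the open sets that a set meets\<close>

definition regularize :: "'a topology \<Rightarrow> 'a set \<Rightarrow> 'a set" where
  "regularize X A = X interior_of (X closure_of A)"

lemma openin_regularize: "openin X (regularize X A)"
  by (simp add: regularize_def)

lemma regularize_increasing: "openin X A \<Longrightarrow> A \<subseteq> regularize X A"
  unfolding regularize_def
  by (simp add: closure_of_subset interior_of_maximal openin_subset)

lemma regularize_mono: "A \<subseteq> B \<Longrightarrow> regularize X A \<subseteq> regularize X B"
  unfolding regularize_def by (simp add: closure_of_mono interior_of_mono)

text \<open>An open set that misses \<open>A\<close> misses its closure. Together with
  \<open>subset_regularizeI\<close> this reduces inclusions and equations between regularizations to
  the question which open sets meet which sets.\<close>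

lemma regularize_meets:
  assumes "openin X V" "V \<inter> regularize X A \<noteq> {}"
  shows "V \<inter> A \<noteq> {}"
  using assms openin_Int_closure_of_eq_empty[OF assms(1), of A]
    interior_of_subset[of X "X closure_of A"]
  unfolding regularize_def by blast

lemma meets_regularize_iff:
  assumes "openin X V" "openin X A"
  shows "V \<inter> regularize X A \<noteq> {} \<longleftrightarrow> V \<inter> A \<noteq> {}"
  using regularize_meets[OF assms(1)] regularize_increasing[OF assms(2)] by blast

text \<open>It suffices to test open sets inside \<open>A\<close>: a neighbourhood \<open>T\<close>
  of a point of \<open>A\<close> may be replaced by \<open>T \<inter> A\<close>. So \<open>A\<close>
  lies in the closure of \<open>B\<close> and, being open, in the interior of that closure.\<close>

lemma subset_regularizeI:
  assumes "openin X A" "\<And>V. openin X V \<Longrightarrow> V \<noteq> {} \<Longrightarrow> V \<subseteq> A \<Longrightarrow> V \<inter> B \<noteq> {}"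
  shows "A \<subseteq> regularize X B"
proof -
  have "x \<in> X closure_of B" if "x \<in> A" for x
    unfolding in_closure_of
  proof (intro conjI allI impI)
    show "x \<in> topspace X"
      using that assms(1) openin_subset by blast
    fix T assume "x \<in> T \<and> openin X T"
    then have "(T \<inter> A) \<inter> B \<noteq> {}"
      using that assms by (intro assms(2)) auto
    then show "\<exists>y. y \<in> B \<and> y \<in> T" by blast
  qed
  then show ?thesis
    unfolding regularize_def using assms(1) by (intro interior_of_maximal subsetI)
qed

lemma regularize_subsetI:
  assumes "\<And>V. openin X V \<Longrightarrow> V \<inter> A \<noteq> {} \<Longrightarrow> V \<inter> B \<noteq> {}"
  shows "regularize X A \<subseteq> regularize X B"
proof (rule subset_regularizeI[OF openin_regularize])
  fix V assume "openin X V" "V \<noteq> {}" "V \<subseteq> regularize X A"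
  then have "V \<inter> A \<noteq> {}"
    using regularize_meets[of X V A] by blast
  then show "V \<inter> B \<noteq> {}"
    using assms \<open>openin X V\<close> by simp
qed

lemma regularize_eqI:
  assumes "\<And>V. openin X V \<Longrightarrow> V \<inter> A \<noteq> {} \<longleftrightarrow> V \<inter> B \<noteq> {}"
  shows "regularize X A = regularize X B"
  by (intro equalityI regularize_subsetI) (use assms in simp_all)

lemma regularize_idem: "regularize X (regularize X A) = regularize X A"
proof (rule equalityI)
  show "regularize X (regularize X A) \<subseteq> regularize X A"
    by (rule subset_regularizeI[OF openin_regularize])
      (metis openin_Int openin_regularize regularize_meets inf.orderE)
qed (rule regularize_increasing[OF openin_regularize])

text \<open>\<open>V\<close> is cut down twice: it meets \<open>A\<close>, and then
  \<open>V \<inter> A\<close> is a nonempty open subset of \<open>regularize X B\<close>, so it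
  meets \<open>B\<close>.\<close>

lemma regularize_Int:
  assumes "openin X A" "openin X B"
  shows "regularize X A \<inter> regularize X B = regularize X (A \<inter> B)"
proof (rule equalityI)
  show "regularize X A \<inter> regularize X B \<subseteq> regularize X (A \<inter> B)"
  proof (rule subset_regularizeI)
    fix V assume V: "openin X V" "V \<noteq> {}" "V \<subseteq> regularize X A \<inter> regularize X B"
    then have "V \<inter> A \<noteq> {}" using regularize_meets[of X V A] by blast
    moreover have "openin X (V \<inter> A)" using V assms by blast
    ultimately have "(V \<inter> A) \<inter> B \<noteq> {}" using V regularize_meets[of X "V \<inter> A" B] by blast
    then show "V \<inter> (A \<inter> B) \<noteq> {}" by blast
  qed (intro openin_Int openin_regularize)
qed (simp add: regularize_mono)

text \<open>An open set meets a union if and only if it meets a member, and for the members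
  regularization does not change what meets them.\<close>

lemma regularize_Union_image:
  fixes X :: "'a topology"
  assumes "\<And>i. i \<in> I \<Longrightarrow> openin X (A i)"
  shows "regularize X (\<Union>i\<in>I. regularize X (A i)) = regularize X (\<Union>i\<in>I. A i)"
proof (rule regularize_eqI)
  fix V assume V: "openin X V"
  have "V \<inter> (\<Union>i\<in>I. B i) \<noteq> {} \<longleftrightarrow> (\<exists>i\<in>I. V \<inter> B i \<noteq> {})" for B :: "_ \<Rightarrow> 'a set"
    by blast
  then show "V \<inter> (\<Union>i\<in>I. regularize X (A i)) \<noteq> {} \<longleftrightarrow> V \<inter> (\<Union>i\<in>I. A i) \<noteq> {}"
    using meets_regularize_iff[OF V assms] by simp
qed

lemma regularize_empty [simp]: "regularize X {} = {}"
  by (simp add: regularize_def)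

lemma regularize_topspace [simp]: "regularize X (topspace X) = topspace X"
  by (simp add: regularize_def)

lemma regularize_eq_topspace_iff:
  "regularize X A = topspace X \<longleftrightarrow> (\<forall>V. openin X V \<longrightarrow> V \<noteq> {} \<longrightarrow> V \<inter> A \<noteq> {})"
proof
  assume eq: "regularize X A = topspace X"
  show "\<forall>V. openin X V \<longrightarrow> V \<noteq> {} \<longrightarrow> V \<inter> A \<noteq> {}"
  proof (intro allI impI)
    fix V assume "openin X V" "V \<noteq> {}"
    then show "V \<inter> A \<noteq> {}"
      using regularize_meets[of X V A] openin_subset[of X V] eq by (simp add: Int_absorb2)
  qed
next
  assume "\<forall>V. openin X V \<longrightarrow> V \<noteq> {} \<longrightarrow> V \<inter> A \<noteq> {}"
  then have "topspace X \<subseteq> regularize X A"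
    by (intro subset_regularizeI openin_topspace) blast
  then show "regularize X A = topspace X"
    using openin_subset[OF openin_regularize[of X A]] by (intro equalityI)
qed

section \<open>The lattice operations of the algebra of regular open sets\<close>

abbreviation RO :: "'a topology \<Rightarrow> 'a set set" where
  "RO X \<equiv> carrier (regular_opens X)"

lemma carrier_regular_opens:
  "U \<in> RO X \<longleftrightarrow> openin X U \<and> regularize X U = U"
  by (simp add: regular_opens_def regularize_def)

lemma regularize_closed: "regularize X A \<in> RO X"
  by (simp add: carrier_regular_opens openin_regularize regularize_idem)

lemma le_regular_opens: "le (regular_opens X) = (\<subseteq>)"
  by (simp add: regular_opens_def)

lemma partial_order_regular_opens: "partial_order (regular_opens X)"
  by unfold_locales (simp_all add: regular_opens_def)

lemma bottom_regular_opens: "\<bottom>\<^bsub>regular_opens X\<^esub> = {}"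
  by (rule partial_order.bottom_eqI[OF partial_order_regular_opens]) (auto simp: carrier_regular_opens le_regular_opens)

lemma top_regular_opens: "\<top>\<^bsub>regular_opens X\<^esub> = topspace X"
  by (rule partial_order.top_eqI[OF partial_order_regular_opens])
    (auto simp: carrier_regular_opens le_regular_opens dest: openin_subset)

lemma sup_regular_opens:
  assumes "A \<subseteq> RO X"
  shows "\<Squnion>\<^bsub>regular_opens X\<^esub>A = regularize X (\<Union>A)"
proof (rule partial_order.sup_eqI[OF partial_order_regular_opens])
  have "openin X (\<Union>A)"
    using assms by (intro openin_Union) (auto simp: carrier_regular_opens)
  then have "\<forall>x\<in>A. x \<subseteq> regularize X (\<Union>A)"
    using regularize_increasing[of X "\<Union>A"] by blast
  moreover have "regularize X (\<Union>A) \<subseteq> y"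
    if "y \<in> RO X" "\<forall>x\<in>A. x \<subseteq> y" for y
    using that regularize_mono[of "\<Union>A" y X] by (auto simp: carrier_regular_opens)
  ultimately show "is_lub (regular_opens X) (regularize X (\<Union>A)) A"
    using assms by (subst is_lub_iff) (auto simp: regularize_closed le_regular_opens)
qed

lemma join_regular_opens:
  assumes "U \<in> RO X" "V \<in> RO X"
  shows "U \<squnion>\<^bsub>regular_opens X\<^esub> V = regularize X (U \<union> V)"
  using assms by (simp add: join_def sup_regular_opens)

lemma Int_regular_opens_closed:
  assumes "U \<in> RO X" "V \<in> RO X"
  shows "U \<inter> V \<in> RO X"
  using assms regularize_Int[of X U V] by (auto simp: carrier_regular_opens)

lemma meet_regular_opens:
  assumes "U \<in> RO X" "V \<in> RO X"
  shows "U \<sqinter>\<^bsub>regular_opens X\<^esub> V = U \<inter> V"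
  unfolding meet_def
  using assms by (intro partial_order.inf_eqI[OF partial_order_regular_opens], subst is_glb_iff)
    (auto simp: le_regular_opens Int_regular_opens_closed)

section \<open>Quasi-continuous real functions\<close>

text \<open>Density in the poset of nonempty open sets under inclusion: the sets with
  \<open>P\<close> form a \<pi>-base. The properties used below pass to smaller open sets, so
  finitely many of them can be made to hold together by shrinking one after the other.\<close>

definition densely :: "'a topology \<Rightarrow> ('a set \<Rightarrow> bool) \<Rightarrow> bool" where
  "densely X P \<longleftrightarrow>
     (\<forall>V. openin X V \<longrightarrow> V \<noteq> {} \<longrightarrow> (\<exists>W. openin X W \<and> W \<noteq> {} \<and> W \<subseteq> V \<and> P W))"

lemma denselyE:
  assumes "densely X P" "openin X V" "V \<noteq> {}"
  obtains W where "openin X W" "W \<noteq> {}" "W \<subseteq> V" "P W"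
  using assms unfolding densely_def by blast

lemma denselyI:
  assumes "\<And>V. openin X V \<Longrightarrow> V \<noteq> {} \<Longrightarrow> \<exists>W. openin X W \<and> W \<noteq> {} \<and> W \<subseteq> V \<and> P W"
  shows "densely X P"
  using assms unfolding densely_def by blast

text \<open>The piece and the constant both depend on \<open>e\<close>. The functions are total, and
  the condition examines them on open subsets of \<open>X\<close> only, so different values off
  \<open>topspace X\<close> give different representatives of the same class.\<close>

definition quasi_reals :: "'a topology \<Rightarrow> ('a \<Rightarrow> real) set" where
  "quasi_reals X = {f. \<forall>e>0. densely X (\<lambda>W. \<exists>c. \<forall>x\<in>W. \<bar>f x - c\<bar> \<le> e)}"

definition ess_le :: "'a topology \<Rightarrow> ('a \<Rightarrow> real) \<Rightarrow> ('a \<Rightarrow> real) \<Rightarrow> bool" where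
  "ess_le X f g \<longleftrightarrow> (\<forall>e>0. densely X (\<lambda>W. \<forall>x\<in>W. f x \<le> g x + e))"

lemma quasi_realsE:
  assumes "f \<in> quasi_reals X" "0 < e" "openin X V" "V \<noteq> {}"
  obtains W c where "openin X W" "W \<noteq> {}" "W \<subseteq> V" "\<And>x. x \<in> W \<Longrightarrow> \<bar>f x - c\<bar> \<le> e"
proof -
  have "densely X (\<lambda>W. \<exists>c. \<forall>x\<in>W. \<bar>f x - c\<bar> \<le> e)"
    using assms by (simp add: quasi_reals_def)
  then show ?thesis
    using assms(3,4) that by (elim denselyE) auto
qed

lemma quasi_realsI:
  assumes "\<And>e V. 0 < e \<Longrightarrow> openin X V \<Longrightarrow> V \<noteq> {} \<Longrightarrow>
    \<exists>W c. openin X W \<and> W \<noteq> {} \<and> W \<subseteq> V \<and> (\<forall>x\<in>W. \<bar>f x - c\<bar> \<le> e)"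
  shows "f \<in> quasi_reals X"
  unfolding quasi_reals_def using assms by (auto intro!: denselyI)

lemma ess_leE:
  assumes "ess_le X f g" "0 < e" "openin X V" "V \<noteq> {}"
  obtains W where "openin X W" "W \<noteq> {}" "W \<subseteq> V" "\<And>x. x \<in> W \<Longrightarrow> f x \<le> g x + e"
proof -
  have "densely X (\<lambda>W. \<forall>x\<in>W. f x \<le> g x + e)"
    using assms by (simp add: ess_le_def)
  then show ?thesis
    using assms(3,4) that by (elim denselyE) auto
qed

lemma ess_leI:
  assumes "\<And>e V. 0 < e \<Longrightarrow> openin X V \<Longrightarrow> V \<noteq> {} \<Longrightarrow>
    \<exists>W. openin X W \<and> W \<noteq> {} \<and> W \<subseteq> V \<and> (\<forall>x\<in>W. f x \<le> g x + e)"
  shows "ess_le X f g"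
  unfolding ess_le_def using assms by (auto intro!: denselyI)

text \<open>A Lipschitz operation keeps nearly constant functions nearly constant; sums, maxima,
  minima and multiples are all instances.\<close>

lemma quasi_reals_combine:
  assumes f: "f \<in> quasi_reals X" and g: "g \<in> quasi_reals X" and K: "0 < K"
    and F: "\<And>a b c d. \<bar>F a b - F c d\<bar> \<le> K * (\<bar>a - c\<bar> + \<bar>b - d\<bar>)"
  shows "(\<lambda>x. F (f x) (g x)) \<in> quasi_reals X"
proof (rule quasi_realsI)
  fix e :: real and V assume e: "0 < e" and V: "openin X V" "V \<noteq> {}"
  \<comment> \<open>Two errors of size \<open>d\<close>, enlarged by the factor \<open>K\<close>,
    add up to \<open>e\<close>.\<close>
  define d where "d = e / (2 * K)"
  have d: "0 < d" using e K by (simp add: d_def)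
  obtain W b where W: "openin X W" "W \<noteq> {}" "W \<subseteq> V" "\<And>x. x \<in> W \<Longrightarrow> \<bar>f x - b\<bar> \<le> d"
    using quasi_realsE[OF f d V] by blast
  obtain W' c where W': "openin X W'" "W' \<noteq> {}" "W' \<subseteq> W" "\<And>x. x \<in> W' \<Longrightarrow> \<bar>g x - c\<bar> \<le> d"
    using quasi_realsE[OF g d W(1,2)] by blast
  have "\<bar>F (f x) (g x) - F b c\<bar> \<le> e" if x: "x \<in> W'" for x
  proof -
    have "\<bar>f x - b\<bar> + \<bar>g x - c\<bar> \<le> d + d"
      using W(4) W'(3,4) x by (intro add_mono) auto
    then have "K * (\<bar>f x - b\<bar> + \<bar>g x - c\<bar>) \<le> K * (d + d)"
      using K by (intro mult_left_mono) auto
    also have "K * (d + d) = e" using K by (simp add: d_def)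
    finally show ?thesis using F[of "f x" "g x" b c] by linarith
  qed
  then show "\<exists>W c. openin X W \<and> W \<noteq> {} \<and> W \<subseteq> V \<and> (\<forall>x\<in>W. \<bar>F (f x) (g x) - c\<bar> \<le> e)"
    using W W' by blast
qed

lemma quasi_reals_const: "(\<lambda>x. c) \<in> quasi_reals X"
proof (rule quasi_realsI)
  fix e :: real and V assume "0 < e" "openin X V" "V \<noteq> {}"
  then show "\<exists>W c'. openin X W \<and> W \<noteq> {} \<and> W \<subseteq> V \<and> (\<forall>x\<in>W. \<bar>c - c'\<bar> \<le> e)"
    by (intro exI[of _ V] exI[of _ c]) auto
qed

lemma quasi_reals_add:
  assumes "f \<in> quasi_reals X" "g \<in> quasi_reals X"
  shows "(\<lambda>x. f x + g x) \<in> quasi_reals X"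
  by (rule quasi_reals_combine[OF assms, where F = "(+)" and K = 1]) auto

lemma quasi_reals_max:
  assumes "f \<in> quasi_reals X" "g \<in> quasi_reals X"
  shows "(\<lambda>x. max (f x) (g x)) \<in> quasi_reals X"
  by (rule quasi_reals_combine[OF assms, where F = "max" and K = 1]) auto

lemma quasi_reals_min:
  assumes "f \<in> quasi_reals X" "g \<in> quasi_reals X"
  shows "(\<lambda>x. min (f x) (g x)) \<in> quasi_reals X"
  by (rule quasi_reals_combine[OF assms, where F = "min" and K = 1]) auto

lemma quasi_reals_scale:
  assumes "f \<in> quasi_reals X"
  shows "(\<lambda>x. c * f x) \<in> quasi_reals X"
\<comment> \<open>A unary operation is treated as a binary one that ignores its second argument. The
  factor is \<open>\<bar>c\<bar> + 1\<close> because \<open>K\<close> has to be positive even for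
  \<open>c = 0\<close>.\<close>
proof (rule quasi_reals_combine[OF assms assms, where F = "\<lambda>a b. c * a" and K = "\<bar>c\<bar> + 1"])
  fix p q r s :: real
  have "\<bar>c * p - c * r\<bar> = \<bar>c\<bar> * \<bar>p - r\<bar>"
    by (simp add: abs_mult flip: right_diff_distrib)
  also have "\<dots> \<le> (\<bar>c\<bar> + 1) * (\<bar>p - r\<bar> + \<bar>q - s\<bar>)"
    by (intro mult_mono) auto
  finally show "\<bar>c * p - c * r\<bar> \<le> (\<bar>c\<bar> + 1) * (\<bar>p - r\<bar> + \<bar>q - s\<bar>)" .
qed auto

lemma quasi_reals_minus:
  assumes "f \<in> quasi_reals X"
  shows "(\<lambda>x. - f x) \<in> quasi_reals X"
  using quasi_reals_scale[OF assms, of "- 1"] by simp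

lemma quasi_reals_continuous:
  assumes "continuous_map X euclideanreal f"
  shows "f \<in> quasi_reals X"
proof (rule quasi_realsI)
  fix e :: real and V assume e: "0 < e" and V: "openin X V" "V \<noteq> {}"
  then obtain y where y: "y \<in> V" by blast
  let ?W = "V \<inter> {x \<in> topspace X. f x \<in> ball (f y) e}"
  have "openin X ?W"
    using V assms by (intro openin_Int openin_continuous_map_preimage[OF assms]) auto
  moreover have "y \<in> ?W"
    using y e V openin_subset by fastforce
  moreover have "\<forall>x\<in>?W. \<bar>f x - f y\<bar> \<le> e"
    by (auto simp: dist_real_def)
  ultimately show "\<exists>W c. openin X W \<and> W \<noteq> {} \<and> W \<subseteq> V \<and> (\<forall>x\<in>W. \<bar>f x - c\<bar> \<le> e)"
    by (intro exI[of _ ?W] exI[of _ "f y"]) blast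
qed

lemma ess_le_if_le:
  assumes "\<And>x. x \<in> topspace X \<Longrightarrow> f x \<le> g x"
  shows "ess_le X f g"
proof (rule ess_leI)
  fix e :: real and V assume e: "0 < e" and V: "openin X V" "V \<noteq> {}"
  have "f x \<le> g x + e" if "x \<in> V" for x
    using that assms[of x] e openin_subset[OF V(1)] by force
  then show "\<exists>W. openin X W \<and> W \<noteq> {} \<and> W \<subseteq> V \<and> (\<forall>x\<in>W. f x \<le> g x + e)"
    using V by blast
qed

text \<open>Shrinking twice gives a piece on which both inequalities hold with error
  \<open>e / K\<close>. What remains to be checked is pointwise, with \<open>K\<close> the factor by
  which the operation enlarges the error: \<open>2\<close> for transitivity, \<open>c + 1\<close>
  for multiples, \<open>1\<close> elsewhere.\<close>

lemma ess_le_combine: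
  assumes fg: "ess_le X f f'" and gg: "ess_le X g g'" and K: "0 < K"
    and F: "\<And>x e. 0 < e \<Longrightarrow> f x \<le> f' x + e \<Longrightarrow> g x \<le> g' x + e \<Longrightarrow> h x \<le> h' x + K * e"
  shows "ess_le X h h'"
proof (rule ess_leI)
  fix e :: real and V assume e: "0 < e" and V: "openin X V" "V \<noteq> {}"
  define d where "d = e / K"
  have d: "0 < d" using e K by (simp add: d_def)
  obtain W where W: "openin X W" "W \<noteq> {}" "W \<subseteq> V" "\<And>x. x \<in> W \<Longrightarrow> f x \<le> f' x + d"
    using ess_leE[OF fg d V] by blast
  obtain W' where W': "openin X W'" "W' \<noteq> {}" "W' \<subseteq> W" "\<And>x. x \<in> W' \<Longrightarrow> g x \<le> g' x + d"
    using ess_leE[OF gg d W(1,2)] by blast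
  have "h x \<le> h' x + e" if "x \<in> W'" for x
    using F[OF d, of x] that W(4) W' K by (auto simp: d_def)
  then show "\<exists>W. openin X W \<and> W \<noteq> {} \<and> W \<subseteq> V \<and> (\<forall>x\<in>W. h x \<le> h' x + e)"
    using W W' by blast
qed

lemma ess_le_refl: "ess_le X f f"
  by (rule ess_le_if_le) simp

lemma ess_le_trans: "ess_le X f g \<Longrightarrow> ess_le X g h \<Longrightarrow> ess_le X f h"
  by (rule ess_le_combine[of X f g g h 2]) auto

lemma ess_le_add_mono: "ess_le X f g \<Longrightarrow> ess_le X (\<lambda>x. f x + h x) (\<lambda>x. g x + h x)"
  by (rule ess_le_combine[of X f g f g 1]) auto

lemma ess_le_scale_mono:
  assumes "ess_le X f g" "0 \<le> c"
  shows "ess_le X (\<lambda>x. c * f x) (\<lambda>x. c * g x)"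
proof (rule ess_le_combine[OF assms(1) assms(1), of "c + 1"])
  fix x and e :: real assume e: "0 < e" "f x \<le> g x + e"
  then have "c * f x \<le> c * (g x + e)"
    using assms by (intro mult_left_mono) auto
  then show "c * f x \<le> c * g x + (c + 1) * e"
    using e by (simp add: algebra_simps)
qed (use assms in auto)

lemma ess_le_max: "ess_le X f h \<Longrightarrow> ess_le X g h \<Longrightarrow> ess_le X (\<lambda>x. max (f x) (g x)) h"
  by (rule ess_le_combine[of X f h g h 1]) auto

lemma ess_le_min: "ess_le X h f \<Longrightarrow> ess_le X h g \<Longrightarrow> ess_le X h (\<lambda>x. min (f x) (g x))"
  by (rule ess_le_combine[of X h f h g 1]) auto

text \<open>This is the set where the lower Baire function of \<open>f\<close> exceeds
  \<open>p\<close>. It can be smaller than the interior of the set where \<open>f\<close> exceeds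
  \<open>p\<close>, since a gap \<open>q - p\<close> is demanded that is uniform on a neighbourhood;
  the gap absorbs the errors that \<open>ess_le\<close> allows.\<close>

definition above :: "'a topology \<Rightarrow> ('a \<Rightarrow> real) \<Rightarrow> real \<Rightarrow> 'a set" where
  "above X f p = \<Union>{V. openin X V \<and> (\<exists>q>p. \<forall>x\<in>V. q \<le> f x)}"

lemma openin_above: "openin X (above X f p)"
  unfolding above_def by (intro openin_Union) auto

lemma above_less: "x \<in> above X f p \<Longrightarrow> p < f x"
  unfolding above_def by force

lemma subset_aboveI:
  assumes "openin X V" "p < q" "\<And>x. x \<in> V \<Longrightarrow> q \<le> f x"
  shows "V \<subseteq> above X f p"
  unfolding above_def using assms by blast

lemma aboveE:
  assumes "x \<in> above X f p"
  obtains V q where "openin X V" "x \<in> V" "p < q" "\<forall>y\<in>V. q \<le> f y"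
  using assms unfolding above_def by blast

lemma above_antimono: "p \<le> q \<Longrightarrow> above X f q \<subseteq> above X f p"
  unfolding above_def by force

lemma above_eq_Union: "above X f p = (\<Union>q\<in>{q. p < real_of_rat q}. above X f (real_of_rat q))"
proof (intro equalityI subsetI)
  fix x assume "x \<in> above X f p"
  then obtain V q where V: "openin X V" "x \<in> V" "p < q" "\<forall>y\<in>V. q \<le> f y"
    by (rule aboveE)
  obtain r where r: "p < of_rat r" "of_rat r < q"
    using of_rat_dense[OF V(3)] by blast
  have "V \<subseteq> above X f (real_of_rat r)"
    using V r by (intro subset_aboveI[of _ _ _ q]) auto
  then show "x \<in> (\<Union>q\<in>{q. p < real_of_rat q}. above X f (real_of_rat q))"
    using V r by blast
next
  fix x assume "x \<in> (\<Union>q\<in>{q. p < real_of_rat q}. above X f (real_of_rat q))"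
  then obtain q where "p < real_of_rat q" "x \<in> above X f (real_of_rat q)"
    by blast
  then show "x \<in> above X f p"
    using above_antimono[of p "real_of_rat q" X f] by auto
qed

text \<open>Half of the gap \<open>q - p\<close> is spent on the error in \<open>ess_le\<close>, the
  other half remains as the gap for \<open>g\<close>.\<close>

lemma above_meets_mono:
  assumes le: "ess_le X f g" and V: "openin X V" and meets: "V \<inter> above X f p \<noteq> {}"
  shows "V \<inter> above X g p \<noteq> {}"
proof -
  obtain x where "x \<in> V" and x: "x \<in> above X f p" using meets by blast
  from x obtain U q where U: "openin X U" "x \<in> U" "p < q" "\<forall>y\<in>U. q \<le> f y"
    by (rule aboveE)
  let ?e = "(q - p) / 2"
  have "0 < ?e" "openin X (V \<inter> U)" "V \<inter> U \<noteq> {}"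
    using U V \<open>x \<in> V\<close> by auto
  then obtain W where W: "openin X W" "W \<noteq> {}" "W \<subseteq> V \<inter> U" "\<And>x. x \<in> W \<Longrightarrow> f x \<le> g x + ?e"
    using ess_leE[OF le] by metis
  have "(p + q) / 2 \<le> g y" if "y \<in> W" for y
  proof -
    have "q \<le> f y" "f y \<le> g y + ?e" using that W U by auto
    then show ?thesis by (simp add: field_simps)
  qed
  then have "W \<subseteq> above X g p"
    using W U by (intro subset_aboveI[of _ _ _ "(p + q) / 2"]) auto
  then show ?thesis using W by blast
qed

text \<open>On a piece where \<open>f\<close> is within \<open>e / 4\<close> of \<open>c\<close> and
  \<open>g\<close> within \<open>e / 4\<close> of \<open>d\<close>, an inequality
  \<open>c - d > e / 2\<close> would leave room for a rational level below \<open>f\<close> and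
  above \<open>g\<close> on the whole piece, which the hypothesis forbids. So the rational levels
  determine the order.\<close>

lemma ess_le_if_above_meets:
  assumes f: "f \<in> quasi_reals X" and g: "g \<in> quasi_reals X"
    and meets: "\<And>V p. openin X V \<Longrightarrow> V \<inter> above X f (real_of_rat p) \<noteq> {} \<Longrightarrow>
      V \<inter> above X g (real_of_rat p) \<noteq> {}"
  shows "ess_le X f g"
proof (rule ess_leI)
  fix e :: real and V assume e: "0 < e" and V: "openin X V" "V \<noteq> {}"
  have e4: "0 < e / 4" using e by simp
  obtain W c where W: "openin X W" "W \<noteq> {}" "W \<subseteq> V" "\<And>x. x \<in> W \<Longrightarrow> \<bar>f x - c\<bar> \<le> e / 4"
    using quasi_realsE[OF f e4 V] by blast
  obtain W' d where W': "openin X W'" "W' \<noteq> {}" "W' \<subseteq> W" "\<And>x. x \<in> W' \<Longrightarrow> \<bar>g x - d\<bar> \<le> e / 4"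
    using quasi_realsE[OF g e4 W(1,2)] by blast
  have bounds: "\<bar>f x - c\<bar> \<le> e / 4" "\<bar>g x - d\<bar> \<le> e / 4" if "x \<in> W'" for x
    using that W(4) W'(3,4) by auto
  have "c - d \<le> e / 2"
  proof (rule ccontr)
    assume "\<not> ?thesis"
    then have "d + e / 4 < c - e / 4" by (simp add: field_simps)
    then obtain p where p: "d + e / 4 < of_rat p" "of_rat p < c - e / 4"
      using of_rat_dense by blast
    have "W' \<subseteq> above X f (of_rat p)"
    proof (rule subset_aboveI[OF W'(1) p(2)])
      show "c - e / 4 \<le> f x" if "x \<in> W'" for x
        using bounds(1)[OF that] by linarith
    qed
    then have "W' \<inter> above X g (of_rat p) \<noteq> {}"
      using W' by (intro meets) auto
    then obtain x where "x \<in> W'" "of_rat p < g x"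
      using above_less[of _ X g "of_rat p"] by blast
    then show False using bounds(2)[of x] p by linarith
  qed
  then have "f x \<le> g x + e" if "x \<in> W'" for x
    using bounds[OF that] by linarith
  then show "\<exists>W. openin X W \<and> W \<noteq> {} \<and> W \<subseteq> V \<and> (\<forall>x\<in>W. f x \<le> g x + e)"
    using W W' by blast
qed

text \<open>The value \<open>0\<close> is only taken on a nowhere dense set, on which the cut is not finite.\<close>

definition cut_fun :: "(real \<Rightarrow> 'a set) \<Rightarrow> 'a \<Rightarrow> real" where
  "cut_fun L x = (if {p. x \<in> L p} \<noteq> {} \<and> bdd_above {p. x \<in> L p} then Sup {p. x \<in> L p} else 0)"

text \<open>An abstract version of the sets where a function exceeds \<open>p\<close>. The levels
  may jump as \<open>p\<close> varies, so the function built from them reproduces the family up to a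
  small shift of \<open>p\<close> and up to regularization. \<open>bounded_L\<close> is the
  finiteness condition: on the pieces it provides, the supremum in \<open>cut_fun\<close> is taken
  over a nonempty bounded set.\<close>

locale cut_family =
  fixes X :: "'a topology" and L :: "real \<Rightarrow> 'a set"
  assumes open_L: "openin X (L p)"
    and antimono_L: "p \<le> q \<Longrightarrow> L q \<subseteq> L p"
    and bounded_L: "densely X (\<lambda>W. \<exists>a b. W \<subseteq> L a \<and> W \<inter> L b = {})"
begin

lemma cut_fun_bounds:
  assumes "x \<in> L c" "x \<notin> L d"
  shows "c \<le> cut_fun L x" "cut_fun L x \<le> d"
proof -
  have "p \<le> d" if "x \<in> L p" for p
    using that assms antimono_L[of d p] by (meson linear subsetD)
  then show "c \<le> cut_fun L x" "cut_fun L x \<le> d"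
    using assms unfolding cut_fun_def by (auto intro!: cSup_upper cSup_least bdd_aboveI)
qed

text \<open>On a piece \<open>W\<close> between the levels \<open>a\<close> and \<open>b\<close>,
  climbing from \<open>a\<close> in steps of \<open>e\<close> reaches a level that \<open>W\<close>
  meets while it misses the next one. On the part of \<open>W\<close> above that level,
  \<open>cut_fun L\<close> varies by at most \<open>e\<close>.\<close>

lemma cut_piece:
  assumes e: "0 < e" and V: "openin X V" "V \<noteq> {}"
  obtains W c where "openin X W" "W \<noteq> {}" "W \<subseteq> V" "W \<subseteq> L c" "W \<inter> L (c + e) = {}"
    "\<And>x. x \<in> W \<Longrightarrow> c \<le> cut_fun L x \<and> cut_fun L x \<le> c + e"
proof -
  obtain W a b where W: "openin X W" "W \<noteq> {}" "W \<subseteq> V" "W \<subseteq> L a" "W \<inter> L b = {}"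
    using denselyE[OF bounded_L V] by metis
  define P where "P n = (W \<inter> L (a + real n * e) = {})" for n :: nat
  obtain N :: nat where N: "(b - a) / e < real N" using reals_Archimedean2 by blast
  then have "b \<le> a + real N * e" using e by (simp add: field_simps)
  then have "P N" using W(5) antimono_L[of b "a + real N * e"] by (auto simp: P_def)
  moreover have "\<not> P 0" using W(2,4) by (auto simp: P_def)
  ultimately obtain n where n: "\<not> P n" "P (Suc n)"
    using ex_least_nat_less[of P N] by blast
  let ?c = "a + real n * e"
  let ?W = "W \<inter> L ?c"
  have "?W \<inter> L (?c + e) = {}" "?W \<noteq> {}"
    using n by (auto simp: P_def algebra_simps)
  moreover have "?c \<le> cut_fun L x \<and> cut_fun L x \<le> ?c + e" if "x \<in> ?W" for x
    using that calculation(1) cut_fun_bounds[of x ?c "?c + e"] by blast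
  moreover have "openin X ?W" using W open_L by blast
  ultimately show ?thesis using that[of ?W ?c] W(3) by blast
qed

lemma cut_fun_quasi_real: "cut_fun L \<in> quasi_reals X"
proof (rule quasi_realsI)
  fix e :: real and V assume e: "0 < e" and V: "openin X V" "V \<noteq> {}"
  obtain W c where "openin X W" "W \<noteq> {}" "W \<subseteq> V"
    "\<And>x. x \<in> W \<Longrightarrow> c \<le> cut_fun L x \<and> cut_fun L x \<le> c + e"
    using cut_piece[OF e V] by metis
  then show "\<exists>W c. openin X W \<and> W \<noteq> {} \<and> W \<subseteq> V \<and> (\<forall>x\<in>W. \<bar>cut_fun L x - c\<bar> \<le> e)"
    by (intro exI[of _ W] exI[of _ c]) (auto simp: abs_le_iff; force)
qed

end

text \<open>\<open>R\<close> is a realization of the quotient, with \<open>\<rho>\<close> as the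
  projection; no set of classes is formed. The assumption \<open>eqI\<close> stands beside
  \<open>le_iff\<close> because antisymmetry of \<open>R\<close> is only derived from it.\<close>

locale quasi_real_image =
  fixes X :: "'a topology" and R :: "'r riesz" and \<rho> :: "('a \<Rightarrow> real) \<Rightarrow> 'r"
  assumes image: "\<rho> ` quasi_reals X = carrier R"
    and eq_R: "eq R = (=)"
    and le_iff: "\<lbrakk>f \<in> quasi_reals X; g \<in> quasi_reals X\<rbrakk> \<Longrightarrow> \<rho> f \<sqsubseteq>\<^bsub>R\<^esub> \<rho> g \<longleftrightarrow> ess_le X f g"
    and eqI: "\<lbrakk>f \<in> quasi_reals X; g \<in> quasi_reals X; ess_le X f g; ess_le X g f\<rbrakk> \<Longrightarrow> \<rho> f = \<rho> g"
    and vzero: "vzero R = \<rho> (\<lambda>x. 0)"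
    and vadd: "\<lbrakk>f \<in> quasi_reals X; g \<in> quasi_reals X\<rbrakk> \<Longrightarrow> \<rho> f \<boxplus>\<^bsub>R\<^esub> \<rho> g = \<rho> (\<lambda>x. f x + g x)"
    and vscale: "f \<in> quasi_reals X \<Longrightarrow> c \<boxdot>\<^bsub>R\<^esub> \<rho> f = \<rho> (\<lambda>x. c * f x)"
begin

lemma closed: "f \<in> quasi_reals X \<Longrightarrow> \<rho> f \<in> carrier R"
  using image by blast

lemma carrierE:
  assumes "x \<in> carrier R"
  obtains f where "f \<in> quasi_reals X" "x = \<rho> f"
  using assms image by blast

lemma eq_iff:
  assumes "f \<in> quasi_reals X" "g \<in> quasi_reals X"
  shows "\<rho> f = \<rho> g \<longleftrightarrow> ess_le X f g \<and> ess_le X g f"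
  using assms eqI le_iff ess_le_refl by metis

lemma partial_order: "partial_order R"
proof (unfold_locales, goal_cases)
  case (4 x) then show ?case by (auto elim!: carrierE simp: le_iff ess_le_refl)
next
  case (5 x y)
  then obtain f g where "f \<in> quasi_reals X" "g \<in> quasi_reals X" "x = \<rho> f" "y = \<rho> g"
    by (metis carrierE)
  then show ?case using 5 eqI[of f g] by (simp add: le_iff eq_R)
next
  case (6 x y z)
  then obtain f g h where "f \<in> quasi_reals X" "g \<in> quasi_reals X" "h \<in> quasi_reals X"
    "x = \<rho> f" "y = \<rho> g" "z = \<rho> h"
    by (metis carrierE)
  then show ?case using 6 ess_le_trans by (auto simp: le_iff)
qed (auto simp: eq_R)

lemma lub_two:
  assumes "f \<in> quasi_reals X" "g \<in> quasi_reals X"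
  shows "is_lub R (\<rho> (\<lambda>x. max (f x) (g x))) {\<rho> f, \<rho> g}"
  using assms by (subst is_lub_iff)
    (auto simp: closed le_iff quasi_reals_max elim!: carrierE intro: ess_le_if_le ess_le_max)

lemma glb_two:
  assumes "f \<in> quasi_reals X" "g \<in> quasi_reals X"
  shows "is_glb R (\<rho> (\<lambda>x. min (f x) (g x))) {\<rho> f, \<rho> g}"
  using assms by (subst is_glb_iff)
    (auto simp: closed le_iff quasi_reals_min elim!: carrierE intro: ess_le_if_le ess_le_min)

lemma join_eq:
  assumes "f \<in> quasi_reals X" "g \<in> quasi_reals X"
  shows "\<rho> f \<squnion>\<^bsub>R\<^esub> \<rho> g = \<rho> (\<lambda>x. max (f x) (g x))"
  unfolding join_def by (rule partial_order.sup_eqI[OF partial_order lub_two[OF assms]])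

lemma meet_eq:
  assumes "f \<in> quasi_reals X" "g \<in> quasi_reals X"
  shows "\<rho> f \<sqinter>\<^bsub>R\<^esub> \<rho> g = \<rho> (\<lambda>x. min (f x) (g x))"
  unfolding meet_def by (rule partial_order.inf_eqI[OF partial_order glb_two[OF assms]])

lemma riesz_space: "riesz_space R"
proof -
  interpret partial_order R by (rule partial_order)
  note closure = quasi_reals_add quasi_reals_scale quasi_reals_const
  show ?thesis
  proof (unfold_locales, goal_cases)
    case (1 x y)
    then show ?case by (metis carrierE lub_two)
  next
    case (2 x y)
    then show ?case by (metis carrierE glb_two)
  next
    case (9 x)
    then obtain f where f: "f \<in> quasi_reals X" "x = \<rho> f" by (rule carrierE)
    then have "x \<boxplus>\<^bsub>R\<^esub> \<rho> (\<lambda>x. - f x) = vzero R"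
      by (simp add: vadd vzero quasi_reals_minus)
    then show ?case using f closed quasi_reals_minus by blast
  next
    case (14 x y z)
    then show ?case
      by (auto elim!: carrierE simp: vadd le_iff closure ess_le_add_mono)
  next
    case (15 x y c)
    then show ?case
      by (auto elim!: carrierE simp: vscale le_iff closure ess_le_scale_mono)
  \<comment> \<open>What remains are closure properties and identities that already hold pointwise
    for the representatives.\<close>
  qed (auto elim!: carrierE simp: vadd vscale vzero closure closed algebra_simps)
qed

end

text \<open>\<open>h\<close> takes any representative and projects it by \<open>\<sigma>\<close>.
  This is well defined and injective because both projections identify the same pairs of
  functions.\<close>

lemma quasi_real_images_isomorphic:
  assumes R: "quasi_real_image X R \<rho>" and S: "quasi_real_image X S \<sigma>"
  shows "riesz_isomorphic R S"
proof -
  interpret R: quasi_real_image X R \<rho> by (rule R)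
  interpret S: quasi_real_image X S \<sigma> by (rule S)
  define h where "h = \<sigma> \<circ> inv_into (quasi_reals X) \<rho>"
  have h: "h (\<rho> f) = \<sigma> f" if f: "f \<in> quasi_reals X" for f
  proof -
    let ?g = "inv_into (quasi_reals X) \<rho> (\<rho> f)"
    have "?g \<in> quasi_reals X" "\<rho> ?g = \<rho> f"
      using f f_inv_into_f[of "\<rho> f" \<rho> "quasi_reals X"]
      by (auto intro: inv_into_into)
    then show ?thesis using f by (simp add: h_def R.eq_iff S.eq_iff)
  qed
  have "riesz_hom R S h"
    unfolding riesz_hom_def
    by (auto elim!: R.carrierE simp: h S.closed R.vadd S.vadd R.vscale S.vscale R.join_eq S.join_eq
      R.meet_eq S.meet_eq quasi_reals_add quasi_reals_scale quasi_reals_max quasi_reals_min)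
  moreover have "inj_on h (carrier R)"
    by (rule inj_onI) (auto elim!: R.carrierE simp: h R.eq_iff S.eq_iff)
  moreover have "h ` carrier R = carrier S"
    unfolding R.image[symmetric] S.image[symmetric] by (simp add: image_image h)
  ultimately show ?thesis
    by (auto simp: riesz_isomorphic_def bij_betw_def)
qed

section \<open>Real functions on the frame of regular open sets\<close>

lemma (in cut_family) above_cut_fun_meets:
  assumes V: "openin X V" and meets: "V \<inter> above X (cut_fun L) p \<noteq> {}"
  shows "V \<inter> L p \<noteq> {}"
proof -
  obtain x where "x \<in> V" and x: "x \<in> above X (cut_fun L) p" using meets by blast
  from x obtain U q where U: "openin X U" "x \<in> U" "p < q" "\<forall>y\<in>U. q \<le> cut_fun L y"
    by (rule aboveE)
  have "0 < (q - p) / 2" "openin X (V \<inter> U)" "V \<inter> U \<noteq> {}"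
    using U V \<open>x \<in> V\<close> by auto
  then obtain W c where W: "W \<noteq> {}" "W \<subseteq> V \<inter> U" "W \<subseteq> L c"
    "\<And>x. x \<in> W \<Longrightarrow> c \<le> cut_fun L x \<and> cut_fun L x \<le> c + (q - p) / 2"
    using cut_piece by metis
  then obtain y where "y \<in> W" by blast
  then have "q \<le> c + (q - p) / 2" using W(2,4) U(4) by force
  then have "L c \<subseteq> L p" using U(3) by (intro antimono_L) (simp add: field_simps)
  then show ?thesis using W by blast
qed

text \<open>The loss from \<open>q\<close> to \<open>p\<close> pays for the oscillation of
  \<open>cut_fun L\<close> on a piece, which is bounded by half the gap.\<close>

lemma (in cut_family) meets_above_cut_fun:
  assumes V: "openin X V" and meets: "V \<inter> L q \<noteq> {}" and "p < q"
  shows "V \<inter> above X (cut_fun L) p \<noteq> {}"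
proof -
  let ?e = "(q - p) / 2"
  have "0 < ?e" "openin X (V \<inter> L q)"
    using assms open_L by auto
  then obtain W c where W: "openin X W" "W \<noteq> {}" "W \<subseteq> V \<inter> L q" "W \<inter> L (c + ?e) = {}"
    "\<And>x. x \<in> W \<Longrightarrow> c \<le> cut_fun L x \<and> cut_fun L x \<le> c + ?e"
    using cut_piece[of ?e "V \<inter> L q"] meets by metis
  \<comment> \<open>Otherwise \<open>L q\<close>, which contains \<open>W\<close>, would be inside
    \<open>L (c + ?e)\<close>, which misses \<open>W\<close>.\<close>
  have "\<not> c + ?e \<le> q"
    using antimono_L[of "c + ?e" q] W(2,3,4) by blast
  then have "p < c" using \<open>p < q\<close> by (simp add: field_simps)
  then have "W \<subseteq> above X (cut_fun L) p"
    using W(1,5) by (intro subset_aboveI[of _ _ _ c]) auto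
  then show ?thesis using W by blast
qed

section \<open>Superlevel sets of negatives, sums and multiples\<close>

lemma above_minus_eq_Union:
  "above X f (- real_of_rat p) = (\<Union>q\<in>{q. q < p}. above X f (- real_of_rat q))"
proof -
  have *: "{q. - real_of_rat p < real_of_rat q} = uminus ` {q. q < p}"
  proof (intro equalityI subsetI)
    fix q assume "q \<in> {q. - real_of_rat p < real_of_rat q}"
    then have "real_of_rat (- p) < real_of_rat q" by (simp add: of_rat_minus)
    then have "- q < p" unfolding of_rat_less by simp
    then show "q \<in> uminus ` {q. q < p}" by (intro image_eqI[of _ _ "- q"]) auto
  qed (auto simp: of_rat_minus of_rat_less)
  show ?thesis
    by (subst above_eq_Union, subst *) (simp add: of_rat_minus)
qed

lemma meets_above_or_above_minus:
  assumes f: "f \<in> quasi_reals X" and V: "openin X V" "V \<noteq> {}" and "p < q"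
  shows "V \<inter> (above X f p \<union> above X (\<lambda>x. - f x) (- q)) \<noteq> {}"
proof -
  let ?e = "(q - p) / 4"
  have "0 < ?e" using assms by simp
  then obtain W c where W: "openin X W" "W \<noteq> {}" "W \<subseteq> V" "\<And>x. x \<in> W \<Longrightarrow> \<bar>f x - c\<bar> \<le> ?e"
    using quasi_realsE[OF f _ V] by metis
  show ?thesis
  proof (cases "p < c - ?e")
    case True
    have "W \<subseteq> above X f p"
    proof (rule subset_aboveI[OF W(1) True])
      show "c - ?e \<le> f x" if "x \<in> W" for x using W(4)[OF that] by linarith
    qed
    then show ?thesis using W by blast
  next
    case False
    \<comment> \<open>Now \<open>c + ?e \<le> p + 2 * ?e\<close>, and \<open>2 * ?e\<close> is half
      the distance from \<open>p\<close> to \<open>q\<close>, so \<open>f\<close> stays below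
      \<open>q\<close> on \<open>W\<close>.\<close>
    then have less: "- q < - (c + ?e)" using \<open>p < q\<close> by (simp add: field_simps)
    have "W \<subseteq> above X (\<lambda>x. - f x) (- q)"
    proof (rule subset_aboveI[OF W(1) less])
      show "- (c + ?e) \<le> - f x" if "x \<in> W" for x using W(4)[OF that] by linarith
    qed
    then show ?thesis using W by blast
  qed
qed

lemma above_meets_some:
  assumes f: "f \<in> quasi_reals X" and V: "openin X V" "V \<noteq> {}"
  shows "\<exists>p. V \<inter> above X f (real_of_rat p) \<noteq> {}"
proof -
  obtain W c where W: "openin X W" "W \<noteq> {}" "W \<subseteq> V" "\<And>x. x \<in> W \<Longrightarrow> \<bar>f x - c\<bar> \<le> 1"
    using quasi_realsE[OF f zero_less_one V] by metis
  obtain p where p: "real_of_rat p < c - 1"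
    using of_rat_dense[of "c - 2" "c - 1"] by auto
  have "W \<subseteq> above X f (real_of_rat p)"
  proof (rule subset_aboveI[OF W(1) p])
    show "c - 1 \<le> f x" if "x \<in> W" for x using W(4)[OF that] by linarith
  qed
  then show ?thesis using W by blast
qed

lemma above_zero: "above X (\<lambda>x. 0) p = (if p < 0 then topspace X else {})"
proof (cases "p < 0")
  case True
  have "topspace X \<subseteq> above X (\<lambda>x. 0) p"
    by (rule subset_aboveI[OF openin_topspace True]) simp
  then show ?thesis using True openin_subset[OF openin_above[of X "\<lambda>x. 0" p]] by auto
next
  case False
  then show ?thesis using above_less[of _ X "\<lambda>x. 0" p] by auto
qed

text \<open>From right to left this is an inclusion of the two sets. In the other direction the
  level \<open>r\<close> at which \<open>p\<close> is split can only be chosen where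
  \<open>f\<close> is nearly constant: at a point where \<open>f\<close> and \<open>g\<close> jump
  in opposite directions the sets themselves can differ, so they are compared by the open sets they
  meet.\<close>

lemma above_add_meets_iff:
  assumes f: "f \<in> quasi_reals X" and g: "g \<in> quasi_reals X" and V: "openin X V"
  shows "V \<inter> above X (\<lambda>x. f x + g x) p \<noteq> {} \<longleftrightarrow>
    V \<inter> (\<Union>r. above X f (real_of_rat r) \<inter> above X g (p - real_of_rat r)) \<noteq> {}"
proof
  assume "V \<inter> above X (\<lambda>x. f x + g x) p \<noteq> {}"
  then obtain x where "x \<in> V" and x: "x \<in> above X (\<lambda>x. f x + g x) p" by blast
  from x obtain U q where U: "openin X U" "x \<in> U" "p < q" "\<forall>y\<in>U. q \<le> f y + g y"
    by (rule aboveE)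
  \<comment> \<open>The unit of all errors below: \<open>f\<close> moves by \<open>e\<close> around
    \<open>c\<close>, and \<open>r\<close> lies less than \<open>2 * e\<close> below
    \<open>c\<close>; a gap of eight units leaves room for both.\<close>
  define e where "e = (q - p) / 8"
  have e: "0 < e" using U by (simp add: e_def)
  have q: "q = p + 8 * e" by (simp add: e_def diff_divide_distrib)
  have VU: "openin X (V \<inter> U)" "V \<inter> U \<noteq> {}" using U V \<open>x \<in> V\<close> by auto
  obtain W c where W: "openin X W" "W \<noteq> {}" "W \<subseteq> V \<inter> U" "\<And>x. x \<in> W \<Longrightarrow> \<bar>f x - c\<bar> \<le> e"
    using quasi_realsE[OF f e VU] by metis
  obtain r where r: "c - 2 * e < real_of_rat r" "real_of_rat r < c - e"
    using of_rat_dense[of "c - 2 * e" "c - e"] e by auto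
  have "W \<subseteq> above X f (real_of_rat r)"
  proof (rule subset_aboveI[OF W(1) r(2)])
    show "c - e \<le> f x" if "x \<in> W" for x using W(4)[OF that] by linarith
  qed
  moreover have "W \<subseteq> above X g (p - real_of_rat r)"
  proof (rule subset_aboveI[OF W(1)])
    show "p - real_of_rat r < q - c - e" using r q e by linarith
    show "q - c - e \<le> g x" if "x \<in> W" for x
    proof -
      have "q \<le> f x + g x" using U W that by blast
      then show ?thesis using W(4)[OF that] by linarith
    qed
  qed
  ultimately show "V \<inter> (\<Union>r. above X f (real_of_rat r) \<inter> above X g (p - real_of_rat r)) \<noteq> {}"
    using W by blast
next
  assume "V \<inter> (\<Union>r. above X f (real_of_rat r) \<inter> above X g (p - real_of_rat r)) \<noteq> {}"
  then obtain x r where "x \<in> V" and x: "x \<in> above X f (real_of_rat r)"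
    "x \<in> above X g (p - real_of_rat r)" by blast
  obtain U a where U: "openin X U" "x \<in> U" "real_of_rat r < a" "\<forall>y\<in>U. a \<le> f y"
    using x(1) by (rule aboveE)
  obtain U' b where U': "openin X U'" "x \<in> U'" "p - real_of_rat r < b" "\<forall>y\<in>U'. b \<le> g y"
    using x(2) by (rule aboveE)
  have "U \<inter> U' \<subseteq> above X (\<lambda>x. f x + g x) p"
  proof (rule subset_aboveI)
    show "openin X (U \<inter> U')" using U U' by blast
    show "p < a + b" using U U' by linarith
    show "a + b \<le> f y + g y" if "y \<in> U \<inter> U'" for y
      using that U(4) U'(4) by (intro add_mono) auto
  qed
  then show "V \<inter> above X (\<lambda>x. f x + g x) p \<noteq> {}"
    using \<open>x \<in> V\<close> U(2) U'(2) by blast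
qed

lemma above_scale:
  assumes c: "0 < c"
  shows "above X (\<lambda>x. c * f x) p = (\<Union>r\<in>{r. p < c * real_of_rat r}. above X f (real_of_rat r))"
proof (intro equalityI subsetI)
  fix x assume "x \<in> above X (\<lambda>x. c * f x) p"
  then obtain U q where U: "openin X U" "x \<in> U" "p < q" "\<forall>y\<in>U. q \<le> c * f y"
    by (rule aboveE)
  have "p / c < q / c" using U c by (simp add: divide_strict_right_mono)
  then obtain r where r: "p / c < real_of_rat r" "real_of_rat r < q / c"
    using of_rat_dense by blast
  have "U \<subseteq> above X f (real_of_rat r)"
  proof (rule subset_aboveI[OF U(1) r(2)])
    show "q / c \<le> f x" if "x \<in> U" for x
      using U(4) that c by (simp add: field_simps)
  qed
  moreover have "p < c * real_of_rat r" using r(1) c by (simp add: field_simps)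
  ultimately show "x \<in> (\<Union>r\<in>{r. p < c * real_of_rat r}. above X f (real_of_rat r))"
    using U by blast
next
  fix x assume "x \<in> (\<Union>r\<in>{r. p < c * real_of_rat r}. above X f (real_of_rat r))"
  then obtain r where r: "p < c * real_of_rat r" and x: "x \<in> above X f (real_of_rat r)" by blast
  from x obtain U q where U: "openin X U" "x \<in> U" "real_of_rat r < q" "\<forall>y\<in>U. q \<le> f y"
    by (rule aboveE)
  have "U \<subseteq> above X (\<lambda>x. c * f x) p"
    using U(1) r
  proof (rule subset_aboveI)
    show "c * real_of_rat r \<le> c * f y" if "y \<in> U" for y
      using that U(3,4) c by (intro mult_left_mono) force+
  qed
  then show "x \<in> above X (\<lambda>x. c * f x) p" using U by blast
qed

section \<open>Frame homomorphisms as classes of quasi-continuous functions\<close>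

lemma frame_reals_regular_opens:
  "(l, u) \<in> frame_reals (regular_opens X) \<longleftrightarrow>
     range l \<subseteq> RO X \<and> range u \<subseteq> RO X \<and>
     (\<forall>p q. q \<le> p \<longrightarrow> l p \<inter> u q = {}) \<and>
     (\<forall>p q. p < q \<longrightarrow> regularize X (l p \<union> u q) = topspace X) \<and>
     (\<forall>p. l p = regularize X (\<Union>q\<in>{q. p < q}. l q)) \<and>
     (\<forall>p. u p = regularize X (\<Union>q\<in>{q. q < p}. u q)) \<and>
     regularize X (\<Union>p. l p) = topspace X \<and> regularize X (\<Union>p. u p) = topspace X"
proof (cases "range l \<subseteq> RO X \<and> range u \<subseteq> RO X")
  case True
  then have cl: "l p \<in> RO X" "u p \<in> RO X" for p by auto
  have sups: "\<Squnion>\<^bsub>regular_opens X\<^esub>{f q |q. P q} = regularize X (\<Union>q\<in>{q. P q}. f q)"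
    if "\<And>q. f q \<in> RO X" for f :: "rat \<Rightarrow> 'a set" and P
    using that by (subst sup_regular_opens) (auto intro!: arg_cong[of _ _ "regularize X"])
  show ?thesis
    unfolding frame_reals_def
    using True cl by (simp add: sups meet_regular_opens join_regular_opens sup_regular_opens
      bottom_regular_opens top_regular_opens)
next
  case False
  then show ?thesis by (auto simp: frame_reals_def)
qed

text \<open>The set where \<open>f\<close> is below \<open>q\<close> is taken as a superlevel set of
  \<open>- f\<close> at \<open>- q\<close>, so that the facts about \<open>above\<close> serve for
  both components.\<close>

definition frame_image :: "'a topology \<Rightarrow> ('a \<Rightarrow> real) \<Rightarrow> 'a set frame_real" where
  "frame_image X f = (\<lambda>p. regularize X (above X f (real_of_rat p)),
     \<lambda>q. regularize X (above X (\<lambda>x. - f x) (- real_of_rat q)))"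

lemma frame_image_closed:
  assumes f: "f \<in> quasi_reals X"
  shows "frame_image X f \<in> frame_reals (regular_opens X)"
proof -
  let ?A = "\<lambda>p. above X f (real_of_rat p)" and ?B = "\<lambda>q. above X (\<lambda>x. - f x) (- real_of_rat q)"
  have disjoint: "regularize X (?A p) \<inter> regularize X (?B q) = {}" if "q \<le> p" for p q
  proof -
    have "real_of_rat q \<le> real_of_rat p" using that by (simp add: of_rat_less_eq)
    moreover have "real_of_rat p < f x" if "x \<in> ?A p" for x
      using that by (rule above_less)
    moreover have "f x < real_of_rat q" if "x \<in> ?B q" for x
      using above_less[OF that] by simp
    ultimately have "?A p \<inter> ?B q = {}" by force
    then show ?thesis by (simp add: regularize_Int openin_above)
  qed
  have cover: "regularize X (regularize X (?A p) \<union> regularize X (?B q)) = topspace X"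
    if "p < q" for p q
    unfolding regularize_eq_topspace_iff
  proof (intro allI impI)
    fix V assume V: "openin X V" "V \<noteq> {}"
    have "V \<inter> (?A p \<union> ?B q) \<noteq> {}"
      using that by (intro meets_above_or_above_minus[OF f V]) (simp add: of_rat_less)
    then show "V \<inter> (regularize X (?A p) \<union> regularize X (?B q)) \<noteq> {}"
      using regularize_increasing[OF openin_above[of X f "real_of_rat p"]]
        regularize_increasing[OF openin_above[of X "\<lambda>x. - f x" "- real_of_rat q"]] by blast
  qed
  have lower: "regularize X (?A p) = regularize X (\<Union>q\<in>{q. p < q}. regularize X (?A q))" for p
    by (subst regularize_Union_image) (auto simp: openin_above of_rat_less above_eq_Union[of X f "real_of_rat p"])
  have upper: "regularize X (?B p) = regularize X (\<Union>q\<in>{q. q < p}. regularize X (?B q))" for p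
    by (subst regularize_Union_image) (auto simp: openin_above above_minus_eq_Union[of X _ p])
  have lower_top: "regularize X (\<Union>p. regularize X (?A p)) = topspace X"
    unfolding regularize_eq_topspace_iff regularize_Union_image[OF openin_above]
  proof (intro allI impI)
    fix V assume V: "openin X V" "V \<noteq> {}"
    then show "V \<inter> (\<Union>p. ?A p) \<noteq> {}"
      using above_meets_some[OF f V] by blast
  qed
  have upper_top: "regularize X (\<Union>p. regularize X (?B p)) = topspace X"
    unfolding regularize_eq_topspace_iff regularize_Union_image[OF openin_above]
  proof (intro allI impI)
    fix V assume V: "openin X V" "V \<noteq> {}"
    then obtain p where "V \<inter> above X (\<lambda>x. - f x) (real_of_rat p) \<noteq> {}"
      using above_meets_some[OF quasi_reals_minus[OF f] V] by blast
    then have "V \<inter> ?B (- p) \<noteq> {}" by (simp add: of_rat_minus)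
    then show "V \<inter> (\<Union>p. ?B p) \<noteq> {}" by blast
  qed
  show ?thesis
    unfolding frame_image_def frame_reals_regular_opens
    using disjoint cover lower upper lower_top upper_top regularize_closed by blast
qed

text \<open>The function is built from the lower half \<open>l\<close> alone. Its upper half is
  \<open>u\<close> because the relations between \<open>l\<close> and \<open>u\<close> determine
  \<open>u\<close> from \<open>l\<close>.\<close>

lemma frame_image_surj:
  assumes F: "F \<in> frame_reals (regular_opens X)"
  shows "\<exists>f\<in>quasi_reals X. frame_image X f = F"
proof -
  obtain l u where lu: "F = (l, u)" by (cases F)
  have cl: "\<And>p. l p \<in> RO X" "\<And>p. u p \<in> RO X"
    and disj: "\<And>p q. q \<le> p \<Longrightarrow> l p \<inter> u q = {}"
    and cover: "\<And>p q. p < q \<Longrightarrow> regularize X (l p \<union> u q) = topspace X"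
    and lower: "\<And>p. l p = regularize X (\<Union>q\<in>{q. p < q}. l q)"
    and upper: "\<And>p. u p = regularize X (\<Union>q\<in>{q. q < p}. u q)"
    and lower_top: "regularize X (\<Union>p. l p) = topspace X"
    and upper_top: "regularize X (\<Union>p. u p) = topspace X"
    using F unfolding lu frame_reals_regular_opens by blast+
  have open_l: "openin X (l p)" and open_u: "openin X (u p)" for p
    using cl by (auto simp: carrier_regular_opens)
  \<comment> \<open>This extends the rational family to real levels. At a rational \<open>p\<close>,
    the relation for \<open>l p\<close> says that the union regularizes to
    \<open>l p\<close>.\<close>
  define L where "L p = (\<Union>r\<in>{r. p < real_of_rat r}. l r)" for p
  interpret L: cut_family X L
  proof
    show "openin X (L p)" for p
      unfolding L_def using open_l by blast
    show "L q \<subseteq> L p" if "p \<le> q" for p q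
      unfolding L_def using that by force
    show "densely X (\<lambda>W. \<exists>a b. W \<subseteq> L a \<and> W \<inter> L b = {})"
    proof (rule denselyI)
      fix V assume V: "openin X V" "V \<noteq> {}"
      then obtain p where p: "V \<inter> l p \<noteq> {}"
        using lower_top unfolding regularize_eq_topspace_iff by blast
      have V': "openin X (V \<inter> l p)" using V open_l by blast
      then obtain q where q: "V \<inter> l p \<inter> u q \<noteq> {}"
        using upper_top p unfolding regularize_eq_topspace_iff by blast
      have "openin X (V \<inter> l p \<inter> u q)" using V' open_u by blast
      \<comment> \<open>The level is lowered because \<open>L\<close> at \<open>p\<close> itself
        collects only the \<open>l r\<close> with \<open>r > p\<close>.\<close>
      moreover have "V \<inter> l p \<inter> u q \<subseteq> L (real_of_rat p - 1)"
        unfolding L_def by force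
      moreover have "V \<inter> l p \<inter> u q \<inter> L (real_of_rat q) = {}"
      proof -
        have "l p \<inter> u q \<inter> l r = {}" if "real_of_rat q < real_of_rat r" for r
          using disj[of q r] that by (auto simp: of_rat_less)
        then show ?thesis unfolding L_def by blast
      qed
      ultimately show "\<exists>W. openin X W \<and> W \<noteq> {} \<and> W \<subseteq> V \<and> (\<exists>a b. W \<subseteq> L a \<and> W \<inter> L b = {})"
        using q by blast
    qed
  qed
  let ?f = "cut_fun L"
  have "regularize X (above X ?f (real_of_rat p)) = l p" for p
  proof -
    have "regularize X (above X ?f (real_of_rat p)) = regularize X (L (real_of_rat p))"
    proof (rule regularize_eqI)
      fix V assume V: "openin X V"
      have "V \<inter> above X ?f (real_of_rat p) \<noteq> {}" if meets: "V \<inter> L (real_of_rat p) \<noteq> {}"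
      proof -
        obtain r where r: "real_of_rat p < real_of_rat r" "V \<inter> l r \<noteq> {}"
          using meets unfolding L_def by blast
        have "\<exists>s. real_of_rat p < s \<and> s < real_of_rat r" using r dense by blast
        then obtain s where s: "real_of_rat p < s" "s < real_of_rat r" by blast
        then have "V \<inter> L s \<noteq> {}" using r unfolding L_def by blast
        then show ?thesis using L.meets_above_cut_fun[OF V _ s(1)] by blast
      qed
      then show "V \<inter> above X ?f (real_of_rat p) \<noteq> {} \<longleftrightarrow> V \<inter> L (real_of_rat p) \<noteq> {}"
        using L.above_cut_fun_meets[OF V] by blast
    qed
    also have "\<dots> = l p"
      unfolding L_def using lower[of p] by (simp add: of_rat_less)
    finally show ?thesis .
  qed
  moreover have "regularize X (above X (\<lambda>x. - ?f x) (- real_of_rat q)) = u q" for q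
  proof -
    have "regularize X (above X (\<lambda>x. - ?f x) (- real_of_rat q)) = regularize X (u q)"
    proof (rule regularize_eqI)
      fix V assume V: "openin X V"
      show "V \<inter> above X (\<lambda>x. - ?f x) (- real_of_rat q) \<noteq> {} \<longleftrightarrow> V \<inter> u q \<noteq> {}"
      proof
        assume "V \<inter> above X (\<lambda>x. - ?f x) (- real_of_rat q) \<noteq> {}"
        then obtain x where "x \<in> V" and x: "x \<in> above X (\<lambda>x. - ?f x) (- real_of_rat q)" by blast
        from x obtain U t where U: "openin X U" "x \<in> U" "- real_of_rat q < t" "\<forall>y\<in>U. t \<le> - ?f y"
          by (rule aboveE)
        then have "- t < real_of_rat q" by linarith
        then obtain r where r: "- t < real_of_rat r" "real_of_rat r < real_of_rat q"
          using of_rat_dense by blast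
        \<comment> \<open>Two rationals between \<open>- t\<close> and \<open>q\<close> are used:
          the function is at most \<open>- t < r\<close> on \<open>U\<close>; meeting
          \<open>l r'\<close> would push it above \<open>r\<close> somewhere in \<open>U\<close>;
          and \<open>l r' \<union> u q\<close> is dense since \<open>r' < q\<close>. So
          \<open>u q\<close> is met.\<close>
        obtain r' where r': "r < r'" "r' < q"
          using r(2) dense[of r q] by (auto simp: of_rat_less)
        have VU: "openin X (V \<inter> U)" "V \<inter> U \<noteq> {}" using V U \<open>x \<in> V\<close> by auto
        have "V \<inter> U \<inter> l r' = {}"
        proof (rule ccontr)
          assume "V \<inter> U \<inter> l r' \<noteq> {}"
          then obtain s where "real_of_rat r < s" "V \<inter> U \<inter> L s \<noteq> {}"
          proof -
            obtain s where s: "real_of_rat r < s" "s < real_of_rat r'"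
              using r'(1) dense[of "real_of_rat r" "real_of_rat r'"] by (auto simp: of_rat_less)
            then have "V \<inter> U \<inter> L s \<noteq> {}"
              using \<open>V \<inter> U \<inter> l r' \<noteq> {}\<close> unfolding L_def by blast
            then show ?thesis using s that by blast
          qed
          then have "V \<inter> U \<inter> above X ?f (real_of_rat r) \<noteq> {}"
            using L.meets_above_cut_fun[OF VU(1)] by blast
          then obtain y where "y \<in> U" "real_of_rat r < ?f y"
            using above_less[of _ X ?f "real_of_rat r"] by blast
          then show False using U(4) r(1) by force
        qed
        moreover have "V \<inter> U \<inter> (l r' \<union> u q) \<noteq> {}"
          using cover[OF r'(2)] VU unfolding regularize_eq_topspace_iff by blast
        ultimately show "V \<inter> u q \<noteq> {}" by blast
      next
        assume "V \<inter> u q \<noteq> {}"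
        then have "V \<inter> (\<Union>r\<in>{r. r < q}. u r) \<noteq> {}"
          using regularize_meets[OF V, of "\<Union>r\<in>{r. r < q}. u r"] upper[of q] by simp
        then obtain r where r: "r < q" "V \<inter> u r \<noteq> {}" by blast
        let ?e = "(real_of_rat q - real_of_rat r) / 2"
        have "0 < ?e" "openin X (V \<inter> u r)" using r V open_u by (auto simp: of_rat_less)
        then obtain W c where W: "openin X W" "W \<noteq> {}" "W \<subseteq> V \<inter> u r" "W \<subseteq> L c"
          "\<And>x. x \<in> W \<Longrightarrow> c \<le> ?f x \<and> ?f x \<le> c + ?e"
          using L.cut_piece[of ?e "V \<inter> u r"] r(2) by metis
        \<comment> \<open>A point of \<open>W\<close> lies in some \<open>l s\<close> with
          \<open>s > c\<close> and also in \<open>u r\<close>, which forces \<open>s < r\<close>.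
          Then \<open>c + ?e\<close> is still below \<open>q\<close>.\<close>
        have "c < real_of_rat r"
        proof -
          obtain y where "y \<in> W" using W by blast
          then obtain s where "c < real_of_rat s" "y \<in> l s" "y \<in> u r"
            using W unfolding L_def by blast
          then have "s < r" using disj[of r s] by force
          then have "real_of_rat s < real_of_rat r" by (simp add: of_rat_less)
          then show ?thesis using \<open>c < real_of_rat s\<close> by linarith
        qed
        then have less: "- real_of_rat q < - (c + ?e)" using \<open>0 < ?e\<close> by (simp add: field_simps)
        have "W \<subseteq> above X (\<lambda>x. - ?f x) (- real_of_rat q)"
        proof (rule subset_aboveI[OF W(1) less])
          show "- (c + ?e) \<le> - ?f x" if "x \<in> W" for x using W(5)[OF that] by linarith
        qed
        then show "V \<inter> above X (\<lambda>x. - ?f x) (- real_of_rat q) \<noteq> {}"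
          using W by blast
      qed
    qed
    then show ?thesis using cl(2) by (simp add: carrier_regular_opens)
  qed
  ultimately have "frame_image X ?f = F"
    by (simp add: frame_image_def lu)
  then show ?thesis using L.cut_fun_quasi_real by blast
qed

lemma frame_image_le_iff:
  assumes "f \<in> quasi_reals X" "g \<in> quasi_reals X"
  shows "frame_real_le (regular_opens X) (frame_image X f) (frame_image X g) \<longleftrightarrow> ess_le X f g"
proof
  assume le: "frame_real_le (regular_opens X) (frame_image X f) (frame_image X g)"
  show "ess_le X f g"
  proof (rule ess_le_if_above_meets[OF assms])
    fix V p assume V: "openin X V" and meets: "V \<inter> above X f (real_of_rat p) \<noteq> {}"
    have "regularize X (above X f (real_of_rat p)) \<subseteq> regularize X (above X g (real_of_rat p))"
      using le by (simp add: frame_real_le_def frame_image_def le_regular_opens)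
    then have "V \<inter> regularize X (above X g (real_of_rat p)) \<noteq> {}"
      using meets regularize_increasing[OF openin_above[of X f "real_of_rat p"]] by blast
    then show "V \<inter> above X g (real_of_rat p) \<noteq> {}"
      by (rule regularize_meets[OF V])
  qed
next
  assume le: "ess_le X f g"
  have "regularize X (above X f p) \<subseteq> regularize X (above X g p)" for p
    by (rule regularize_subsetI) (rule above_meets_mono[OF le])
  then show "frame_real_le (regular_opens X) (frame_image X f) (frame_image X g)"
    by (simp add: frame_real_le_def frame_image_def le_regular_opens)
qed

lemma ess_le_minus: "ess_le X f g \<Longrightarrow> ess_le X (\<lambda>x. - g x) (\<lambda>x. - f x)"
  by (rule ess_le_combine[of X f g f g 1]) auto

lemma regularize_above_cong:
  assumes "ess_le X f g" "ess_le X g f"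
  shows "regularize X (above X f p) = regularize X (above X g p)"
proof (rule regularize_eqI)
  fix V assume V: "openin X V"
  show "V \<inter> above X f p \<noteq> {} \<longleftrightarrow> V \<inter> above X g p \<noteq> {}"
    using above_meets_mono[OF assms(1) V, of p] above_meets_mono[OF assms(2) V, of p] by blast
qed

lemma frame_image_cong:
  assumes "ess_le X f g" "ess_le X g f"
  shows "frame_image X f = frame_image X g"
  unfolding frame_image_def
  by (simp add: regularize_above_cong[OF assms]
    regularize_above_cong[OF ess_le_minus[OF assms(2)] ess_le_minus[OF assms(1)]])

lemma frame_image_zero: "frame_real_zero (regular_opens X) = frame_image X (\<lambda>x. 0)"
  by (auto simp: frame_real_zero_def frame_image_def above_zero bottom_regular_opens
    top_regular_opens fun_eq_iff)

lemma sup_Int_regularize: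
  assumes "\<And>r. openin X (A r)" "\<And>r. openin X (B r)"
  shows "\<Squnion>\<^bsub>regular_opens X\<^esub>{regularize X (A r) \<sqinter>\<^bsub>regular_opens X\<^esub> regularize X (B r) |r. True} =
    regularize X (\<Union>r. A r \<inter> B r)"
proof -
  have "\<Squnion>\<^bsub>regular_opens X\<^esub>{regularize X (A r) \<sqinter>\<^bsub>regular_opens X\<^esub> regularize X (B r) |r. True} =
      regularize X (\<Union>r. regularize X (A r \<inter> B r))"
    by (subst sup_regular_opens) (auto simp: meet_regular_opens regularize_closed regularize_Int assms
      intro!: arg_cong[of _ _ "regularize X"])
  then show ?thesis
    using assms by (simp add: regularize_Union_image openin_Int)
qed

lemma frame_image_add:
  assumes f: "f \<in> quasi_reals X" and g: "g \<in> quasi_reals X"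
  shows "frame_real_add (regular_opens X) (frame_image X f) (frame_image X g) =
    frame_image X (\<lambda>x. f x + g x)"
proof -
  have add: "regularize X (\<Union>r. above X f (real_of_rat r) \<inter> above X g (p - real_of_rat r)) =
      regularize X (above X (\<lambda>x. f x + g x) p)"
    if "f \<in> quasi_reals X" "g \<in> quasi_reals X" for f g p
    by (rule regularize_eqI) (simp only: above_add_meets_iff[OF that])
  \<comment> \<open>Reindexing the union by the negatives of the rationals turns the second
    component into an instance of the formula for superlevel sets.\<close>
  have "(\<Union>r. above X (\<lambda>x. - f x) (- real_of_rat r) \<inter> above X (\<lambda>x. - g x) (- (q - real_of_rat r))) =
      (\<Union>r. above X (\<lambda>x. - f x) (real_of_rat r) \<inter> above X (\<lambda>x. - g x) (- q - real_of_rat r))" for q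
  proof -
    have "(\<Union>r. F (- r)) = (\<Union>r. F r)" for F :: "rat \<Rightarrow> 'a set"
      by (auto; metis minus_minus)
    from this[of "\<lambda>r. above X (\<lambda>x. - f x) (real_of_rat r) \<inter> above X (\<lambda>x. - g x) (- q - real_of_rat r)"]
    show ?thesis by (simp add: of_rat_minus)
  qed
  then have "regularize X (\<Union>r. above X (\<lambda>x. - f x) (- real_of_rat r) \<inter>
      above X (\<lambda>x. - g x) (- (real_of_rat q - real_of_rat r))) =
    regularize X (above X (\<lambda>x. - (f x + g x)) (- real_of_rat q))" for q
    using add[OF quasi_reals_minus[OF f] quasi_reals_minus[OF g], of "- real_of_rat q"] by simp
  then show ?thesis
    by (simp add: frame_real_add_def frame_image_def sup_Int_regularize[simplified] openin_above add[OF f g]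
      of_rat_diff)
qed

lemma frame_image_scale_pos:
  assumes c: "0 < c"
  shows "frame_real_scale_pos (regular_opens X) c (frame_image X f) = frame_image X (\<lambda>x. c * f x)"
proof -
  have sup: "\<Squnion>\<^bsub>regular_opens X\<^esub>{regularize X (A r) |r. P r} = regularize X (\<Union>r\<in>{r. P r}. A r)"
    if "\<And>r. openin X (A r)" for A :: "rat \<Rightarrow> 'a set" and P
  proof -
    have "\<Squnion>\<^bsub>regular_opens X\<^esub>{regularize X (A r) |r. P r} = regularize X (\<Union>r\<in>{r. P r}. regularize X (A r))"
      by (subst sup_regular_opens) (auto simp: regularize_closed intro!: arg_cong[of _ _ "regularize X"])
    then show ?thesis using that by (simp add: regularize_Union_image)
  qed
  have "{r. - q < c * real_of_rat r} = uminus ` {r. c * real_of_rat r < q}" for q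
  proof (intro equalityI subsetI)
    fix r assume "r \<in> {r. - q < c * real_of_rat r}"
    then have "- r \<in> {r. c * real_of_rat r < q}" by (simp add: of_rat_minus)
    then show "r \<in> uminus ` {r. c * real_of_rat r < q}" by force
  qed (auto simp: of_rat_minus)
  then have "above X (\<lambda>x. c * - f x) (- q) =
      (\<Union>r\<in>{r. c * real_of_rat r < q}. above X (\<lambda>x. - f x) (- real_of_rat r))" for q
    by (subst above_scale[OF c]) (simp add: of_rat_minus)
  then show ?thesis
    by (simp add: frame_real_scale_pos_def frame_image_def sup openin_above above_scale[OF c])
qed

lemma frame_image_neg: "frame_real_neg (frame_image X f) = frame_image X (\<lambda>x. - f x)"
  by (simp add: frame_real_neg_def frame_image_def of_rat_minus)

lemma frame_image_scale:
  "frame_real_scale (regular_opens X) c (frame_image X f) = frame_image X (\<lambda>x. c * f x)"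
proof -
  consider "0 < c" | "c = 0" | "c < 0" by linarith
  then show ?thesis
    by cases (simp_all add: frame_real_scale_def frame_image_scale_pos frame_image_zero frame_image_neg)
qed

lemma quasi_real_image_frame:
  "quasi_real_image X (frame_real_riesz (regular_opens X)) (frame_image X)"
proof (unfold_locales, goal_cases)
  case 1
  show ?case
  proof (intro equalityI subsetI)
    fix F assume "F \<in> frame_image X ` quasi_reals X"
    then show "F \<in> carrier (frame_real_riesz (regular_opens X))"
      by (auto simp: frame_real_riesz_def frame_image_closed)
  next
    fix F assume "F \<in> carrier (frame_real_riesz (regular_opens X))"
    then show "F \<in> frame_image X ` quasi_reals X"
      using frame_image_surj[of F X] by (auto simp: frame_real_riesz_def)
  qed
next
  case (4 f g)
  then show ?case by (intro frame_image_cong)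
qed (simp_all add: frame_real_riesz_def frame_image_le_iff frame_image_zero
  frame_image_add frame_image_scale)

section \<open>Normal lower semicontinuous functions\<close>

lemma ereal_le_if_reals_less:
  fixes u v :: ereal
  assumes "\<And>a. ereal a < u \<Longrightarrow> ereal a < v"
  shows "u \<le> v"
proof (rule ccontr)
  assume "\<not> u \<le> v"
  then have "v < u" by simp
  then obtain a where "v < ereal a" "ereal a < u"
    using ereal_dense2 by blast
  then show False using assms[of a] by simp
qed

lemma ne_empty: "x \<in> A \<Longrightarrow> A \<noteq> {}"
  by blast

section \<open>The Baire operators, tested on open sets\<close>

lemma nhds_in_open: "openin X V \<Longrightarrow> x \<in> V \<Longrightarrow> V \<in> nhds_in X x"
  by (simp add: nhds_in_def interior_of_openin openin_subset)

lemma nhds_inE: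
  assumes "V \<in> nhds_in X x"
  obtains U where "openin X U" "x \<in> U" "U \<subseteq> V"
  using assms interior_of_subset[of X V] openin_interior_of[of X V]
  unfolding nhds_in_def by blast

lemma less_lower_baireE:
  assumes "a < lower_baire X u x" "x \<in> topspace X"
  obtains V b where "openin X V" "x \<in> V" "a < b" "\<forall>y\<in>V. b \<le> u y"
proof -
  have "a < (SUP V\<in>nhds_in X x. INF y\<in>V. u y)"
    using assms by (simp add: lower_baire_def)
  then obtain V where V: "V \<in> nhds_in X x" "a < (INF y\<in>V. u y)"
    by (auto simp: less_SUP_iff)
  obtain U where U: "openin X U" "x \<in> U" "U \<subseteq> V"
    using V(1) by (rule nhds_inE)
  have "\<forall>y\<in>U. (INF y\<in>V. u y) \<le> u y"
    using U by (auto intro: INF_lower)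
  then show ?thesis using that U V by blast
qed

lemma upper_baire_lessE:
  assumes "upper_baire X u x < a" "x \<in> topspace X"
  obtains V b where "openin X V" "x \<in> V" "b < a" "\<forall>y\<in>V. u y \<le> b"
proof -
  have "(INF V\<in>nhds_in X x. SUP y\<in>V. u y) < a"
    using assms by (simp add: upper_baire_def)
  then obtain V where V: "V \<in> nhds_in X x" "(SUP y\<in>V. u y) < a"
    by (auto simp: INF_less_iff)
  obtain U where U: "openin X U" "x \<in> U" "U \<subseteq> V"
    using V(1) by (rule nhds_inE)
  have "\<forall>y\<in>U. u y \<le> (SUP y\<in>V. u y)"
    using U by (auto intro: SUP_upper)
  then show ?thesis using that U V by blast
qed

lemma le_lower_baireI:
  assumes "openin X W" "x \<in> W" "\<And>y. y \<in> W \<Longrightarrow> b \<le> u y"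
  shows "b \<le> lower_baire X u x"
proof -
  have "b \<le> (INF y\<in>W. u y)" using assms(3) by (rule INF_greatest)
  also have "\<dots> \<le> (SUP V\<in>nhds_in X x. INF y\<in>V. u y)"
    using assms by (intro SUP_upper nhds_in_open)
  finally show ?thesis
    using assms openin_subset[of X W] by (auto simp: lower_baire_def)
qed

lemma upper_baire_leI:
  assumes "openin X W" "x \<in> W" "\<And>y. y \<in> W \<Longrightarrow> u y \<le> b"
  shows "upper_baire X u x \<le> b"
proof -
  have "(INF V\<in>nhds_in X x. SUP y\<in>V. u y) \<le> (SUP y\<in>W. u y)"
    using assms by (intro INF_lower nhds_in_open)
  also have "\<dots> \<le> b" using assms(3) by (rule SUP_least)
  finally show ?thesis
    using assms openin_subset[of X W] by (auto simp: upper_baire_def)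
qed

lemma lower_baire_le:
  assumes "x \<in> topspace X"
  shows "lower_baire X u x \<le> u x"
proof (rule ccontr)
  assume "\<not> ?thesis"
  then have "u x < lower_baire X u x" by simp
  then obtain V b where "x \<in> V" "u x < b" "\<forall>y\<in>V. b \<le> u y"
    using assms by (rule less_lower_baireE)
  then show False by force
qed

lemma upper_baire_ge:
  assumes "x \<in> topspace X"
  shows "u x \<le> upper_baire X u x"
proof (rule ccontr)
  assume "\<not> ?thesis"
  then have "upper_baire X u x < u x" by simp
  then obtain V b where "x \<in> V" "b < u x" "\<forall>y\<in>V. u y \<le> b"
    using assms by (rule upper_baire_lessE)
  then show False by force
qed

lemma lower_baire_mono:
  assumes "\<And>y. y \<in> topspace X \<Longrightarrow> u y \<le> v y" "x \<in> topspace X"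
  shows "lower_baire X u x \<le> lower_baire X v x"
proof (rule ccontr)
  assume "\<not> ?thesis"
  then have "lower_baire X v x < lower_baire X u x" by simp
  then obtain V b where V: "openin X V" "x \<in> V" "lower_baire X v x < b" "\<forall>y\<in>V. b \<le> u y"
    using assms(2) by (rule less_lower_baireE)
  have "b \<le> lower_baire X v x"
    using V(1,2)
  proof (rule le_lower_baireI)
    show "b \<le> v y" if "y \<in> V" for y
      using that V(1,4) assms(1)[of y] openin_subset[of X V] order_trans by blast
  qed
  then show False using V by simp
qed

lemma upper_baire_mono:
  assumes "\<And>y. y \<in> topspace X \<Longrightarrow> u y \<le> v y" "x \<in> topspace X"
  shows "upper_baire X u x \<le> upper_baire X v x"
proof (rule ccontr)
  assume "\<not> ?thesis"
  then have "upper_baire X v x < upper_baire X u x" by simp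
  then obtain V b where V: "openin X V" "x \<in> V" "b < upper_baire X u x" "\<forall>y\<in>V. v y \<le> b"
    using assms(2) by (rule upper_baire_lessE)
  have "upper_baire X u x \<le> b"
    using V(1,2)
  proof (rule upper_baire_leI)
    show "u y \<le> b" if "y \<in> V" for y
      using that V(1,4) assms(1)[of y] openin_subset[of X V] order_trans by blast
  qed
  then show False using V by simp
qed

lemma openin_less_lower_baire: "openin X {x \<in> topspace X. a < lower_baire X u x}"
proof (subst openin_subopen, intro ballI)
  fix x assume "x \<in> {x \<in> topspace X. a < lower_baire X u x}"
  then have "a < lower_baire X u x" "x \<in> topspace X" by auto
  then obtain V b where V: "openin X V" "x \<in> V" "a < b" "\<forall>y\<in>V. b \<le> u y"
    by (rule less_lower_baireE)
  have "a < lower_baire X u y" if "y \<in> V" for y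
    using le_lower_baireI[OF V(1) that, of b u] V(3,4) by force
  then show "\<exists>T. openin X T \<and> x \<in> T \<and> T \<subseteq> {x \<in> topspace X. a < lower_baire X u x}"
    using V openin_subset[OF V(1)] by blast
qed

lemma openin_upper_baire_less: "openin X {x \<in> topspace X. upper_baire X u x < a}"
proof (subst openin_subopen, intro ballI)
  fix x assume "x \<in> {x \<in> topspace X. upper_baire X u x < a}"
  then have "upper_baire X u x < a" "x \<in> topspace X" by auto
  then obtain V b where V: "openin X V" "x \<in> V" "b < a" "\<forall>y\<in>V. u y \<le> b"
    by (rule upper_baire_lessE)
  have "upper_baire X u y < a" if "y \<in> V" for y
    using upper_baire_leI[OF V(1) that, of u b] V(3,4) by force
  then show "\<exists>T. openin X T \<and> x \<in> T \<and> T \<subseteq> {x \<in> topspace X. upper_baire X u x < a}"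
    using V openin_subset[OF V(1)] by blast
qed

lemma ereal_dense_rat:
  fixes a b :: ereal
  assumes "a < b"
  obtains p where "a < ereal (real_of_rat p)" "ereal (real_of_rat p) < b"
proof -
  obtain r where r: "a < ereal r" "ereal r < b" using ereal_dense2[OF assms] by blast
  obtain s where s: "ereal r < ereal s" "ereal s < b" using ereal_dense2[OF r(2)] by blast
  then obtain p where "r < real_of_rat p" "real_of_rat p < s" using of_rat_dense[of r s] by auto
  then have "ereal r < ereal (real_of_rat p)" "ereal (real_of_rat p) < ereal s" by simp_all
  then show ?thesis using that r s less_trans by blast
qed

lemma lower_baire_eq_if_lsc:
  assumes "\<And>p. openin X {y \<in> topspace X. ereal (real_of_rat p) < u y}" "x \<in> topspace X"
  shows "lower_baire X u x = u x"
proof (rule antisym[OF lower_baire_le[OF assms(2)]], rule ccontr)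
  assume "\<not> u x \<le> lower_baire X u x"
  then have "lower_baire X u x < u x" by simp
  then obtain p where p: "lower_baire X u x < ereal (real_of_rat p)" "ereal (real_of_rat p) < u x"
    by (rule ereal_dense_rat)
  have "ereal (real_of_rat p) \<le> lower_baire X u x"
    by (rule le_lower_baireI[OF assms(1)[of p]]) (use p assms(2) in auto)
  then show False using p by simp
qed

lemma upper_baire_eq_if_usc:
  assumes "\<And>p. openin X {y \<in> topspace X. u y < ereal (real_of_rat p)}" "x \<in> topspace X"
  shows "upper_baire X u x = u x"
proof (rule antisym[OF _ upper_baire_ge[OF assms(2)]], rule ccontr)
  assume "\<not> upper_baire X u x \<le> u x"
  then have "u x < upper_baire X u x" by simp
  then obtain p where p: "u x < ereal (real_of_rat p)" "ereal (real_of_rat p) < upper_baire X u x"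
    by (rule ereal_dense_rat)
  have "upper_baire X u x \<le> ereal (real_of_rat p)"
    by (rule upper_baire_leI[OF assms(1)[of p]]) (use p assms(2) in auto)
  then show False using p by simp
qed

text \<open>Ties an extended real function to a real representative through the pieces on which it
  is finite and close to \<open>f\<close>. Sums and multiples of functions with infinite values are
  handled by looking at such pieces only.\<close>

definition ess_approx :: "'a topology \<Rightarrow> ('a \<Rightarrow> ereal) \<Rightarrow> ('a \<Rightarrow> real) \<Rightarrow> bool" where
  "ess_approx X h f \<longleftrightarrow>
     (\<forall>e>0. densely X (\<lambda>W. \<forall>x\<in>W. \<exists>t. h x = ereal t \<and> \<bar>t - f x\<bar> \<le> e))"

lemma ess_approxE:
  assumes "ess_approx X h f" "0 < e" "openin X V" "V \<noteq> {}"
  obtains W where "openin X W" "W \<noteq> {}" "W \<subseteq> V"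
    "\<And>x. x \<in> W \<Longrightarrow> \<exists>t. h x = ereal t \<and> \<bar>t - f x\<bar> \<le> e"
proof -
  have "densely X (\<lambda>W. \<forall>x\<in>W. \<exists>t. h x = ereal t \<and> \<bar>t - f x\<bar> \<le> e)"
    using assms by (simp add: ess_approx_def)
  then obtain W where "openin X W" "W \<noteq> {}" "W \<subseteq> V" "\<forall>x\<in>W. \<exists>t. h x = ereal t \<and> \<bar>t - f x\<bar> \<le> e"
    using assms(3,4) by (rule denselyE)
  then show ?thesis using that by blast
qed

lemma ess_approxI:
  assumes "\<And>e V. 0 < e \<Longrightarrow> openin X V \<Longrightarrow> V \<noteq> {} \<Longrightarrow>
    \<exists>W. openin X W \<and> W \<noteq> {} \<and> W \<subseteq> V \<and> (\<forall>x\<in>W. \<exists>t. h x = ereal t \<and> \<bar>t - f x\<bar> \<le> e)"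
  shows "ess_approx X h f"
  unfolding ess_approx_def using assms by (auto intro!: denselyI)

lemma ess_approx_ereal: "ess_approx X (\<lambda>x. ereal (f x)) f"
proof (rule ess_approxI)
  fix e :: real and V assume e: "0 < e" and V: "openin X V" "V \<noteq> {}"
  then have "\<forall>x\<in>V. \<exists>t. ereal (f x) = ereal t \<and> \<bar>t - f x\<bar> \<le> e" by auto
  then show "\<exists>W. openin X W \<and> W \<noteq> {} \<and> W \<subseteq> V \<and> (\<forall>x\<in>W. \<exists>t. ereal (f x) = ereal t \<and> \<bar>t - f x\<bar> \<le> e)"
    using V by blast
qed

text \<open>Since \<open>f\<close> is nearly constant on a piece, a single value of \<open>h\<close>
  close to \<open>q\<close> bounds \<open>f\<close> from below on the whole piece, and
  \<open>upper_baire\<close> supplies such a value in every smaller open set. The bound is reached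
  on pieces inside \<open>V\<close>, hence the regularization.\<close>

lemma subset_regularize_above_if_le_upper_baire:
  assumes f: "f \<in> quasi_reals X" and h: "ess_approx X h f" and V: "openin X V"
    and le: "\<And>y. y \<in> V \<Longrightarrow> ereal q \<le> upper_baire X h y" and "p < q"
  shows "V \<subseteq> regularize X (above X f p)"
proof (rule subset_regularizeI[OF V])
  fix V' assume V': "openin X V'" "V' \<noteq> {}" "V' \<subseteq> V"
  \<comment> \<open>A value \<open>h y > q - e\<close> gives \<open>f y > q - 2 * e\<close>, then
    \<open>c \<ge> q - 3 * e\<close>, and \<open>f \<ge> q - 4 * e\<close> on \<open>W\<close>,
    which is still above \<open>p\<close>.\<close>
  define e where "e = (q - p) / 8"
  have e: "0 < e" using \<open>p < q\<close> by (simp add: e_def)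
  have q: "q = p + 8 * e" by (simp add: e_def diff_divide_distrib)
  obtain W c where W: "openin X W" "W \<noteq> {}" "W \<subseteq> V'" "\<And>x. x \<in> W \<Longrightarrow> \<bar>f x - c\<bar> \<le> e"
    using quasi_realsE[OF f e V'(1,2)] by metis
  obtain W' where W': "openin X W'" "W' \<noteq> {}" "W' \<subseteq> W"
    "\<And>x. x \<in> W' \<Longrightarrow> \<exists>t. h x = ereal t \<and> \<bar>t - f x\<bar> \<le> e"
    using ess_approxE[OF h e W(1,2)] by metis
  obtain y0 where y0: "y0 \<in> W'" using W' by blast
  have "\<exists>y\<in>W'. ereal (q - e) < h y"
  proof (rule ccontr)
    assume "\<not> ?thesis"
    then have "upper_baire X h y0 \<le> ereal (q - e)"
      by (intro upper_baire_leI[OF W'(1) y0]) (auto simp: not_less)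
    moreover have "ereal q \<le> upper_baire X h y0" using le y0 W' W V' by blast
    ultimately have "ereal q \<le> ereal (q - e)" by (rule order_trans[rotated])
    then show False using e by simp
  qed
  then obtain y where y: "y \<in> W'" "ereal (q - e) < h y" by blast
  then obtain t where t: "h y = ereal t" "\<bar>t - f y\<bar> \<le> e" using W'(4) by blast
  have "\<bar>f y - c\<bar> \<le> e" using y W W' by blast
  then have c: "q - 3 * e \<le> c" using t y by auto
  have "W \<subseteq> above X f p"
  proof (rule subset_aboveI[OF W(1)])
    show "p < q - 4 * e" using e q by linarith
    show "q - 4 * e \<le> f x" if "x \<in> W" for x using W(4)[OF that] c by linarith
  qed
  then show "V' \<inter> above X f p \<noteq> {}" using W by blast
qed

lemma le_upper_baire_if_subset_regularize_above:
  assumes h: "ess_approx X h f" and V: "openin X V" "V \<subseteq> regularize X (above X f q)" and y: "y \<in> V"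
  shows "ereal q \<le> upper_baire X h y"
proof (rule ccontr)
  assume "\<not> ?thesis"
  then have "upper_baire X h y < ereal q" by simp
  moreover have "y \<in> topspace X" using openin_subset[OF V(1)] y by blast
  ultimately obtain U b where U: "openin X U" "y \<in> U" "b < ereal q" "\<forall>z\<in>U. h z \<le> b"
    by (rule upper_baire_lessE)
  have VU: "openin X (V \<inter> U)" using V U by blast
  moreover have "(V \<inter> U) \<inter> regularize X (above X f q) \<noteq> {}" using y U V by blast
  ultimately have "(V \<inter> U) \<inter> above X f q \<noteq> {}" by (rule regularize_meets)
  then obtain z where z: "z \<in> V \<inter> U" "z \<in> above X f q" by blast
  obtain U' r where U': "openin X U'" "z \<in> U'" "q < r" "\<forall>x\<in>U'. r \<le> f x"
    using z(2) by (rule aboveE)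
  have "0 < r - q" "openin X (V \<inter> U \<inter> U')" "V \<inter> U \<inter> U' \<noteq> {}"
    using U' z VU by auto
  then obtain W where W: "W \<noteq> {}" "W \<subseteq> V \<inter> U \<inter> U'"
    "\<And>x. x \<in> W \<Longrightarrow> \<exists>t. h x = ereal t \<and> \<bar>t - f x\<bar> \<le> r - q"
    using ess_approxE[OF h] by metis
  then obtain w where w: "w \<in> W" by blast
  then obtain t where t: "h w = ereal t" "\<bar>t - f w\<bar> \<le> r - q" using W by blast
  have "r \<le> f w" "h w \<le> b" using w W U U' by auto
  moreover from this have "ereal t < ereal q" using t(1) U(3) by (metis le_less_trans)
  ultimately have "q \<le> t" "t < q" using t(2) by auto
  then show False by simp
qed

text \<open>The right-hand side mentions \<open>f\<close> but not \<open>h\<close>, so all functions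
  approximated by \<open>f\<close> have the same normalization. The quantifier over
  \<open>p > a\<close> cannot be replaced by the level \<open>a\<close>, since a union of regular
  open sets need not be regular.\<close>

lemma less_lower_upper_baire_iff:
  assumes f: "f \<in> quasi_reals X" and h: "ess_approx X h f" and x: "x \<in> topspace X"
  shows "ereal a < lower_baire X (upper_baire X h) x \<longleftrightarrow>
    (\<exists>p>a. x \<in> regularize X (above X f p))"
proof
  assume "ereal a < lower_baire X (upper_baire X h) x"
  then obtain V b where V: "openin X V" "x \<in> V" "ereal a < b" "\<forall>y\<in>V. b \<le> upper_baire X h y"
    using x by (rule less_lower_baireE)
  obtain q where q: "ereal a < ereal q" "ereal q < b" using ereal_dense2[OF V(3)] by blast
  obtain p where p: "a < p" "p < q" using q dense[of a q] by auto
  have "ereal q \<le> upper_baire X h y" if "y \<in> V" for y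
    using q(2) V(4) that by force
  then have "V \<subseteq> regularize X (above X f p)"
    by (rule subset_regularize_above_if_le_upper_baire[OF f h V(1) _ p(2)])
  then show "\<exists>p>a. x \<in> regularize X (above X f p)"
    using V p by blast
next
  assume "\<exists>p>a. x \<in> regularize X (above X f p)"
  then obtain p where p: "a < p" "x \<in> regularize X (above X f p)" by blast
  have "ereal a < ereal p" using p(1) by simp
  also have "ereal p \<le> lower_baire X (upper_baire X h) x"
    by (rule le_lower_baireI[OF openin_regularize p(2)])
      (rule le_upper_baire_if_subset_regularize_above[OF h openin_regularize order_refl])
  finally show "ereal a < lower_baire X (upper_baire X h) x" .
qed

section \<open>Normal lower semicontinuous functions as classes of quasi-continuous
  functions\<close>

definition NL_image :: "'a topology \<Rightarrow> ('a \<Rightarrow> real) \<Rightarrow> 'a \<Rightarrow> ereal" where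
  "NL_image X f = lower_baire X (upper_baire X (\<lambda>x. ereal (f x)))"

lemma lower_upper_baire_eq_NL_image:
  assumes f: "f \<in> quasi_reals X" and h: "ess_approx X h f"
  shows "lower_baire X (upper_baire X h) = NL_image X f"
proof
  fix x
  show "lower_baire X (upper_baire X h) x = NL_image X f x"
  proof (cases "x \<in> topspace X")
    case True
    then show ?thesis
      unfolding NL_image_def
      by (intro antisym ereal_le_if_reals_less)
        (simp_all add: less_lower_upper_baire_iff[OF f h] less_lower_upper_baire_iff[OF f ess_approx_ereal])
  qed (simp add: NL_image_def lower_baire_def)
qed

lemma less_NL_image_iff:
  assumes "f \<in> quasi_reals X" "x \<in> topspace X"
  shows "ereal a < NL_image X f x \<longleftrightarrow> (\<exists>p>a. x \<in> regularize X (above X f p))"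
  unfolding NL_image_def by (rule less_lower_upper_baire_iff[OF assms(1) ess_approx_ereal assms(2)])

lemma NL_image_bounds:
  assumes W: "openin X W" "x \<in> W" and f: "\<And>y. y \<in> W \<Longrightarrow> a \<le> f y \<and> f y \<le> b"
  shows "ereal a \<le> NL_image X f x" "upper_baire X (NL_image X f) x \<le> ereal b"
proof -
  have top: "y \<in> topspace X" if "y \<in> W" for y using that openin_subset[OF W(1)] by blast
  have "ereal a \<le> upper_baire X (\<lambda>x. ereal (f x)) y" if "y \<in> W" for y
    using upper_baire_ge[OF top[OF that], of "\<lambda>x. ereal (f x)"] f[OF that]
    by (meson ereal_less_eq(3) order_trans)
  then show "ereal a \<le> NL_image X f x"
    unfolding NL_image_def by (rule le_lower_baireI[OF W])
  have "upper_baire X (\<lambda>x. ereal (f x)) y \<le> ereal b" if "y \<in> W" for y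
    by (rule upper_baire_leI[OF W(1) that]) (simp add: f)
  then have "NL_image X f y \<le> ereal b" if "y \<in> W" for y
    unfolding NL_image_def using lower_baire_le[OF top[OF that]] that order_trans by blast
  then show "upper_baire X (NL_image X f) x \<le> ereal b"
    by (rule upper_baire_leI[OF W])
qed

lemma NL_image_le:
  assumes W: "openin X W" "x \<in> W" and f: "\<And>y. y \<in> W \<Longrightarrow> a \<le> f y \<and> f y \<le> b"
  shows "NL_image X f x \<le> ereal b"
proof -
  have "x \<in> topspace X" using W openin_subset[OF W(1)] by blast
  then have "NL_image X f x \<le> upper_baire X (NL_image X f) x" by (rule upper_baire_ge)
  also have "\<dots> \<le> ereal b" using W f by (rule NL_image_bounds(2))
  finally show ?thesis .
qed

lemma ess_approx_NL_image:
  assumes f: "f \<in> quasi_reals X"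
  shows "ess_approx X (NL_image X f) f"
proof (rule ess_approxI)
  fix e :: real and V assume e: "0 < e" and V: "openin X V" "V \<noteq> {}"
  have e2: "0 < e / 2" using e by simp
  obtain W c where W: "openin X W" "W \<noteq> {}" "W \<subseteq> V" "\<And>x. x \<in> W \<Longrightarrow> \<bar>f x - c\<bar> \<le> e / 2"
    using quasi_realsE[OF f e2 V] by metis
  have b: "c - e / 2 \<le> f y \<and> f y \<le> c + e / 2" if "y \<in> W" for y
    using W(4)[OF that] by linarith
  have "\<exists>t. NL_image X f x = ereal t \<and> \<bar>t - f x\<bar> \<le> e" if x: "x \<in> W" for x
  proof -
    have *: "ereal (c - e / 2) \<le> NL_image X f x" "NL_image X f x \<le> ereal (c + e / 2)"
      using NL_image_bounds(1)[OF W(1) x b] NL_image_le[OF W(1) x b] by auto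
    then obtain t where t: "NL_image X f x = ereal t" by (cases "NL_image X f x") auto
    then show ?thesis using * b[OF x] by (auto simp: abs_le_iff)
  qed
  then show "\<exists>W. openin X W \<and> W \<noteq> {} \<and> W \<subseteq> V \<and>
      (\<forall>x\<in>W. \<exists>t. NL_image X f x = ereal t \<and> \<bar>t - f x\<bar> \<le> e)"
    using W(1-3) by blast
qed

lemma NL_image_closed:
  assumes f: "f \<in> quasi_reals X"
  shows "NL_image X f \<in> NL X"
proof -
  \<comment> \<open>Normality comes from approximation: \<open>NL_image X f\<close> is itself
    approximated by \<open>f\<close>, so normalizing it gives the image of \<open>f\<close>
    again.\<close>
  have "lower_baire X (upper_baire X (NL_image X f)) = NL_image X f"
    by (rule lower_upper_baire_eq_NL_image[OF f ess_approx_NL_image[OF f]])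
  moreover have "X closure_of {x \<in> topspace X. \<bar>NL_image X f x\<bar> \<noteq> \<infinity>} = topspace X"
    unfolding dense_intersects_open
  proof (intro allI impI)
    fix V assume V: "openin X V \<and> V \<noteq> {}"
    then obtain W where W: "openin X W" "W \<noteq> {}" "W \<subseteq> V"
      "\<And>x. x \<in> W \<Longrightarrow> \<exists>t. NL_image X f x = ereal t \<and> \<bar>t - f x\<bar> \<le> 1"
      using ess_approxE[OF ess_approx_NL_image[OF f] zero_less_one] by metis
    then obtain x where x: "x \<in> W" by blast
    then have "\<bar>NL_image X f x\<bar> \<noteq> \<infinity>" using W(4) by fastforce
    moreover have "x \<in> topspace X" "x \<in> V" using x W(3) openin_subset[OF W(1)] by auto
    ultimately have "x \<in> {x \<in> topspace X. \<bar>NL_image X f x\<bar> \<noteq> \<infinity>} \<inter> V" by simp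
    then show "{x \<in> topspace X. \<bar>NL_image X f x\<bar> \<noteq> \<infinity>} \<inter> V \<noteq> {}" by (rule ne_empty)
  qed
  moreover have "NL_image X f \<in> extensional (topspace X)"
    by (simp add: NL_image_def lower_baire_def)
  ultimately show ?thesis by (simp add: NL_def)
qed

text \<open>At a point \<open>x\<close> of \<open>V\<close> with finite value \<open>c\<close>,
  lower semicontinuity keeps \<open>u\<close> above \<open>c - e\<close> nearby. The upper Baire
  function cannot be at least \<open>c + e\<close> on a whole neighbourhood of \<open>x\<close>, as
  then \<open>u x\<close> would be at least \<open>c + e\<close>; so it is smaller at some nearby
  \<open>y\<close>, and around \<open>y\<close> also \<open>u\<close> is at most
  \<open>c + e\<close>. The piece need not contain \<open>x\<close>.\<close>

lemma NL_pinched: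
  assumes u: "u \<in> NL X" and e: "0 < e" and V: "openin X V" "V \<noteq> {}"
  obtains W c where "openin X W" "W \<noteq> {}" "W \<subseteq> V"
    "\<And>x. x \<in> W \<Longrightarrow> \<exists>t. u x = ereal t \<and> \<bar>t - c\<bar> \<le> e"
proof -
  have IS: "lower_baire X (upper_baire X u) = u"
    and dense: "X closure_of {x \<in> topspace X. \<bar>u x\<bar> \<noteq> \<infinity>} = topspace X"
    using u by (auto simp: NL_def)
  have "{x \<in> topspace X. \<bar>u x\<bar> \<noteq> \<infinity>} \<inter> V \<noteq> {}"
    by (rule dense[unfolded dense_intersects_open, rule_format, OF conjI[OF V]])
  then obtain x where "x \<in> {x \<in> topspace X. \<bar>u x\<bar> \<noteq> \<infinity>} \<inter> V"
    unfolding ex_in_conv[symmetric] by (elim exE)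
  then have x: "x \<in> V" "x \<in> topspace X" "\<bar>u x\<bar> \<noteq> \<infinity>"
    by simp_all
  then obtain c where c: "u x = ereal c" by (cases "u x") auto
  have "ereal (c - e) < lower_baire X (upper_baire X u) x"
    using c e by (simp add: IS)
  then obtain U b where U: "openin X U" "x \<in> U" "ereal (c - e) < b" "\<forall>y\<in>U. b \<le> upper_baire X u y"
    using x(2) by (rule less_lower_baireE)
  have lower: "ereal (c - e) \<le> u y" if "y \<in> U" for y
  proof -
    have "b \<le> lower_baire X (upper_baire X u) y"
      using U(4) by (intro le_lower_baireI[OF U(1) that]) auto
    then show ?thesis using U(3) by (simp add: IS)
  qed
  have VU: "openin X (V \<inter> U)" "x \<in> V \<inter> U" using V U x by auto
  have "\<exists>y\<in>V \<inter> U. upper_baire X u y < ereal (c + e)"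
  proof (rule ccontr)
    assume "\<not> ?thesis"
    then have "ereal (c + e) \<le> lower_baire X (upper_baire X u) x"
      by (intro le_lower_baireI[OF VU]) (auto simp: not_less)
    then show False using c e by (simp add: IS)
  qed
  then obtain y where y: "y \<in> V \<inter> U" "upper_baire X u y < ereal (c + e)" by blast
  have "y \<in> topspace X" using y VU openin_subset by blast
  with y(2) obtain U' b' where U': "openin X U'" "y \<in> U'" "b' < ereal (c + e)" "\<forall>z\<in>U'. u z \<le> b'"
    by (rule upper_baire_lessE)
  have "\<exists>t. u z = ereal t \<and> \<bar>t - c\<bar> \<le> e" if "z \<in> V \<inter> U \<inter> U'" for z
  proof -
    have *: "ereal (c - e) \<le> u z" "u z \<le> ereal (c + e)"
      using lower that U'(3,4) by (auto intro: order_trans less_imp_le)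
    then obtain t where "u z = ereal t" by (cases "u z") auto
    then show ?thesis using * by (auto simp: abs_le_iff)
  qed
  moreover have "openin X (V \<inter> U \<inter> U')" "V \<inter> U \<inter> U' \<noteq> {}" using VU U' y by auto
  ultimately show ?thesis using that[of "V \<inter> U \<inter> U'" c] by blast
qed

lemma NL_image_surj:
  assumes u: "u \<in> NL X"
  shows "\<exists>f\<in>quasi_reals X. NL_image X f = u"
proof -
  \<comment> \<open>\<open>real_of_ereal\<close> sends infinite values to \<open>0\<close>; the
    pieces given by \<open>NL_pinched\<close> contain none.\<close>
  define f where "f x = real_of_ereal (u x)" for x
  have f: "f \<in> quasi_reals X"
  proof (rule quasi_realsI)
    fix e :: real and V assume "0 < e" "openin X V" "V \<noteq> {}"
    then obtain W c where W: "openin X W" "W \<noteq> {}" "W \<subseteq> V"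
      "\<And>x. x \<in> W \<Longrightarrow> \<exists>t. u x = ereal t \<and> \<bar>t - c\<bar> \<le> e"
      using NL_pinched[OF u] by metis
    then have "\<forall>x\<in>W. \<bar>f x - c\<bar> \<le> e" by (fastforce simp: f_def)
    then show "\<exists>W c. openin X W \<and> W \<noteq> {} \<and> W \<subseteq> V \<and> (\<forall>x\<in>W. \<bar>f x - c\<bar> \<le> e)"
      using W(1-3) by blast
  qed
  have "ess_approx X u f"
  proof (rule ess_approxI)
    fix e :: real and V assume e: "0 < e" and V: "openin X V" "V \<noteq> {}"
    then obtain W c where W: "openin X W" "W \<noteq> {}" "W \<subseteq> V"
      "\<And>x. x \<in> W \<Longrightarrow> \<exists>t. u x = ereal t \<and> \<bar>t - c\<bar> \<le> e"
      using NL_pinched[OF u] by metis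
    have "\<exists>t. u x = ereal t \<and> \<bar>t - f x\<bar> \<le> e" if "x \<in> W" for x
      using W(4)[OF that] e by (auto simp: f_def)
    then show "\<exists>W. openin X W \<and> W \<noteq> {} \<and> W \<subseteq> V \<and> (\<forall>x\<in>W. \<exists>t. u x = ereal t \<and> \<bar>t - f x\<bar> \<le> e)"
      using W(1-3) by blast
  qed
  then have "NL_image X f = u"
    using lower_upper_baire_eq_NL_image[OF f] u by (simp add: NL_def)
  then show ?thesis using f by blast
qed

lemma NL_image_le_iff:
  assumes f: "f \<in> quasi_reals X" and g: "g \<in> quasi_reals X"
  shows "(\<forall>x\<in>topspace X. NL_image X f x \<le> NL_image X g x) \<longleftrightarrow> ess_le X f g"
proof
  assume le: "\<forall>x\<in>topspace X. NL_image X f x \<le> NL_image X g x"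
  show "ess_le X f g"
  proof (rule ess_leI)
    fix e :: real and V assume e: "0 < e" and V: "openin X V" "V \<noteq> {}"
    have e2: "0 < e / 2" using e by simp
    obtain W where W: "openin X W" "W \<noteq> {}" "W \<subseteq> V"
      "\<And>x. x \<in> W \<Longrightarrow> \<exists>t. NL_image X f x = ereal t \<and> \<bar>t - f x\<bar> \<le> e / 2"
      using ess_approxE[OF ess_approx_NL_image[OF f] e2 V] by metis
    obtain W' where W': "openin X W'" "W' \<noteq> {}" "W' \<subseteq> W"
      "\<And>x. x \<in> W' \<Longrightarrow> \<exists>t. NL_image X g x = ereal t \<and> \<bar>t - g x\<bar> \<le> e / 2"
      using ess_approxE[OF ess_approx_NL_image[OF g] e2 W(1,2)] by metis
    have "f x \<le> g x + e" if x: "x \<in> W'" for x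
    proof -
      obtain s t where s: "NL_image X f x = ereal s" "\<bar>s - f x\<bar> \<le> e / 2"
        and t: "NL_image X g x = ereal t" "\<bar>t - g x\<bar> \<le> e / 2"
        using W(4) W'(3,4) x by blast
      have "x \<in> topspace X" using x openin_subset[OF W'(1)] by blast
      then have "ereal s \<le> ereal t" using le s t by metis
      then have "s \<le> t" by simp
      then show ?thesis using s(2) t(2) by linarith
    qed
    then show "\<exists>W. openin X W \<and> W \<noteq> {} \<and> W \<subseteq> V \<and> (\<forall>x\<in>W. f x \<le> g x + e)"
      using W(1-3) W'(1-3) by blast
  qed
next
  assume le: "ess_le X f g"
  have "regularize X (above X f p) \<subseteq> regularize X (above X g p)" for p
    by (rule regularize_subsetI) (rule above_meets_mono[OF le])
  then show "\<forall>x\<in>topspace X. NL_image X f x \<le> NL_image X g x"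
    by (intro ballI ereal_le_if_reals_less) (auto simp: less_NL_image_iff f g)
qed

lemma NL_image_cong:
  assumes "f \<in> quasi_reals X" "g \<in> quasi_reals X" "ess_le X f g" "ess_le X g f"
  shows "NL_image X f = NL_image X g"
proof
  fix x
  show "NL_image X f x = NL_image X g x"
  proof (cases "x \<in> topspace X")
    case True
    then show ?thesis
      using assms NL_image_le_iff[of f X g] NL_image_le_iff[of g X f] by (auto intro: antisym)
  qed (simp add: NL_image_def lower_baire_def)
qed

lemma NL_image_zero: "NL_image X (\<lambda>x. 0) = (\<lambda>x\<in>topspace X. 0)"
proof
  fix x
  show "NL_image X (\<lambda>x. 0) x = (\<lambda>x\<in>topspace X. 0) x"
  proof (cases "x \<in> topspace X")
    case True
    then have "ereal 0 \<le> NL_image X (\<lambda>x. 0) x" "NL_image X (\<lambda>x. 0) x \<le> ereal 0"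
      using NL_image_bounds(1)[OF openin_topspace True, of 0 "\<lambda>x. 0" 0]
        NL_image_le[OF openin_topspace True, of 0 "\<lambda>x. 0" 0] by auto
    then show ?thesis using True by (simp add: zero_ereal_def)
  qed (simp add: NL_image_def lower_baire_def)
qed

text \<open>After two shrinkings both summands are finite on the piece, so their sum there is the
  ordinary sum of two real numbers, each within \<open>e / 2\<close> of its representative.\<close>

lemma NL_image_add:
  assumes f: "f \<in> quasi_reals X" and g: "g \<in> quasi_reals X"
  shows "lower_baire X (upper_baire X (\<lambda>x\<in>topspace X. NL_image X f x + NL_image X g x)) =
    NL_image X (\<lambda>x. f x + g x)"
proof (rule lower_upper_baire_eq_NL_image[OF quasi_reals_add[OF f g]], rule ess_approxI)
  fix e :: real and V assume e: "0 < e" and V: "openin X V" "V \<noteq> {}"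
  have e2: "0 < e / 2" using e by simp
  obtain W where W: "openin X W" "W \<noteq> {}" "W \<subseteq> V"
    "\<And>x. x \<in> W \<Longrightarrow> \<exists>t. NL_image X f x = ereal t \<and> \<bar>t - f x\<bar> \<le> e / 2"
    using ess_approxE[OF ess_approx_NL_image[OF f] e2 V] by metis
  obtain W' where W': "openin X W'" "W' \<noteq> {}" "W' \<subseteq> W"
    "\<And>x. x \<in> W' \<Longrightarrow> \<exists>t. NL_image X g x = ereal t \<and> \<bar>t - g x\<bar> \<le> e / 2"
    using ess_approxE[OF ess_approx_NL_image[OF g] e2 W(1,2)] by metis
  have "\<exists>t. (\<lambda>x\<in>topspace X. NL_image X f x + NL_image X g x) x = ereal t \<and>
      \<bar>t - (f x + g x)\<bar> \<le> e" if x: "x \<in> W'" for x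
  proof -
    obtain s t where s: "NL_image X f x = ereal s" "\<bar>s - f x\<bar> \<le> e / 2"
      and t: "NL_image X g x = ereal t" "\<bar>t - g x\<bar> \<le> e / 2"
      using W(4) W'(3,4) x by blast
    have "x \<in> topspace X" using x openin_subset[OF W'(1)] by blast
    moreover have "\<bar>s + t - (f x + g x)\<bar> \<le> e" using s(2) t(2) by linarith
    ultimately show ?thesis using s t by (intro exI[of _ "s + t"]) simp
  qed
  then show "\<exists>W. openin X W \<and> W \<noteq> {} \<and> W \<subseteq> V \<and> (\<forall>x\<in>W.
      \<exists>t. (\<lambda>x\<in>topspace X. NL_image X f x + NL_image X g x) x = ereal t \<and> \<bar>t - (f x + g x)\<bar> \<le> e)"
    using W(1-3) W'(1-3) by blast
qed

lemma NL_image_scale: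
  assumes f: "f \<in> quasi_reals X"
  shows "lower_baire X (upper_baire X (\<lambda>x\<in>topspace X. ereal c * NL_image X f x)) =
    NL_image X (\<lambda>x. c * f x)"
proof (rule lower_upper_baire_eq_NL_image[OF quasi_reals_scale[OF f]], rule ess_approxI)
  fix e :: real and V assume e: "0 < e" and V: "openin X V" "V \<noteq> {}"
  \<comment> \<open>The summand \<open>1\<close> keeps the denominator positive for
    \<open>c = 0\<close>.\<close>
  define d where "d = e / (\<bar>c\<bar> + 1)"
  have d: "0 < d" using e by (simp add: d_def)
  have cd: "\<bar>c\<bar> * d \<le> e" using e by (simp add: d_def field_simps)
  obtain W where W: "openin X W" "W \<noteq> {}" "W \<subseteq> V"
    "\<And>x. x \<in> W \<Longrightarrow> \<exists>t. NL_image X f x = ereal t \<and> \<bar>t - f x\<bar> \<le> d"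
    using ess_approxE[OF ess_approx_NL_image[OF f] d V] by metis
  have "\<exists>t. (\<lambda>x\<in>topspace X. ereal c * NL_image X f x) x = ereal t \<and> \<bar>t - c * f x\<bar> \<le> e"
    if x: "x \<in> W" for x
  proof -
    obtain t where t: "NL_image X f x = ereal t" "\<bar>t - f x\<bar> \<le> d" using W(4)[OF x] by blast
    have "x \<in> topspace X" using x openin_subset[OF W(1)] by blast
    moreover have "\<bar>c * t - c * f x\<bar> \<le> e"
    proof -
      have "\<bar>c * t - c * f x\<bar> = \<bar>c\<bar> * \<bar>t - f x\<bar>" by (simp add: abs_mult flip: right_diff_distrib)
      also have "\<dots> \<le> \<bar>c\<bar> * d" using t by (intro mult_left_mono) auto
      finally show ?thesis using cd by linarith
    qed
    ultimately show ?thesis using t by (intro exI[of _ "c * t"]) simp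
  qed
  then show "\<exists>W. openin X W \<and> W \<noteq> {} \<and> W \<subseteq> V \<and>
      (\<forall>x\<in>W. \<exists>t. (\<lambda>x\<in>topspace X. ereal c * NL_image X f x) x = ereal t \<and> \<bar>t - c * f x\<bar> \<le> e)"
    using W(1-3) by blast
qed

lemma quasi_real_image_NL: "quasi_real_image X (NL_riesz X) (NL_image X)"
proof (unfold_locales, goal_cases)
  case 1
  show ?case
  proof (intro equalityI subsetI)
    fix u assume "u \<in> NL_image X ` quasi_reals X"
    then show "u \<in> carrier (NL_riesz X)"
      by (auto simp: NL_riesz_def NL_image_closed)
  next
    fix u assume "u \<in> carrier (NL_riesz X)"
    then show "u \<in> NL_image X ` quasi_reals X"
      using NL_image_surj[of u X] by (auto simp: NL_riesz_def)
  qed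
next
  case (4 f g)
  then show ?case by (intro NL_image_cong)
qed (simp_all add: NL_riesz_def NL_image_le_iff NL_image_zero NL_image_add NL_image_scale)

section \<open>Hausdorff continuous functions\<close>

lemma ext_intervals_iff: "I \<in> ext_intervals \<longleftrightarrow> I = {Inf I..Sup I} \<and> Inf I \<le> Sup I"
proof
  assume "I \<in> ext_intervals"
  then obtain a b where "I = {a..b}" "a \<le> b" by (auto simp: ext_intervals_def)
  then show "I = {Inf I..Sup I} \<and> Inf I \<le> Sup I" by simp
qed (auto simp: ext_intervals_def)

text \<open>Continuity is checked on the generators. The generator formed by all intervals makes
  their union equal to \<open>ext_intervals\<close>, so it accounts for the condition that
  \<open>f\<close> takes intervals as values.\<close>

lemma interval_cont_iff:
  "f \<in> interval_cont X \<longleftrightarrow> f \<in> extensional (topspace X) \<and>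
     (\<forall>x\<in>topspace X. f x = {Inf (f x)..Sup (f x)} \<and> Inf (f x) \<le> Sup (f x)) \<and>
     (\<forall>p. openin X {x \<in> topspace X. ereal (real_of_rat p) < Inf (f x)}) \<and>
     (\<forall>q. openin X {x \<in> topspace X. Sup (f x) < ereal (real_of_rat q)})"
proof (cases "\<forall>x\<in>topspace X. f x \<in> ext_intervals")
  case True
  have A: "f -` ext_intervals \<inter> topspace X = topspace X"
    "f -` {a \<in> ext_intervals. Inf a > ereal (real_of_rat p)} \<inter> topspace X =
      {x \<in> topspace X. ereal (real_of_rat p) < Inf (f x)}"
    "f -` {a \<in> ext_intervals. Sup a < ereal (real_of_rat q)} \<inter> topspace X =
      {x \<in> topspace X. Sup (f x) < ereal (real_of_rat q)}" for p q
    using True by auto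
  have B: "f ` topspace X \<subseteq> \<Union> ({ext_intervals} \<union>
      range (\<lambda>p :: rat. {a \<in> ext_intervals. Inf a > ereal (real_of_rat p)}) \<union>
      range (\<lambda>q :: rat. {a \<in> ext_intervals. Sup a < ereal (real_of_rat q)}))"
    using True by auto
  have ball_generators: "(\<forall>U. U \<in> {E} \<union> range P \<union> range Q \<longrightarrow> \<phi> U) \<longleftrightarrow>
      \<phi> E \<and> (\<forall>p. \<phi> (P p)) \<and> (\<forall>q. \<phi> (Q q))"
    for \<phi> :: "ereal set set \<Rightarrow> bool" and E and P Q :: "rat \<Rightarrow> ereal set set"
  proof (rule iffI)
    assume *: "\<forall>U. U \<in> {E} \<union> range P \<union> range Q \<longrightarrow> \<phi> U"
    have "\<phi> E" by (rule *[rule_format]) simp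
    moreover have "\<phi> (P p)" for p by (rule *[rule_format]) simp
    moreover have "\<phi> (Q q)" for q by (rule *[rule_format]) simp
    ultimately show "\<phi> E \<and> (\<forall>p. \<phi> (P p)) \<and> (\<forall>q. \<phi> (Q q))" by (intro conjI allI)
  qed (intro allI impI, elim UnE imageE singletonE conjE, simp_all)
  have C: "\<forall>x\<in>topspace X. f x = {Inf (f x)..Sup (f x)} \<and> Inf (f x) \<le> Sup (f x)"
    using True unfolding ext_intervals_iff .
  have "continuous_map X interval_topology f \<longleftrightarrow>
     (\<forall>p. openin X {x \<in> topspace X. ereal (real_of_rat p) < Inf (f x)}) \<and>
     (\<forall>q. openin X {x \<in> topspace X. Sup (f x) < ereal (real_of_rat q)})"
    unfolding interval_topology_def continuous_on_generated_topo_iff ball_generators A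
    using B by simp
  then show ?thesis using C by (simp add: interval_cont_def)
next
  case False
  have "f ` topspace X \<subseteq> ext_intervals" if "continuous_map X interval_topology f"
    using that unfolding interval_topology_def continuous_on_generated_topo_iff by blast
  then have "\<not> continuous_map X interval_topology f" using False by blast
  moreover have "\<not> (\<forall>x\<in>topspace X. f x = {Inf (f x)..Sup (f x)} \<and> Inf (f x) \<le> Sup (f x))"
    using False unfolding ext_intervals_iff .
  ultimately show ?thesis
    by (simp only: interval_cont_def mem_Collect_eq simp_thms)
qed

lemma interval_contI:
  assumes "\<And>x. x \<in> topspace X \<Longrightarrow> u x \<le> v x"
    and "\<And>p. openin X {x \<in> topspace X. ereal (real_of_rat p) < u x}"
    and "\<And>q. openin X {x \<in> topspace X. v x < ereal (real_of_rat q)}"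
  shows "(\<lambda>x\<in>topspace X. {u x..v x}) \<in> interval_cont X"
proof -
  have "{x \<in> topspace X. ereal (real_of_rat p) < Inf ((\<lambda>x\<in>topspace X. {u x..v x}) x)} =
      {x \<in> topspace X. ereal (real_of_rat p) < u x}" for p
    using assms(1) by auto
  moreover have "{x \<in> topspace X. Sup ((\<lambda>x\<in>topspace X. {u x..v x}) x) < ereal (real_of_rat q)} =
      {x \<in> topspace X. v x < ereal (real_of_rat q)}" for q
    using assms(1) by auto
  ultimately show ?thesis
    using assms unfolding interval_cont_iff by simp
qed

text \<open>Replacing the lower endpoint by the lower Baire function of the upper one, or the upper
  endpoint by the upper Baire function of the lower one, gives a continuous refinement of
  \<open>f\<close>. By maximality this refinement is \<open>f\<close>.\<close>

lemma hausdorff_continuous_bounds: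
  assumes "hausdorff_continuous X f" "x \<in> topspace X"
  shows "Inf (f x) = lower_baire X (\<lambda>y. Sup (f y)) x" "Sup (f x) = upper_baire X (\<lambda>y. Inf (f y)) x"
proof -
  have f: "f \<in> interval_cont X"
    and max: "\<And>g. g \<in> interval_cont X \<Longrightarrow> interval_refines X f g \<Longrightarrow> g = f"
    using assms(1) by (auto simp: hausdorff_continuous_def)
  have le: "\<And>y. y \<in> topspace X \<Longrightarrow> Inf (f y) \<le> Sup (f y)"
    and int: "\<And>y. y \<in> topspace X \<Longrightarrow> f y = {Inf (f y)..Sup (f y)}"
    and lsc: "\<And>p. openin X {x \<in> topspace X. ereal (real_of_rat p) < Inf (f x)}"
    and usc: "\<And>q. openin X {x \<in> topspace X. Sup (f x) < ereal (real_of_rat q)}"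
    using f unfolding interval_cont_iff by blast+
  let ?l = "lower_baire X (\<lambda>y. Sup (f y))" and ?u = "upper_baire X (\<lambda>y. Inf (f y))"
  have l: "Inf (f y) \<le> ?l y" "?l y \<le> Sup (f y)" if "y \<in> topspace X" for y
    using lower_baire_mono[of X "\<lambda>y. Inf (f y)" "\<lambda>y. Sup (f y)", OF le that]
      lower_baire_eq_if_lsc[of X "\<lambda>y. Inf (f y)", OF lsc that] lower_baire_le[OF that, of "\<lambda>y. Sup (f y)"]
    by simp_all
  have u: "Inf (f y) \<le> ?u y" "?u y \<le> Sup (f y)" if "y \<in> topspace X" for y
    using upper_baire_mono[of X "\<lambda>y. Inf (f y)" "\<lambda>y. Sup (f y)", OF le that]
      upper_baire_eq_if_usc[of X "\<lambda>y. Sup (f y)", OF usc that] upper_baire_ge[OF that, of "\<lambda>y. Inf (f y)"]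
    by simp_all
  have "(\<lambda>y\<in>topspace X. {?l y..Sup (f y)}) = f"
  proof (rule max)
    show "(\<lambda>y\<in>topspace X. {?l y..Sup (f y)}) \<in> interval_cont X"
      by (rule interval_contI[OF l(2) openin_less_lower_baire usc])
    have "{?l y..Sup (f y)} \<subseteq> f y" if "y \<in> topspace X" for y
      by (subst int[OF that]) (use l[OF that] in auto)
    then show "interval_refines X f (\<lambda>y\<in>topspace X. {?l y..Sup (f y)})"
      by (simp add: interval_refines_def)
  qed
  from fun_cong[OF this, of x] assms(2) have "f x = {?l x..Sup (f x)}" by simp
  from arg_cong[OF this, of Inf] show "Inf (f x) = ?l x" using l(2)[OF assms(2)] by simp
  have "(\<lambda>y\<in>topspace X. {Inf (f y)..?u y}) = f"
  proof (rule max)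
    show "(\<lambda>y\<in>topspace X. {Inf (f y)..?u y}) \<in> interval_cont X"
      by (rule interval_contI[OF u(1) lsc openin_upper_baire_less])
    have "{Inf (f y)..?u y} \<subseteq> f y" if "y \<in> topspace X" for y
      by (subst int[OF that]) (use u[OF that] in auto)
    then show "interval_refines X f (\<lambda>y\<in>topspace X. {Inf (f y)..?u y})"
      by (simp add: interval_refines_def)
  qed
  from fun_cong[OF this, of x] assms(2) have "f x = {Inf (f x)..?u x}" by simp
  from arg_cong[OF this, of Sup] show "Sup (f x) = ?u x" using u(1)[OF assms(2)] by simp
qed

definition Hnf_image :: "'a topology \<Rightarrow> ('a \<Rightarrow> real) \<Rightarrow> 'a \<Rightarrow> ereal set" where
  "Hnf_image X f = (\<lambda>x\<in>topspace X. {NL_image X f x..upper_baire X (NL_image X f) x})"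

lemma Hnf_image_bounds:
  assumes "x \<in> topspace X"
  shows "Inf (Hnf_image X f x) = NL_image X f x"
    "Sup (Hnf_image X f x) = upper_baire X (NL_image X f) x"
  using assms upper_baire_ge[OF assms, of "NL_image X f"] by (simp_all add: Hnf_image_def)

text \<open>Let \<open>u\<close> and \<open>v = S u\<close> be the bounds. The endpoints of a
  refinement \<open>g\<close> lie between them and, being semicontinuous, are fixed by the matching
  Baire operator. Hence \<open>v = S u \<le> S (Sup g) = Sup g\<close> and
  \<open>Inf g = I (Inf g) \<le> I v = u\<close>, so \<open>g\<close> has the same
  endpoints.\<close>

lemma hausdorff_continuous_Hnf_image:
  assumes f: "f \<in> quasi_reals X"
  shows "hausdorff_continuous X (Hnf_image X f)"
  unfolding hausdorff_continuous_def
proof (intro conjI ballI impI)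
  let ?u = "NL_image X f" and ?v = "upper_baire X (NL_image X f)"
  have IS: "lower_baire X ?v = ?u"
    using NL_image_closed[OF f] by (simp add: NL_def)
  have "openin X {x \<in> topspace X. ereal (real_of_rat p) < ?u x}" for p
    unfolding NL_image_def by (rule openin_less_lower_baire)
  then show "Hnf_image X f \<in> interval_cont X"
    unfolding Hnf_image_def by (intro interval_contI upper_baire_ge openin_upper_baire_less)
  fix g assume g: "g \<in> interval_cont X" and refines: "interval_refines X (Hnf_image X f) g"
  have ext: "g \<in> extensional (topspace X)"
    and le: "\<And>y. y \<in> topspace X \<Longrightarrow> Inf (g y) \<le> Sup (g y)"
    and int: "\<And>y. y \<in> topspace X \<Longrightarrow> g y = {Inf (g y)..Sup (g y)}"
    and lsc: "\<And>p. openin X {x \<in> topspace X. ereal (real_of_rat p) < Inf (g x)}"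
    and usc: "\<And>q. openin X {x \<in> topspace X. Sup (g x) < ereal (real_of_rat q)}"
    using g unfolding interval_cont_iff by blast+
  have between: "?u y \<le> Inf (g y)" "Sup (g y) \<le> ?v y" if y: "y \<in> topspace X" for y
  proof -
    have "g y \<subseteq> {?u y..?v y}"
      using refines y by (simp add: interval_refines_def Hnf_image_def)
    moreover define a b where "a = Inf (g y)" and "b = Sup (g y)"
    then have "g y = {a..b}" "a \<le> b"
      using int[OF y] le[OF y] by (simp_all only:)
    then have "Inf (g y) \<in> g y" "Sup (g y) \<in> g y" by simp_all
    ultimately show "?u y \<le> Inf (g y)" "Sup (g y) \<le> ?v y" by auto
  qed
  have upper: "Sup (g y) = ?v y" if y: "y \<in> topspace X" for y
  proof (rule antisym[OF between(2)[OF y]])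
    have "?v y \<le> upper_baire X (\<lambda>y. Sup (g y)) y"
      by (rule upper_baire_mono[OF _ y]) (use between(1) le order_trans in blast)
    then show "?v y \<le> Sup (g y)"
      by (simp only: upper_baire_eq_if_usc[of X "\<lambda>y. Sup (g y)", OF usc y])
  qed
  have lower: "Inf (g y) = ?u y" if y: "y \<in> topspace X" for y
  proof (rule antisym[OF _ between(1)[OF y]])
    have "lower_baire X (\<lambda>y. Inf (g y)) y \<le> lower_baire X ?v y"
      by (rule lower_baire_mono[OF _ y]) (use between(2) le order_trans in blast)
    then show "Inf (g y) \<le> ?u y"
      by (simp only: lower_baire_eq_if_lsc[of X "\<lambda>y. Inf (g y)", OF lsc y] IS)
  qed
  show "g = Hnf_image X f"
  proof
    fix x
    show "g x = Hnf_image X f x"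
    proof (cases "x \<in> topspace X")
      case True
      then show ?thesis by (subst int[OF True]) (simp add: lower upper Hnf_image_def)
    next
      case False
      then show ?thesis using ext by (simp add: Hnf_image_def extensional_def)
    qed
  qed
qed

lemma Hnf_image_closed:
  assumes f: "f \<in> quasi_reals X"
  shows "Hnf_image X f \<in> Hnf X"
proof -
  let ?S = "{x \<in> topspace X. \<bar>Inf (Hnf_image X f x)\<bar> \<noteq> \<infinity> \<and> \<bar>Sup (Hnf_image X f x)\<bar> \<noteq> \<infinity>}"
  have "X closure_of ?S = topspace X"
    unfolding dense_intersects_open
  proof (intro allI impI)
    fix V assume V: "openin X V \<and> V \<noteq> {}"
    then obtain W c where W: "openin X W" "W \<noteq> {}" "W \<subseteq> V" "\<And>x. x \<in> W \<Longrightarrow> \<bar>f x - c\<bar> \<le> 1"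
      using quasi_realsE[OF f zero_less_one] by metis
    then obtain x where x: "x \<in> W" by blast
    have b: "c - 1 \<le> f y \<and> f y \<le> c + 1" if "y \<in> W" for y
      using W(4)[OF that] by linarith
    have top: "x \<in> topspace X" using x openin_subset[OF W(1)] by blast
    have "ereal (c - 1) \<le> NL_image X f x" "upper_baire X (NL_image X f) x \<le> ereal (c + 1)"
      using NL_image_bounds[OF W(1) x b] by auto
    moreover have "NL_image X f x \<le> upper_baire X (NL_image X f) x"
      by (rule upper_baire_ge[OF top])
    ultimately have "\<bar>NL_image X f x\<bar> \<noteq> \<infinity> \<and> \<bar>upper_baire X (NL_image X f) x\<bar> \<noteq> \<infinity>"
      by (cases "NL_image X f x"; cases "upper_baire X (NL_image X f) x") auto
    then have "x \<in> ?S \<inter> V"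
      using top x W(3) by (simp add: Hnf_image_bounds subset_iff)
    then show "?S \<inter> V \<noteq> {}" by (rule ne_empty)
  qed
  then show ?thesis
    using hausdorff_continuous_Hnf_image[OF f] by (simp add: Hnf_def nearly_finite_interval_def)
qed

text \<open>The lower endpoint \<open>u\<close> is normal: its upper Baire function is the upper
  endpoint, and the lower Baire function of that is \<open>u\<close> again. A preimage of
  \<open>u\<close> under \<open>NL_image\<close> then represents \<open>F\<close>.\<close>

lemma Hnf_image_surj:
  assumes F: "F \<in> Hnf X"
  shows "\<exists>f\<in>quasi_reals X. Hnf_image X f = F"
proof -
  have H: "hausdorff_continuous X F" and nf: "nearly_finite_interval X F"
    using F by (auto simp: Hnf_def)
  have ext: "F \<in> extensional (topspace X)"
    and int: "\<And>y. y \<in> topspace X \<Longrightarrow> F y = {Inf (F y)..Sup (F y)}"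
    using H unfolding hausdorff_continuous_def interval_cont_iff by blast+
  define u where "u = (\<lambda>x\<in>topspace X. Inf (F x))"
  have upper: "upper_baire X u x = Sup (F x)" if x: "x \<in> topspace X" for x
  proof -
    have "upper_baire X u x = upper_baire X (\<lambda>y. Inf (F y)) x"
      by (intro antisym upper_baire_mono x) (simp_all add: u_def)
    then show ?thesis using hausdorff_continuous_bounds(2)[OF H x] by simp
  qed
  have "lower_baire X (upper_baire X u) = u"
  proof
    fix x
    show "lower_baire X (upper_baire X u) x = u x"
    proof (cases "x \<in> topspace X")
      case True
      have "lower_baire X (upper_baire X u) x = lower_baire X (\<lambda>y. Sup (F y)) x"
        by (intro antisym lower_baire_mono True) (simp_all add: upper)
      then show ?thesis using hausdorff_continuous_bounds(1)[OF H True] True by (simp add: u_def)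
    qed (simp add: lower_baire_def u_def)
  qed
  moreover have "X closure_of {x \<in> topspace X. \<bar>u x\<bar> \<noteq> \<infinity>} = topspace X"
  proof (rule antisym)
    have "topspace X = X closure_of {x \<in> topspace X. \<bar>Inf (F x)\<bar> \<noteq> \<infinity> \<and> \<bar>Sup (F x)\<bar> \<noteq> \<infinity>}"
      using nf by (simp add: nearly_finite_interval_def)
    also have "\<dots> \<subseteq> X closure_of {x \<in> topspace X. \<bar>u x\<bar> \<noteq> \<infinity>}"
      by (rule closure_of_mono) (auto simp: u_def)
    finally show "topspace X \<subseteq> X closure_of {x \<in> topspace X. \<bar>u x\<bar> \<noteq> \<infinity>}" .
  qed (rule closure_of_subset_topspace)
  ultimately have "u \<in> NL X" by (simp add: NL_def u_def)
  then obtain f where f: "f \<in> quasi_reals X" "NL_image X f = u"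
    using NL_image_surj by blast
  have "Hnf_image X f = F"
  proof
    fix x
    show "Hnf_image X f x = F x"
    proof (cases "x \<in> topspace X")
      case True
      then have "u x = Inf (F x)" by (simp add: u_def)
      then show ?thesis
        using True by (subst int[OF True]) (simp add: Hnf_image_def f(2) upper)
    next
      case False
      then show ?thesis using ext by (simp add: Hnf_image_def extensional_def)
    qed
  qed
  then show ?thesis using f(1) by blast
qed

text \<open>The sets cut out by the two endpoints differ from the superlevel sets of
  \<open>f\<close> and \<open>- f\<close>, but they meet the same open sets. Through this the
  transported operations of \<open>Hnf_riesz\<close> can be computed on representatives.\<close>

lemma Hnf_to_frame_Hnf_image:
  assumes f: "f \<in> quasi_reals X"
  shows "Hnf_to_frame X (Hnf_image X f) = frame_image X f"
proof -
  let ?u = "NL_image X f"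
  have "regularize X {x \<in> topspace X. ereal p < ?u x} = regularize X (above X f p)" for p
  proof (rule regularize_eqI)
    fix V assume V: "openin X V"
    show "V \<inter> {x \<in> topspace X. ereal p < ?u x} \<noteq> {} \<longleftrightarrow> V \<inter> above X f p \<noteq> {}"
    proof
      assume "V \<inter> {x \<in> topspace X. ereal p < ?u x} \<noteq> {}"
      then obtain x where x: "x \<in> V" "x \<in> topspace X" "ereal p < ?u x" by blast
      then obtain q where q: "p < q" "x \<in> regularize X (above X f q)"
        using less_NL_image_iff[OF f x(2)] by blast
      have "V \<inter> regularize X (above X f q) \<noteq> {}" using q(2) x(1) by blast
      then have "V \<inter> above X f q \<noteq> {}" by (rule regularize_meets[OF V])
      then show "V \<inter> above X f p \<noteq> {}"
        using above_antimono[OF less_imp_le[OF q(1)], of X f] by blast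
    next
      assume "V \<inter> above X f p \<noteq> {}"
      then obtain x where x: "x \<in> V" "x \<in> above X f p" by blast
      obtain q where q: "p < real_of_rat q" "x \<in> above X f (real_of_rat q)"
        using x(2) unfolding above_eq_Union[of X f p] by blast
      then have "x \<in> regularize X (above X f (real_of_rat q))"
        using regularize_increasing[OF openin_above[of X f "real_of_rat q"]] by blast
      moreover have top: "x \<in> topspace X"
        using x(1) openin_subset[OF V] by blast
      ultimately have "ereal p < ?u x" using less_NL_image_iff[OF f top] q(1) by blast
      then show "V \<inter> {x \<in> topspace X. ereal p < ?u x} \<noteq> {}" using x(1) top by blast
    qed
  qed
  moreover have "regularize X {x \<in> topspace X. upper_baire X ?u x < ereal q} =
    regularize X (above X (\<lambda>x. - f x) (- q))" for q
  proof (rule regularize_eqI)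
    fix V assume V: "openin X V"
    show "V \<inter> {x \<in> topspace X. upper_baire X ?u x < ereal q} \<noteq> {} \<longleftrightarrow>
      V \<inter> above X (\<lambda>x. - f x) (- q) \<noteq> {}"
    proof
      assume "V \<inter> {x \<in> topspace X. upper_baire X ?u x < ereal q} \<noteq> {}"
      then obtain x where x: "x \<in> V" "x \<in> topspace X" "upper_baire X ?u x < ereal q" by blast
      obtain U b where U: "openin X U" "x \<in> U" "b < ereal q" "\<forall>y\<in>U. ?u y \<le> b"
        using x(3,2) by (rule upper_baire_lessE)
      obtain r where r: "b < ereal r" "ereal r < ereal q" using ereal_dense2[OF U(3)] by blast
      \<comment> \<open>On \<open>W\<close>, \<open>?u\<close> is below \<open>r\<close> and
        \<open>f\<close> exceeds \<open>?u\<close> by at most \<open>e\<close>, so \<open>f\<close>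
        is at most \<open>r + e\<close>, which leaves the gap \<open>e\<close> below
        \<open>q\<close>.\<close>
      define e where "e = (q - r) / 2"
      have e: "0 < e" using r by (simp add: e_def)
      have q: "q = r + 2 * e" by (simp add: e_def diff_divide_distrib)
      have "openin X (V \<inter> U)" "V \<inter> U \<noteq> {}" using V U x by auto
      then obtain W where W: "openin X W" "W \<noteq> {}" "W \<subseteq> V \<inter> U"
        "\<And>x. x \<in> W \<Longrightarrow> \<exists>t. ?u x = ereal t \<and> \<bar>t - f x\<bar> \<le> e"
        using ess_approxE[OF ess_approx_NL_image[OF f] e] by metis
      have "W \<subseteq> above X (\<lambda>x. - f x) (- q)"
      proof (rule subset_aboveI[OF W(1)])
        show "- q < - (r + e)" using e q by linarith
        show "- (r + e) \<le> - f y" if y: "y \<in> W" for y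
        proof -
          obtain t where t: "?u y = ereal t" "\<bar>t - f y\<bar> \<le> e" using W(4)[OF y] by blast
          have "y \<in> U" using y W(3) by blast
          then have "ereal t \<le> b" using U(4) t(1) by metis
          then have "ereal t < ereal r" using r(1) by (rule le_less_trans)
          then show ?thesis using t(2) by simp
        qed
      qed
      then show "V \<inter> above X (\<lambda>x. - f x) (- q) \<noteq> {}" using W(1-3) by blast
    next
      assume "V \<inter> above X (\<lambda>x. - f x) (- q) \<noteq> {}"
      then obtain x where x: "x \<in> V" "x \<in> above X (\<lambda>x. - f x) (- q)" by blast
      have top: "x \<in> topspace X"
        using x(1) openin_subset[OF V] by blast
      obtain U s where U: "openin X U" "x \<in> U" "- q < s" "\<forall>y\<in>U. s \<le> - f y"
        using x(2) by (rule aboveE)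
      have "upper_baire X (\<lambda>x. ereal (f x)) y \<le> ereal (- s)" if "y \<in> U" for y
        by (rule upper_baire_leI[OF U(1) that]) (use U(4) in force)
      then have "?u y \<le> ereal (- s)" if "y \<in> U" for y
        unfolding NL_image_def using lower_baire_le[of y X] that openin_subset[OF U(1)]
        by (meson order_trans subsetD)
      then have "upper_baire X ?u x \<le> ereal (- s)"
        by (rule upper_baire_leI[OF U(1,2)])
      also have "ereal (- s) < ereal q" using U(3) by simp
      finally show "V \<inter> {x \<in> topspace X. upper_baire X ?u x < ereal q} \<noteq> {}"
        using x(1) top by blast
    qed
  qed
  moreover have "{x \<in> topspace X. ereal p < Inf (Hnf_image X f x)} = {x \<in> topspace X. ereal p < ?u x}"
    "{x \<in> topspace X. Sup (Hnf_image X f x) < ereal p} = {x \<in> topspace X. upper_baire X ?u x < ereal p}"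
    for p
    by (auto simp: Hnf_image_bounds)
  ultimately show ?thesis
    by (simp add: Hnf_to_frame_def frame_image_def flip: regularize_def)
qed

lemma Hnf_image_le_iff:
  assumes f: "f \<in> quasi_reals X" and g: "g \<in> quasi_reals X"
  shows "interval_le X (Hnf_image X f) (Hnf_image X g) \<longleftrightarrow> ess_le X f g"
proof -
  have "interval_le X (Hnf_image X f) (Hnf_image X g) \<longleftrightarrow>
      (\<forall>x\<in>topspace X. NL_image X f x \<le> NL_image X g x)"
    using upper_baire_mono[of X "NL_image X f" "NL_image X g"]
    by (auto simp: interval_le_def Hnf_image_bounds)
  then show ?thesis by (simp add: NL_image_le_iff f g)
qed

text \<open>The operations of \<open>Hnf_riesz\<close> go through an inverse of
  \<open>Hnf_to_frame\<close>. Once that map is shown to be injective on \<open>Hnf X\<close>, the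
  inverse takes \<open>frame_image X f\<close> to \<open>Hnf_image X f\<close>, and the laws are
  those of the frame homomorphisms.\<close>

lemma quasi_real_image_Hnf: "quasi_real_image X (Hnf_riesz X) (Hnf_image X)"
proof -
  interpret F: quasi_real_image X "frame_real_riesz (regular_opens X)" "frame_image X"
    by (rule quasi_real_image_frame)
  define \<Psi> where "\<Psi> = inv_into (Hnf X) (Hnf_to_frame X)"
  have cong: "Hnf_image X f = Hnf_image X g"
    if "f \<in> quasi_reals X" "g \<in> quasi_reals X" "ess_le X f g" "ess_le X g f" for f g
    using NL_image_cong[OF that] by (simp add: Hnf_image_def)
  have "inj_on (Hnf_to_frame X) (Hnf X)"
  proof (rule inj_onI)
    fix a b assume ab: "a \<in> Hnf X" "b \<in> Hnf X" "Hnf_to_frame X a = Hnf_to_frame X b"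
    obtain f g where f: "f \<in> quasi_reals X" "a = Hnf_image X f"
      and g: "g \<in> quasi_reals X" "b = Hnf_image X g"
      using Hnf_image_surj[OF ab(1)] Hnf_image_surj[OF ab(2)] by blast
    then have "frame_image X f = frame_image X g"
      using ab(3) by (simp add: Hnf_to_frame_Hnf_image)
    then have "ess_le X f g" "ess_le X g f" using f(1) g(1) by (simp_all add: F.eq_iff)
    then show "a = b" using cong[OF f(1) g(1)] f(2) g(2) by simp
  qed
  then have \<Psi>: "\<Psi> (frame_image X f) = Hnf_image X f" if "f \<in> quasi_reals X" for f
    using that Hnf_image_closed[OF that] by (simp add: \<Psi>_def flip: Hnf_to_frame_Hnf_image)
  note Hnf_riesz = Hnf_riesz_def[of X, unfolded Let_def, folded \<Psi>_def]
  show ?thesis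
  proof (unfold_locales, goal_cases)
    case 1
    show ?case
    proof (intro equalityI subsetI)
      fix u assume "u \<in> Hnf_image X ` quasi_reals X"
      then show "u \<in> carrier (Hnf_riesz X)"
        by (auto simp: Hnf_riesz_def Let_def Hnf_image_closed)
    next
      fix u assume "u \<in> carrier (Hnf_riesz X)"
      then show "u \<in> Hnf_image X ` quasi_reals X"
        using Hnf_image_surj[of u X] by (auto simp: Hnf_riesz_def Let_def)
    qed
  next
    case (4 f g)
    then show ?case by (intro cong)
  qed (simp_all add: Hnf_riesz Hnf_image_le_iff Hnf_to_frame_Hnf_image F.vzero F.vadd F.vscale \<Psi>
    quasi_reals_const quasi_reals_add quasi_reals_scale)
qed

section \<open>Universal completions of spaces of continuous functions\<close>

lemma above_min:
  assumes "x \<in> above X f p" "x \<in> above X g p"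
  shows "x \<in> above X (\<lambda>x. min (f x) (g x)) p"
proof -
  obtain U a where U: "openin X U" "x \<in> U" "p < a" "\<forall>y\<in>U. a \<le> f y"
    using assms(1) by (rule aboveE)
  obtain U' b where U': "openin X U'" "x \<in> U'" "p < b" "\<forall>y\<in>U'. b \<le> g y"
    using assms(2) by (rule aboveE)
  have "U \<inter> U' \<subseteq> above X (\<lambda>x. min (f x) (g x)) p"
  proof (rule subset_aboveI)
    show "openin X (U \<inter> U')" using U(1) U'(1) by blast
    show "p < min a b" using U(3) U'(3) by simp
    show "min a b \<le> min (f y) (g y)" if "y \<in> U \<inter> U'" for y
      using that U(4) U'(4) by (intro min.mono) auto
  qed
  then show ?thesis using U(2) U'(2) by blast
qed

section \<open>Dedekind and lateral completeness of the quotient\<close>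

context quasi_real_image
begin

text \<open>The superlevel sets of a supremum are, up to regularization, the unions of those of the
  members, and \<open>cut_fun\<close> makes a function of these unions. The bound is asked for on
  pieces only, so that the lemma covers bounded sets and disjoint sets alike.\<close>

lemma lub_exists:
  assumes A: "A \<subseteq> carrier R" "A \<noteq> {}"
    and bounded: "densely X (\<lambda>W. \<exists>k. \<forall>f\<in>quasi_reals X. \<rho> f \<in> A \<longrightarrow> W \<inter> above X f k = {})"
  shows "\<exists>s. is_lub R s A"
proof -
  define B where "B = {f \<in> quasi_reals X. \<rho> f \<in> A}"
  have B: "B \<subseteq> quasi_reals X" and AB: "A = \<rho> ` B"
    using A(1) image unfolding B_def by auto
  define L where "L p = (\<Union>f\<in>B. above X f p)" for p
  interpret L: cut_family X L
  proof
    show "openin X (L p)" for p unfolding L_def by (intro openin_Union) (auto simp: openin_above)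
    show "L q \<subseteq> L p" if "p \<le> q" for p q unfolding L_def by (intro UN_mono above_antimono that order_refl)
    show "densely X (\<lambda>W. \<exists>a b. W \<subseteq> L a \<and> W \<inter> L b = {})"
    proof (rule denselyI)
      fix V assume V: "openin X V" "V \<noteq> {}"
      obtain W where W: "openin X W" "W \<noteq> {}" "W \<subseteq> V"
        "\<exists>k. \<forall>f\<in>quasi_reals X. \<rho> f \<in> A \<longrightarrow> W \<inter> above X f k = {}"
        using bounded V by (rule denselyE)
      then obtain k where k: "W \<inter> L k = {}" unfolding L_def B_def by blast
      \<comment> \<open>One member already gives the lower level that \<open>bounded_L\<close> asks
        for.\<close>
      obtain f where f: "f \<in> B" using A(2) AB by blast
      then have fQ: "f \<in> quasi_reals X" using B by blast
      obtain p where p: "W \<inter> above X f (real_of_rat p) \<noteq> {}"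
        using above_meets_some[OF fQ W(1,2)] by blast
      let ?W = "W \<inter> above X f (real_of_rat p)"
      have "openin X ?W" by (intro openin_Int W(1) openin_above)
      moreover have "?W \<subseteq> L (real_of_rat p)" using f unfolding L_def by blast
      moreover have "?W \<inter> L k = {}" using k by blast
      ultimately show "\<exists>W. openin X W \<and> W \<noteq> {} \<and> W \<subseteq> V \<and> (\<exists>a b. W \<subseteq> L a \<and> W \<inter> L b = {})"
        using p W(3) by blast
    qed
  qed
  let ?s = "cut_fun L"
  have s: "?s \<in> quasi_reals X" by (rule L.cut_fun_quasi_real)
  have upper: "ess_le X f ?s" if f: "f \<in> B" for f
  proof (rule ess_le_if_above_meets[OF _ s])
    show "f \<in> quasi_reals X" using f B by blast
    fix V p assume V: "openin X V" and meets: "V \<inter> above X f (real_of_rat p) \<noteq> {}"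
    then obtain q where q: "real_of_rat p < real_of_rat q" "V \<inter> above X f (real_of_rat q) \<noteq> {}"
      unfolding above_eq_Union[of X f "real_of_rat p"] by blast
    then have "V \<inter> L (real_of_rat q) \<noteq> {}" using f unfolding L_def by blast
    then show "V \<inter> above X ?s (real_of_rat p) \<noteq> {}"
      using q(1) by (rule L.meets_above_cut_fun[OF V])
  qed
  have least: "ess_le X ?s u" if u: "u \<in> quasi_reals X" "\<forall>f\<in>B. ess_le X f u" for u
  proof (rule ess_le_if_above_meets[OF s u(1)])
    fix V p assume V: "openin X V" and meets: "V \<inter> above X ?s (real_of_rat p) \<noteq> {}"
    then have "V \<inter> L (real_of_rat p) \<noteq> {}" by (rule L.above_cut_fun_meets)
    then obtain f where f: "f \<in> B" "V \<inter> above X f (real_of_rat p) \<noteq> {}"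
      unfolding L_def by blast
    show "V \<inter> above X u (real_of_rat p) \<noteq> {}"
      using bspec[OF u(2) f(1)] V f(2) by (rule above_meets_mono)
  qed
  have "is_lub R (\<rho> ?s) A"
    unfolding is_lub_iff[OF A(1)]
  proof (intro conjI ballI impI)
    show "\<rho> ?s \<in> carrier R" using s by (rule closed)
    show "x \<sqsubseteq>\<^bsub>R\<^esub> \<rho> ?s" if x: "x \<in> A" for x
    proof -
      obtain f where f: "f \<in> B" "x = \<rho> f" using x AB by blast
      then show ?thesis using upper B s by (simp add: le_iff subsetD)
    qed
    fix y assume y: "y \<in> carrier R" "\<forall>x\<in>A. x \<sqsubseteq>\<^bsub>R\<^esub> y"
    obtain u where u: "u \<in> quasi_reals X" "y = \<rho> u" using y(1) by (rule carrierE)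
    have "\<forall>f\<in>B. ess_le X f u"
    proof
      fix f assume f: "f \<in> B"
      then have "\<rho> f \<sqsubseteq>\<^bsub>R\<^esub> \<rho> u" using y(2) u(2) AB by blast
      then show "ess_le X f u" using f B u(1) by (simp add: le_iff subsetD)
    qed
    then show "\<rho> ?s \<sqsubseteq>\<^bsub>R\<^esub> y" using least u s by (simp add: le_iff)
  qed
  then show ?thesis by blast
qed

lemma dedekind_complete: "dedekind_complete R"
  unfolding dedekind_complete_def
proof (intro allI impI, elim conjE)
  fix A assume A: "A \<subseteq> carrier R" "A \<noteq> {}" "Upper R A \<noteq> {}"
  then obtain y where y: "y \<in> carrier R" "\<And>x. x \<in> A \<Longrightarrow> x \<sqsubseteq>\<^bsub>R\<^esub> y"
    unfolding Upper_def by blast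
  obtain g where g: "g \<in> quasi_reals X" "y = \<rho> g" using y(1) by (rule carrierE)
  show "\<exists>s. is_lub R s A"
  proof (rule lub_exists[OF A(1,2)], rule denselyI)
    fix V assume V: "openin X V" "V \<noteq> {}"
    obtain W c where W: "openin X W" "W \<noteq> {}" "W \<subseteq> V" "\<And>x. x \<in> W \<Longrightarrow> \<bar>g x - c\<bar> \<le> 1"
      using quasi_realsE[OF g(1) zero_less_one V] by metis
    have disjoint: "W \<inter> above X g (c + 1) = {}"
      using W(4) above_less[of _ X g "c + 1"] by force
    have "W \<inter> above X f (c + 1) = {}" if f: "f \<in> quasi_reals X" "\<rho> f \<in> A" for f
    proof (rule ccontr)
      assume meets: "W \<inter> above X f (c + 1) \<noteq> {}"
      have "ess_le X f g" using y(2)[OF f(2)] f(1) g by (simp add: le_iff)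
      then have "W \<inter> above X g (c + 1) \<noteq> {}" using W(1) meets by (rule above_meets_mono)
      then show False using disjoint by simp
    qed
    then show "\<exists>W. openin X W \<and> W \<noteq> {} \<and> W \<subseteq> V \<and>
        (\<exists>k. \<forall>f\<in>quasi_reals X. \<rho> f \<in> A \<longrightarrow> W \<inter> above X f k = {})"
      using W(1-3) by blast
  qed
qed

text \<open>On a piece where one member is positive, the members of other classes have no part above
  \<open>0\<close>, so a bound for that one member bounds the whole family there. Where no member is
  positive, \<open>0\<close> is a bound.\<close>

lemma laterally_complete: "laterally_complete R"
  unfolding laterally_complete_def
proof (intro allI impI, elim conjE)
  fix A assume A: "A \<subseteq> carrier R" "A \<noteq> {}"
    and disj: "\<forall>x\<in>A. \<forall>y\<in>A. x \<noteq> y \<longrightarrow> x \<sqinter>\<^bsub>R\<^esub> y = vzero R"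
  have zero_above: "V \<inter> above X f 0 \<inter> above X g 0 = {}"
    if fg: "f \<in> quasi_reals X" "g \<in> quasi_reals X" "\<rho> f \<in> A" "\<rho> g \<in> A" "\<rho> f \<noteq> \<rho> g" for f g V
  proof (rule ccontr)
    assume "V \<inter> above X f 0 \<inter> above X g 0 \<noteq> {}"
    then obtain x where "x \<in> above X f 0" "x \<in> above X g 0" by blast
    then have x: "x \<in> above X (\<lambda>x. min (f x) (g x)) 0" by (rule above_min)
    have "\<rho> f \<sqinter>\<^bsub>R\<^esub> \<rho> g = vzero R" using disj fg by blast
    then have "ess_le X (\<lambda>x. min (f x) (g x)) (\<lambda>x. 0)"
      using fg by (simp add: meet_eq vzero eq_iff quasi_reals_min quasi_reals_const)
    then have "above X (\<lambda>x. min (f x) (g x)) 0 \<inter> above X (\<lambda>x. 0) 0 \<noteq> {}"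
      using openin_above by (rule above_meets_mono) (use x in blast)
    then show False by (simp add: above_zero)
  qed
  show "\<exists>s. is_lub R s A"
  proof (rule lub_exists[OF A(1,2)], rule denselyI)
    fix V assume V: "openin X V" "V \<noteq> {}"
    show "\<exists>W. openin X W \<and> W \<noteq> {} \<and> W \<subseteq> V \<and>
        (\<exists>k. \<forall>f\<in>quasi_reals X. \<rho> f \<in> A \<longrightarrow> W \<inter> above X f k = {})"
    proof (cases "\<exists>f\<in>quasi_reals X. \<rho> f \<in> A \<and> V \<inter> above X f 0 \<noteq> {}")
      case True
      then obtain f where f: "f \<in> quasi_reals X" "\<rho> f \<in> A" and meets: "V \<inter> above X f 0 \<noteq> {}"
        by blast
      have "openin X (V \<inter> above X f 0)" by (intro openin_Int V(1) openin_above)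
      then obtain W c where W: "openin X W" "W \<noteq> {}" "W \<subseteq> V \<inter> above X f 0"
        "\<And>x. x \<in> W \<Longrightarrow> \<bar>f x - c\<bar> \<le> 1"
        using quasi_realsE[OF f(1) zero_less_one _ meets] by metis
      \<comment> \<open>At least \<open>0\<close>, so that the members with no part above
        \<open>0\<close> in \<open>W\<close> have none above \<open>?k\<close> either.\<close>
      let ?k = "max 0 (c + 1)"
      have disjoint: "W \<inter> above X f ?k = {}"
        using W(4) above_less[of _ X f ?k] by force
      have "W \<inter> above X g ?k = {}" if g: "g \<in> quasi_reals X" "\<rho> g \<in> A" for g
      proof (cases "\<rho> f = \<rho> g")
        case True
        then have le: "ess_le X g f" using f g by (simp add: eq_iff)
        show ?thesis
        proof (rule ccontr)
          assume "W \<inter> above X g ?k \<noteq> {}"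
          then have "W \<inter> above X f ?k \<noteq> {}" by (rule above_meets_mono[OF le W(1)])
          then show False using disjoint by simp
        qed
      next
        case False
        then have "W \<inter> above X f 0 \<inter> above X g 0 = {}"
          using f g by (intro zero_above)
        then show ?thesis using W(3) above_antimono[of 0 ?k X g] by auto
      qed
      then show ?thesis using W(1-3) by blast
    next
      case False
      then show ?thesis using V by blast
    qed
  qed
qed

lemma universally_complete: "universally_complete R"
  by (simp add: universally_complete_def riesz_space dedekind_complete laterally_complete)

end

section \<open>The Riesz space of continuous functions and its order density\<close>

lemma cont_riesz_simps:
  "carrier (cont_riesz X) = {f \<in> extensional (topspace X). continuous_map X euclideanreal f}"
  "le (cont_riesz X) f g \<longleftrightarrow> (\<forall>x\<in>topspace X. f x \<le> g x)"
  "vzero (cont_riesz X) = (\<lambda>x\<in>topspace X. 0)"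
  "vadd (cont_riesz X) f g = (\<lambda>x\<in>topspace X. f x + g x)"
  "vscale (cont_riesz X) c f = (\<lambda>x\<in>topspace X. c * f x)"
  by (simp_all add: cont_riesz_def)

lemma carrier_cont_riesz_restrict:
  "continuous_map X euclideanreal f \<Longrightarrow> (\<lambda>x\<in>topspace X. f x) \<in> carrier (cont_riesz X)"
  by (auto simp: cont_riesz_simps intro: continuous_map_eq)

lemma partial_order_cont_riesz: "partial_order (cont_riesz X)"
proof (unfold_locales, goal_cases)
  case (5 f g)
  have "f = g"
  proof (rule extensionalityI)
    show "f \<in> extensional (topspace X)" "g \<in> extensional (topspace X)"
      using 5 by (simp_all add: cont_riesz_simps)
    show "f x = g x" if "x \<in> topspace X" for x
      using 5 that by (simp add: cont_riesz_simps antisym)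
  qed
  then show ?case by (simp add: cont_riesz_def)
next
  case (6 f g h)
  then show ?case by (auto simp: cont_riesz_simps intro: order_trans)
qed (auto simp: cont_riesz_def)

lemma join_cont_riesz:
  assumes "f \<in> carrier (cont_riesz X)" "g \<in> carrier (cont_riesz X)"
  shows "f \<squnion>\<^bsub>cont_riesz X\<^esub> g = (\<lambda>x\<in>topspace X. max (f x) (g x))"
  unfolding join_def
proof (rule partial_order.sup_eqI[OF partial_order_cont_riesz])
  have "(\<lambda>x\<in>topspace X. max (f x) (g x)) \<in> carrier (cont_riesz X)"
    using assms by (intro carrier_cont_riesz_restrict continuous_map_real_max)
      (simp_all add: cont_riesz_simps)
  then show "is_lub (cont_riesz X) (\<lambda>x\<in>topspace X. max (f x) (g x)) {f, g}"
    using assms by (subst is_lub_iff) (simp_all add: cont_riesz_simps(2))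
qed

lemma meet_cont_riesz:
  assumes "f \<in> carrier (cont_riesz X)" "g \<in> carrier (cont_riesz X)"
  shows "f \<sqinter>\<^bsub>cont_riesz X\<^esub> g = (\<lambda>x\<in>topspace X. min (f x) (g x))"
  unfolding meet_def
proof (rule partial_order.inf_eqI[OF partial_order_cont_riesz])
  have "(\<lambda>x\<in>topspace X. min (f x) (g x)) \<in> carrier (cont_riesz X)"
    using assms by (intro carrier_cont_riesz_restrict continuous_map_real_min)
      (simp_all add: cont_riesz_simps)
  then show "is_glb (cont_riesz X) (\<lambda>x\<in>topspace X. min (f x) (g x)) {f, g}"
    using assms by (subst is_glb_iff) (simp_all add: cont_riesz_simps(2))
qed

text \<open>A violation at one point persists on an open set, by at least \<open>d\<close>, and
  contradicts \<open>ess_le\<close> there. So the quotient does not identify different continuous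
  functions on \<open>X\<close>.\<close>

lemma ess_le_continuousD:
  assumes f: "continuous_map X euclideanreal f" and g: "continuous_map X euclideanreal g"
    and le: "ess_le X f g" and x: "x \<in> topspace X"
  shows "f x \<le> g x"
proof (rule ccontr)
  assume "\<not> f x \<le> g x"
  define d where "d = (f x - g x) / 2"
  have d: "0 < d" using \<open>\<not> f x \<le> g x\<close> by (simp add: d_def)
  let ?V = "{y \<in> topspace X. f y - g y \<in> {d<..}}"
  have V: "openin X ?V"
    by (rule openin_continuous_map_preimage[OF continuous_map_diff[OF f g]]) simp
  have "x \<in> ?V" using x d by (simp add: d_def)
  then have "?V \<noteq> {}" by (rule ne_empty)
  with V obtain W where W: "W \<noteq> {}" "W \<subseteq> ?V" "\<And>y. y \<in> W \<Longrightarrow> f y \<le> g y + d"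
    using ess_leE[OF le d, of ?V] by metis
  then obtain y where y: "y \<in> W" by blast
  then have "d < f y - g y" using W(2) by auto
  then show False using W(3)[OF y] by simp
qed

text \<open>The function is \<open>q * (1 - \<phi>)\<close>, where \<open>\<phi>\<close> separates
  \<open>x\<close> from the complement of \<open>V\<close>. Complete regularity enters the density
  arguments in this form.\<close>

lemma continuous_bump:
  assumes X: "completely_regular_space X" and V: "openin X V" "x \<in> V" and q: "0 \<le> q"
  obtains g where "continuous_map X euclideanreal g" "g x = q"
    "\<And>y. y \<in> topspace X \<Longrightarrow> 0 \<le> g y \<and> g y \<le> q" "\<And>y. y \<in> topspace X \<Longrightarrow> y \<notin> V \<Longrightarrow> g y = 0"
proof -
  have x: "x \<in> topspace X" using V openin_subset[OF V(1)] by blast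
  have "closedin X (topspace X - V)" using V(1) by (simp add: openin_closedin_eq)
  moreover have "x \<in> topspace X - (topspace X - V)" using V x by blast
  ultimately obtain \<phi> where \<phi>: "continuous_map X (top_of_set {0..1::real}) \<phi>" "\<phi> x = 0"
    "\<phi> ` (topspace X - V) \<subseteq> {1}"
    using X unfolding completely_regular_space_def by metis
  have cont: "continuous_map X euclideanreal \<phi>" and range: "\<phi> ` topspace X \<subseteq> {0..1}"
    using \<phi>(1) by (auto simp: continuous_map_in_subtopology)
  show ?thesis
  proof (rule that[of "\<lambda>y. q * (1 - \<phi> y)"])
    show "continuous_map X euclideanreal (\<lambda>y. q * (1 - \<phi> y))"
      using cont by (intro continuous_map_real_mult continuous_map_diff) auto
    show "q * (1 - \<phi> x) = q" using \<phi>(2) by simp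
    show "0 \<le> q * (1 - \<phi> y) \<and> q * (1 - \<phi> y) \<le> q" if "y \<in> topspace X" for y
    proof -
      have "0 \<le> \<phi> y" "\<phi> y \<le> 1" using range that by auto
      then show ?thesis using q by (simp add: mult_left_le)
    qed
    show "q * (1 - \<phi> y) = 0" if "y \<in> topspace X" "y \<notin> V" for y
      using \<phi>(3) that by auto
  qed
qed

text \<open>At a point of \<open>above X f p\<close> there is room for a bump of height
  \<open>q > p\<close> below \<open>f\<close>; as \<open>u\<close> dominates the bump, it exceeds
  \<open>p\<close> somewhere in \<open>V\<close>. The bumps are nonnegative, so levels
  \<open>p < 0\<close> are settled by the zero function instead.\<close>

lemma ess_le_if_continuous_below:
  assumes X: "completely_regular_space X"
    and f: "f \<in> quasi_reals X" "ess_le X (\<lambda>x. 0) f" and u: "u \<in> quasi_reals X"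
    and le: "\<And>g. continuous_map X euclideanreal g \<Longrightarrow> ess_le X (\<lambda>x. 0) g \<Longrightarrow> ess_le X g f \<Longrightarrow>
      ess_le X g u"
  shows "ess_le X f u"
proof (rule ess_le_if_above_meets[OF f(1) u])
  fix V and p' :: rat
  define p where "p = real_of_rat p'"
  assume V: "openin X V" and "V \<inter> above X f (real_of_rat p') \<noteq> {}"
  then obtain x where x: "x \<in> V" "x \<in> above X f p" unfolding p_def by blast
  show "V \<inter> above X u (real_of_rat p') \<noteq> {}"
    unfolding p_def[symmetric]
  proof (cases "p < 0")
    case True
    have "ess_le X (\<lambda>x. 0) u"
      by (rule le) (simp_all add: ess_le_refl f(2))
    moreover have "V \<inter> above X (\<lambda>x. 0) p \<noteq> {}"
      using True x(1) openin_subset[OF V] by (auto simp: above_zero)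
    ultimately show "V \<inter> above X u p \<noteq> {}"
      using V by (intro above_meets_mono[of X "\<lambda>x. 0" u])
  next
    case False
    obtain U q where U: "openin X U" "x \<in> U" "p < q" "\<forall>y\<in>U. q \<le> f y"
      using x(2) by (rule aboveE)
    have VU: "openin X (V \<inter> U)" "x \<in> V \<inter> U" using V U x(1) by auto
    have q: "0 \<le> q" using False U(3) by simp
    obtain g where g: "continuous_map X euclideanreal g" "g x = q"
      "\<And>y. y \<in> topspace X \<Longrightarrow> 0 \<le> g y \<and> g y \<le> q"
      "\<And>y. y \<in> topspace X \<Longrightarrow> y \<notin> V \<inter> U \<Longrightarrow> g y = 0"
      using continuous_bump[OF X VU q] by metis
    have "ess_le X (\<lambda>x. 0) g"
      by (rule ess_le_if_le) (simp add: g(3))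
    moreover have "ess_le X g f"
    proof (rule ess_leI)
      fix e :: real and T assume e: "0 < e" and T: "openin X T" "T \<noteq> {}"
      show "\<exists>W. openin X W \<and> W \<noteq> {} \<and> W \<subseteq> T \<and> (\<forall>x\<in>W. g x \<le> f x + e)"
      proof (cases "T \<inter> (V \<inter> U) = {}")
        \<comment> \<open>Here the bump vanishes, and it is below \<open>f\<close> because
          \<open>f\<close> is positive, again only up to \<open>e\<close> and on a smaller
          piece.\<close>
        case True
        obtain W where W: "openin X W" "W \<noteq> {}" "W \<subseteq> T" "\<And>x. x \<in> W \<Longrightarrow> 0 \<le> f x + e"
          using ess_leE[OF f(2) e T] by metis
        have "g y \<le> f y + e" if y: "y \<in> W" for y
        proof -
          have "y \<in> topspace X" "y \<notin> V \<inter> U" using y W(3) True openin_subset[OF W(1)] by blast+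
          then show ?thesis using g(4)[of y] W(4)[OF y] by simp
        qed
        then show ?thesis using W(1-3) by blast
      next
        case False
        have "g y \<le> f y + e" if y: "y \<in> T \<inter> (V \<inter> U)" for y
        proof -
          have "y \<in> topspace X" "y \<in> U" using y openin_subset[OF T(1)] by blast+
          then show ?thesis using g(3)[of y] bspec[OF U(4), of y] e by linarith
        qed
        moreover have "openin X (T \<inter> (V \<inter> U))" using T(1) VU(1) by blast
        ultimately show ?thesis using False by (intro exI[of _ "T \<inter> (V \<inter> U)"]) blast
      qed
    qed
    ultimately have gu: "ess_le X g u" by (rule le[OF g(1)])
    \<comment> \<open>The midpoint leaves a gap above \<open>p\<close> and keeps \<open>x\<close>,
      where \<open>g\<close> has the value \<open>q\<close>.\<close>
    let ?W = "{y \<in> topspace X. g y \<in> {(p + q) / 2<..}}"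
    have "?W \<subseteq> above X g p"
    proof (rule subset_aboveI)
      show "openin X ?W"
        by (rule openin_continuous_map_preimage[OF g(1)]) simp
      show "p < (p + q) / 2" using U(3) by simp
    qed simp
    moreover have "x \<in> ?W" using g(2) U(3) VU openin_subset[OF V] by auto
    ultimately have "V \<inter> above X g p \<noteq> {}" using x(1) by blast
    then show "V \<inter> above X u p \<noteq> {}" by (rule above_meets_mono[OF gu V])
  qed
qed

text \<open>The operations of \<open>cont_riesz X\<close> cut functions off outside the space, those
  on representatives do not; the projection does not see the difference.\<close>

lemma (in quasi_real_image) restrict_eq:
  assumes "continuous_map X euclideanreal f"
  shows "\<rho> (\<lambda>x\<in>topspace X. f x) = \<rho> f"
proof (rule eqI)
  show "(\<lambda>x\<in>topspace X. f x) \<in> quasi_reals X"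
    using carrier_cont_riesz_restrict[OF assms]
    by (intro quasi_reals_continuous) (simp add: cont_riesz_simps)
qed (simp_all add: quasi_reals_continuous[OF assms] ess_le_if_le)

lemma (in quasi_real_image) universal_completion:
  assumes X: "completely_regular_space X"
  shows "universal_completion (cont_riesz X) R \<rho>"
proof -
  let ?C = "carrier (cont_riesz X)"
  have cont: "continuous_map X euclideanreal f" and Q: "f \<in> quasi_reals X" if "f \<in> ?C" for f
    using that by (simp_all add: cont_riesz_simps quasi_reals_continuous)
  have "riesz_hom (cont_riesz X) R \<rho>"
    unfolding riesz_hom_def
  proof (intro conjI ballI allI funcsetI)
    fix f g and c :: real assume f: "f \<in> ?C"
    show "\<rho> f \<in> carrier R" using f by (intro closed Q)
    show "\<rho> (c \<boxdot>\<^bsub>cont_riesz X\<^esub> f) = c \<boxdot>\<^bsub>R\<^esub> \<rho> f"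
      using f by (simp add: cont_riesz_simps(5) vscale Q restrict_eq continuous_map_real_mult_left cont)
    assume g: "g \<in> ?C"
    show "\<rho> (f \<boxplus>\<^bsub>cont_riesz X\<^esub> g) = \<rho> f \<boxplus>\<^bsub>R\<^esub> \<rho> g"
      using f g by (simp add: cont_riesz_simps(4) vadd Q restrict_eq continuous_map_add cont)
    show "\<rho> (f \<squnion>\<^bsub>cont_riesz X\<^esub> g) = \<rho> f \<squnion>\<^bsub>R\<^esub> \<rho> g"
      using f g by (simp add: join_cont_riesz join_eq Q restrict_eq continuous_map_real_max cont)
    show "\<rho> (f \<sqinter>\<^bsub>cont_riesz X\<^esub> g) = \<rho> f \<sqinter>\<^bsub>R\<^esub> \<rho> g"
      using f g by (simp add: meet_cont_riesz meet_eq Q restrict_eq continuous_map_real_min cont)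
  qed
  moreover have "inj_on \<rho> ?C"
  proof (rule inj_onI)
    fix f g assume f: "f \<in> ?C" and g: "g \<in> ?C" and eq: "\<rho> f = \<rho> g"
    then have "ess_le X f g" "ess_le X g f" by (simp_all add: eq_iff Q)
    then have "f x = g x" if "x \<in> topspace X" for x
      using ess_le_continuousD[OF cont[OF f] cont[OF g] _ that]
        ess_le_continuousD[OF cont[OF g] cont[OF f] _ that] by (simp add: antisym)
    then show "f = g"
      using f g by (intro extensionalityI[of f "topspace X" g]) (simp_all add: cont_riesz_simps)
  qed
  moreover have "is_lub R F {\<rho> g |g. g \<in> ?C \<and> vzero R \<sqsubseteq>\<^bsub>R\<^esub> \<rho> g \<and> \<rho> g \<sqsubseteq>\<^bsub>R\<^esub> F}"
    if F: "F \<in> carrier R" "vzero R \<sqsubseteq>\<^bsub>R\<^esub> F" for F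
  proof -
    obtain f where f: "f \<in> quasi_reals X" "F = \<rho> f" using F(1) by (rule carrierE)
    have f0: "ess_le X (\<lambda>x. 0) f" using F(2) f by (simp add: vzero le_iff quasi_reals_const)
    have sub: "{\<rho> g |g. g \<in> ?C \<and> vzero R \<sqsubseteq>\<^bsub>R\<^esub> \<rho> g \<and> \<rho> g \<sqsubseteq>\<^bsub>R\<^esub> F} \<subseteq> carrier R"
      using closed Q by blast
    show ?thesis
      unfolding is_lub_iff[OF sub]
    proof (intro conjI ballI impI)
      fix y assume y: "y \<in> carrier R"
        "\<forall>x\<in>{\<rho> g |g. g \<in> ?C \<and> vzero R \<sqsubseteq>\<^bsub>R\<^esub> \<rho> g \<and> \<rho> g \<sqsubseteq>\<^bsub>R\<^esub> F}. x \<sqsubseteq>\<^bsub>R\<^esub> y"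
      obtain u where u: "u \<in> quasi_reals X" "y = \<rho> u" using y(1) by (rule carrierE)
      have "ess_le X f u"
      proof (rule ess_le_if_continuous_below[OF X f(1) f0 u(1)])
        fix g assume g: "continuous_map X euclideanreal g" "ess_le X (\<lambda>x. 0) g" "ess_le X g f"
        let ?g = "\<lambda>x\<in>topspace X. g x"
        have gQ: "g \<in> quasi_reals X" using g(1) by (rule quasi_reals_continuous)
        have "?g \<in> ?C" using g(1) by (rule carrier_cont_riesz_restrict)
        moreover have "\<rho> ?g = \<rho> g" using g(1) by (rule restrict_eq)
        moreover have "vzero R \<sqsubseteq>\<^bsub>R\<^esub> \<rho> g" "\<rho> g \<sqsubseteq>\<^bsub>R\<^esub> F"
          using g f gQ by (simp_all add: vzero le_iff quasi_reals_const)
        ultimately have "\<rho> g \<sqsubseteq>\<^bsub>R\<^esub> y"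
          by (intro bspec[OF y(2)] CollectI exI[of _ ?g]) simp
        then show "ess_le X g u" using u gQ by (simp add: le_iff)
      qed
      then show "F \<sqsubseteq>\<^bsub>R\<^esub> y" using f u by (simp add: le_iff)
    qed (use F in auto)
  qed
  ultimately show ?thesis
    using universally_complete by (simp add: universal_completion_def riesz_embedding_def)
qed

section \<open>Recovering the regular open sets\<close>

lemma riesz_isomorphicI:
  assumes R: "riesz_space R" and S: "riesz_space S" and bij: "bij_betw h (carrier R) (carrier S)"
    and le: "\<And>x y. x \<in> carrier R \<Longrightarrow> y \<in> carrier R \<Longrightarrow> h x \<sqsubseteq>\<^bsub>S\<^esub> h y \<longleftrightarrow> x \<sqsubseteq>\<^bsub>R\<^esub> y"
    and add: "\<And>x y. x \<in> carrier R \<Longrightarrow> y \<in> carrier R \<Longrightarrow> h (x \<boxplus>\<^bsub>R\<^esub> y) = h x \<boxplus>\<^bsub>S\<^esub> h y"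
    and scale: "\<And>c x. x \<in> carrier R \<Longrightarrow> h (c \<boxdot>\<^bsub>R\<^esub> x) = c \<boxdot>\<^bsub>S\<^esub> h x"
  shows "riesz_isomorphic R S"
proof -
  interpret R: riesz_space R by (rule R)
  interpret S: riesz_space S by (rule S)
  have closed: "h x \<in> carrier S" if "x \<in> carrier R" for x
    using bij that by (rule bij_betwE[THEN bspec])
  have surj: "\<exists>x\<in>carrier R. y = h x" if "y \<in> carrier S" for y
    using bij that by (auto simp: bij_betw_def)
  have join: "h (x \<squnion>\<^bsub>R\<^esub> y) = h x \<squnion>\<^bsub>S\<^esub> h y" if x: "x \<in> carrier R" and y: "y \<in> carrier R" for x y
  proof -
    have "is_lub S (h (x \<squnion>\<^bsub>R\<^esub> y)) {h x, h y}"
    proof (subst is_lub_iff)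
      show "h (x \<squnion>\<^bsub>R\<^esub> y) \<in> carrier S \<and> (\<forall>z\<in>{h x, h y}. z \<sqsubseteq>\<^bsub>S\<^esub> h (x \<squnion>\<^bsub>R\<^esub> y)) \<and>
        (\<forall>z\<in>carrier S. (\<forall>z'\<in>{h x, h y}. z' \<sqsubseteq>\<^bsub>S\<^esub> z) \<longrightarrow> h (x \<squnion>\<^bsub>R\<^esub> y) \<sqsubseteq>\<^bsub>S\<^esub> z)"
      proof (intro conjI ballI impI)
        fix z assume z: "z \<in> carrier S" "\<forall>z'\<in>{h x, h y}. z' \<sqsubseteq>\<^bsub>S\<^esub> z"
        obtain w where w: "w \<in> carrier R" "z = h w" using surj[OF z(1)] by blast
        then have "x \<sqsubseteq>\<^bsub>R\<^esub> w" "y \<sqsubseteq>\<^bsub>R\<^esub> w" using z(2) x y le by auto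
        then have "x \<squnion>\<^bsub>R\<^esub> y \<sqsubseteq>\<^bsub>R\<^esub> w" using x y w by (intro R.join_le)
        then show "h (x \<squnion>\<^bsub>R\<^esub> y) \<sqsubseteq>\<^bsub>S\<^esub> z" using x y w by (simp add: le R.join_closed)
      qed (use x y in \<open>auto simp: le closed R.join_closed R.join_left R.join_right\<close>)
    qed (use x y closed in auto)
    then show ?thesis unfolding join_def[of S] by (rule S.sup_eqI[symmetric])
  qed
  have meet: "h (x \<sqinter>\<^bsub>R\<^esub> y) = h x \<sqinter>\<^bsub>S\<^esub> h y" if x: "x \<in> carrier R" and y: "y \<in> carrier R" for x y
  proof -
    have "is_glb S (h (x \<sqinter>\<^bsub>R\<^esub> y)) {h x, h y}"
    proof (subst is_glb_iff)
      show "h (x \<sqinter>\<^bsub>R\<^esub> y) \<in> carrier S \<and> (\<forall>z\<in>{h x, h y}. h (x \<sqinter>\<^bsub>R\<^esub> y) \<sqsubseteq>\<^bsub>S\<^esub> z) \<and>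
        (\<forall>z\<in>carrier S. (\<forall>z'\<in>{h x, h y}. z \<sqsubseteq>\<^bsub>S\<^esub> z') \<longrightarrow> z \<sqsubseteq>\<^bsub>S\<^esub> h (x \<sqinter>\<^bsub>R\<^esub> y))"
      proof (intro conjI ballI impI)
        fix z assume z: "z \<in> carrier S" "\<forall>z'\<in>{h x, h y}. z \<sqsubseteq>\<^bsub>S\<^esub> z'"
        obtain w where w: "w \<in> carrier R" "z = h w" using surj[OF z(1)] by blast
        then have "w \<sqsubseteq>\<^bsub>R\<^esub> x" "w \<sqsubseteq>\<^bsub>R\<^esub> y" using z(2) x y le by auto
        then have "w \<sqsubseteq>\<^bsub>R\<^esub> x \<sqinter>\<^bsub>R\<^esub> y" using x y w by (intro R.meet_le)
        then show "z \<sqsubseteq>\<^bsub>S\<^esub> h (x \<sqinter>\<^bsub>R\<^esub> y)" using x y w by (simp add: le R.meet_closed)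
      qed (use x y in \<open>auto simp: le closed R.meet_closed R.meet_left R.meet_right\<close>)
    qed (use x y closed in auto)
    then show ?thesis unfolding meet_def[of S] by (rule S.inf_eqI[symmetric])
  qed
  have "riesz_hom R S h"
    unfolding riesz_hom_def using closed add scale join meet by (intro conjI ballI allI funcsetI) simp_all
  then show ?thesis using bij by (auto simp: riesz_isomorphic_def)
qed

lemma boolean_isomorphic_if_order_isomorphic:
  assumes bij: "bij_betw h (RO X) (RO Y)"
    and le: "\<And>U V. U \<in> RO X \<Longrightarrow> V \<in> RO X \<Longrightarrow>
      h U \<subseteq> h V \<longleftrightarrow> U \<subseteq> V"
  shows "boolean_isomorphic (regular_opens X) (regular_opens Y)"
proof -
  let ?B = "RO X" and ?C = "RO Y"
  have closed: "h U \<in> ?C" if "U \<in> ?B" for U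
    using bij that by (rule bij_betwE[THEN bspec])
  have surj: "\<exists>U\<in>?B. Z = h U" if "Z \<in> ?C" for Z
    using bij that unfolding bij_betw_def by blast
  have empty: "{} \<in> RO X" for X :: "'x topology"
    by (simp add: carrier_regular_opens)
  have top: "topspace X \<in> RO X" for X :: "'x topology"
    by (simp add: carrier_regular_opens)
  have sub: "U \<subseteq> topspace X" if "U \<in> RO X" for U and X :: "'x topology"
    using that by (simp add: carrier_regular_opens openin_subset)
  have "h {} = {}"
  proof -
    obtain U where U: "U \<in> ?B" "{} = h U" using surj[OF empty] by blast
    have "h {} \<subseteq> h U" using le[OF empty U(1)] by simp
    then show ?thesis using U(2) by simp
  qed
  moreover have "h (topspace X) = topspace Y"
  proof -
    obtain U where U: "U \<in> ?B" "topspace Y = h U" using surj[OF top] by blast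
    have "h U \<subseteq> h (topspace X)" using le[OF U(1) top] sub[OF U(1)] by simp
    then show ?thesis using U(2) sub[OF closed[OF top]] by simp
  qed
  moreover have "h (regularize X (U \<union> V)) = regularize Y (h U \<union> h V)" if UV: "U \<in> ?B" "V \<in> ?B" for U V
  proof (rule equalityI)
    obtain W where W: "W \<in> ?B" "regularize Y (h U \<union> h V) = h W"
      using surj[OF regularize_closed] by blast
    have "openin Y (h U \<union> h V)" using closed[OF UV(1)] closed[OF UV(2)] by (simp add: carrier_regular_opens openin_Un)
    then have "h U \<union> h V \<subseteq> h W" using regularize_increasing[of Y "h U \<union> h V"] W(2) by simp
    then have "U \<union> V \<subseteq> W" using UV W(1) by (simp add: le)
    then have "regularize X (U \<union> V) \<subseteq> W"
      using regularize_mono[of "U \<union> V" W X] W(1) by (simp add: carrier_regular_opens)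
    then show "h (regularize X (U \<union> V)) \<subseteq> regularize Y (h U \<union> h V)"
      using W by (simp add: le regularize_closed)
    have "openin X (U \<union> V)" using UV by (simp add: carrier_regular_opens openin_Un)
    then have "U \<union> V \<subseteq> regularize X (U \<union> V)" by (rule regularize_increasing)
    then have "h U \<union> h V \<subseteq> h (regularize X (U \<union> V))" using UV by (simp add: le regularize_closed)
    then show "regularize Y (h U \<union> h V) \<subseteq> h (regularize X (U \<union> V))"
      using regularize_mono[of "h U \<union> h V" _ Y] closed[OF regularize_closed, of "U \<union> V"]
      by (metis carrier_regular_opens)
  qed
  moreover have "h (U \<inter> V) = h U \<inter> h V" if UV: "U \<in> ?B" "V \<in> ?B" for U V
  proof (rule equalityI)
    show "h (U \<inter> V) \<subseteq> h U \<inter> h V"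
      using UV by (simp add: le Int_regular_opens_closed)
    obtain W where W: "W \<in> ?B" "h U \<inter> h V = h W"
      using surj[OF Int_regular_opens_closed[OF closed[OF UV(1)] closed[OF UV(2)]]] by blast
    then have "h W \<subseteq> h U" "h W \<subseteq> h V" by auto
    then have "W \<subseteq> U \<inter> V" using UV W(1) by (simp add: le)
    then show "h U \<inter> h V \<subseteq> h (U \<inter> V)"
      using UV W by (simp add: le Int_regular_opens_closed)
  qed
  ultimately show ?thesis
    unfolding boolean_isomorphic_def
    using bij closed
    by (intro exI[of _ h]) (simp add: bottom_regular_opens top_regular_opens join_regular_opens meet_regular_opens)
qed

text \<open>
  A family of elements with a support in each of two spaces identifies the regular open sets of the
  spaces as soon as the supports are dense and reflect the same disjointness relation.
\<close>

locale paired_supports =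
  fixes X :: "'a topology" and Y :: "'b topology" and P :: "'p set"
    and s :: "'p \<Rightarrow> 'a set" and t :: "'p \<Rightarrow> 'b set"
  assumes s_closed: "u \<in> P \<Longrightarrow> s u \<in> RO X"
    and t_closed: "u \<in> P \<Longrightarrow> t u \<in> RO Y"
    and disjoint_iff: "\<lbrakk>u \<in> P; v \<in> P\<rbrakk> \<Longrightarrow> s u \<inter> s v = {} \<longleftrightarrow> t u \<inter> t v = {}"
    and s_dense: "\<lbrakk>W \<in> RO X; W \<noteq> {}\<rbrakk> \<Longrightarrow> \<exists>u\<in>P. s u \<noteq> {} \<and> s u \<subseteq> W"
    and t_dense: "\<lbrakk>Z \<in> RO Y; Z \<noteq> {}\<rbrakk> \<Longrightarrow> \<exists>u\<in>P. t u \<noteq> {} \<and> t u \<subseteq> Z"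
begin

definition transfer :: "'a set \<Rightarrow> 'b set" where
  "transfer W = regularize Y (\<Union>(t ` {u \<in> P. s u \<subseteq> W}))"

lemma transfer_closed: "transfer W \<in> RO Y"
  unfolding transfer_def by (rule regularize_closed)

text \<open>If \<open>s u\<close> is not inside \<open>W\<close>, density gives \<open>v\<close>
  with \<open>s v\<close> inside \<open>s u\<close> and disjoint from \<open>W\<close>. Then
  \<open>t v\<close> meets \<open>t u\<close>, but it misses every \<open>t w\<close> with
  \<open>s w \<subseteq> W\<close> and hence \<open>transfer W\<close>, so \<open>t u\<close> cannot
  be inside \<open>transfer W\<close>. Here disjointness alone has to express inclusion, as the
  pairing respects nothing else.\<close>

lemma subset_transfer_iff:
  assumes u: "u \<in> P" and W: "W \<in> RO X"
  shows "t u \<subseteq> transfer W \<longleftrightarrow> s u \<subseteq> W"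
proof
  assume "s u \<subseteq> W"
  then have "t u \<subseteq> \<Union>(t ` {u \<in> P. s u \<subseteq> W})" using u by blast
  moreover have "openin Y (\<Union>(t ` {u \<in> P. s u \<subseteq> W}))"
    using t_closed by (intro openin_Union) (auto simp: carrier_regular_opens)
  ultimately show "t u \<subseteq> transfer W"
    unfolding transfer_def using regularize_increasing[of Y "\<Union>(t ` {u \<in> P. s u \<subseteq> W})"] by blast
next
  assume sub: "t u \<subseteq> transfer W"
  show "s u \<subseteq> W"
  proof (rule ccontr)
    assume "\<not> s u \<subseteq> W"
    then have "\<not> s u \<subseteq> regularize X W" using W by (simp add: carrier_regular_opens)
    then obtain V where V: "openin X V" "V \<noteq> {}" "V \<subseteq> s u" "V \<inter> W = {}"
      using subset_regularizeI[of X "s u" W] s_closed[OF u] by (auto simp: carrier_regular_opens)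
    have "regularize X V \<noteq> {}" using V(1,2) regularize_increasing[of X V] by blast
    then obtain v where v: "v \<in> P" "s v \<noteq> {}" "s v \<subseteq> regularize X V"
      using s_dense[OF regularize_closed] by blast
    have "regularize X V \<subseteq> s u"
      using regularize_mono[OF V(3), of X] s_closed[OF u] by (simp add: carrier_regular_opens)
    then have "s v \<inter> s u \<noteq> {}" using v by blast
    then have meets: "t v \<inter> transfer W \<noteq> {}" using disjoint_iff[OF v(1) u] sub by blast
    have "W \<inter> regularize X V = {}"
      using regularize_meets[of X W V] V(4) W by (auto simp: carrier_regular_opens)
    then have "t v \<inter> t w = {}" if "w \<in> P" "s w \<subseteq> W" for w
      using disjoint_iff[OF v(1) that(1)] v(3) that(2) by blast
    then have "t v \<inter> \<Union>(t ` {u \<in> P. s u \<subseteq> W}) = {}" by blast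
    then show False
      using meets regularize_meets[of Y "t v"] t_closed[OF v(1)]
      unfolding transfer_def by (auto simp: carrier_regular_opens)
  qed
qed

lemma regular_open_eq_supports:
  assumes W: "W \<in> RO X"
  shows "regularize X (\<Union>(s ` {u \<in> P. s u \<subseteq> W})) = W"
proof (rule equalityI)
  have "regularize X (\<Union>(s ` {u \<in> P. s u \<subseteq> W})) \<subseteq> regularize X W"
    by (rule regularize_mono) blast
  then show "regularize X (\<Union>(s ` {u \<in> P. s u \<subseteq> W})) \<subseteq> W"
    using W by (simp add: carrier_regular_opens)
  show "W \<subseteq> regularize X (\<Union>(s ` {u \<in> P. s u \<subseteq> W}))"
  proof (rule subset_regularizeI)
    show "openin X W" using W by (simp add: carrier_regular_opens)
    fix V assume V: "openin X V" "V \<noteq> {}" "V \<subseteq> W"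
    then have "regularize X V \<noteq> {}" using regularize_increasing by blast
    then obtain v where v: "v \<in> P" "s v \<noteq> {}" "s v \<subseteq> regularize X V"
      using s_dense[OF regularize_closed] by blast
    have "regularize X V \<subseteq> W"
      using regularize_mono[OF V(3), of X] W by (simp add: carrier_regular_opens)
    then have "s v \<subseteq> \<Union>(s ` {u \<in> P. s u \<subseteq> W})" using v by blast
    moreover have "s v \<inter> V \<noteq> {}"
      using regularize_meets[of X "s v" V] v s_closed[OF v(1)] by (auto simp: carrier_regular_opens)
    ultimately show "V \<inter> \<Union>(s ` {u \<in> P. s u \<subseteq> W}) \<noteq> {}" by blast
  qed
qed

end

lemma (in paired_supports) swapped: "paired_supports Y X P t s"
  by unfold_locales (use s_closed t_closed disjoint_iff s_dense t_dense in \<open>simp_all\<close>)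

text \<open>By \<open>subset_transfer_iff\<close>, the elements with \<open>t u\<close> inside
  \<open>transfer W\<close> are those with \<open>s u\<close> inside \<open>W\<close>. Transferring
  back thus generates the same set that the supports inside \<open>W\<close> generate, and by
  density this is \<open>W\<close>.\<close>

lemma (in paired_supports) boolean_isomorphic:
  "boolean_isomorphic (regular_opens X) (regular_opens Y)"
proof -
  interpret S: paired_supports Y X P t s by (rule swapped)
  have inv: "S.transfer (transfer W) = W" if W: "W \<in> RO X" for W
  proof -
    have "{u \<in> P. t u \<subseteq> transfer W} = {u \<in> P. s u \<subseteq> W}"
      using subset_transfer_iff[OF _ W] by blast
    then show ?thesis using regular_open_eq_supports[OF W] by (simp add: S.transfer_def)
  qed
  have inv': "transfer (S.transfer Z) = Z" if Z: "Z \<in> RO Y" for Z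
  proof -
    have "{u \<in> P. s u \<subseteq> S.transfer Z} = {u \<in> P. t u \<subseteq> Z}"
      using S.subset_transfer_iff[OF _ Z] by blast
    then show ?thesis using S.regular_open_eq_supports[OF Z] by (simp add: transfer_def)
  qed
  have mono: "transfer U \<subseteq> transfer V" if "U \<subseteq> V" for U V
    unfolding transfer_def by (rule regularize_mono) (use that in blast)
  have mono': "S.transfer U \<subseteq> S.transfer V" if "U \<subseteq> V" for U V
    unfolding S.transfer_def by (rule regularize_mono) (use that in blast)
  show ?thesis
  proof (rule boolean_isomorphic_if_order_isomorphic[of transfer])
    show "bij_betw transfer (RO X) (RO Y)"
      by (rule bij_betw_byWitness[of _ S.transfer])
        (auto simp: inv inv' transfer_closed S.transfer_closed)
    show "transfer U \<subseteq> transfer V \<longleftrightarrow> U \<subseteq> V"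
      if "U \<in> RO X" "V \<in> RO X" for U V
      using mono[of U V] mono'[of "transfer U" "transfer V"] that by (auto simp: inv)
  qed
qed

section \<open>Supports in an arbitrary universal completion\<close>

locale function_completion =
  fixes X :: "'a topology" and U :: "'u riesz" and \<mu> :: "('a \<Rightarrow> real) \<Rightarrow> 'u"
  assumes X: "completely_regular_space X" and completion: "universal_completion (cont_riesz X) U \<mu>"
begin

sublocale U: riesz_space U
  using completion by (simp add: universal_completion_def universally_complete_def)

abbreviation C where "C \<equiv> carrier (cont_riesz X)"

abbreviation zero where "zero \<equiv> (\<lambda>x\<in>topspace X. 0 :: real)"

lemma hom: "riesz_hom (cont_riesz X) U \<mu>" and inj: "inj_on \<mu> C"
  using completion by (simp_all add: universal_completion_def riesz_embedding_def)

lemma \<mu>_closed: "f \<in> C \<Longrightarrow> \<mu> f \<in> carrier U"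
  using hom by (auto simp: riesz_hom_def)

lemma \<mu>_join: "f \<in> C \<Longrightarrow> g \<in> C \<Longrightarrow> \<mu> (f \<squnion>\<^bsub>cont_riesz X\<^esub> g) = \<mu> f \<squnion>\<^bsub>U\<^esub> \<mu> g"
  using hom unfolding riesz_hom_def by blast

lemma \<mu>_meet: "f \<in> C \<Longrightarrow> g \<in> C \<Longrightarrow> \<mu> (f \<sqinter>\<^bsub>cont_riesz X\<^esub> g) = \<mu> f \<sqinter>\<^bsub>U\<^esub> \<mu> g"
  using hom unfolding riesz_hom_def by blast

text \<open>The inequality is written as \<open>f \<squnion> g = g\<close>; \<open>\<mu>\<close>
  preserves this equation because it respects joins and reflects it because it is injective.\<close>

lemma \<mu>_le_iff:
  assumes "f \<in> C" "g \<in> C"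
  shows "\<mu> f \<sqsubseteq>\<^bsub>U\<^esub> \<mu> g \<longleftrightarrow> (\<forall>x\<in>topspace X. f x \<le> g x)"
proof -
  let ?h = "\<lambda>x\<in>topspace X. max (f x) (g x)"
  have h: "f \<squnion>\<^bsub>cont_riesz X\<^esub> g = ?h" using assms by (rule join_cont_riesz)
  have hC: "?h \<in> C"
    using assms by (intro carrier_cont_riesz_restrict continuous_map_real_max) (simp_all add: cont_riesz_simps)
  have "\<mu> f \<sqsubseteq>\<^bsub>U\<^esub> \<mu> g \<longleftrightarrow> \<mu> f \<squnion>\<^bsub>U\<^esub> \<mu> g = \<mu> g"
    using assms by (intro U.le_iff_meet \<mu>_closed)
  also have "\<mu> f \<squnion>\<^bsub>U\<^esub> \<mu> g = \<mu> ?h"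
    using \<mu>_join[OF assms] h by simp
  also have "\<mu> ?h = \<mu> g \<longleftrightarrow> ?h = g"
    using inj hC assms(2) by (auto dest: inj_onD)
  also have "?h = g \<longleftrightarrow> (\<forall>x\<in>topspace X. f x \<le> g x)"
  proof
    assume eq: "?h = g"
    show "\<forall>x\<in>topspace X. f x \<le> g x"
    proof
      fix x assume "x \<in> topspace X"
      then have "max (f x) (g x) = g x" using fun_cong[OF eq, of x] by simp
      then show "f x \<le> g x" by linarith
    qed
  next
    assume le: "\<forall>x\<in>topspace X. f x \<le> g x"
    show "?h = g"
      by (rule extensionalityI[of _ "topspace X"]) (use assms(2) le in \<open>simp_all add: cont_riesz_simps max_absorb2\<close>)
  qed
  finally show ?thesis .
qed

lemma zero_C: "zero \<in> C"
  using carrier_cont_riesz_restrict[of X "\<lambda>x. 0"] by simp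

lemma \<mu>_zero: "\<mu> zero = vzero U"
proof -
  have "\<mu> (zero \<boxplus>\<^bsub>cont_riesz X\<^esub> zero) = \<mu> zero \<boxplus>\<^bsub>U\<^esub> \<mu> zero"
    using hom zero_C unfolding riesz_hom_def by blast
  moreover have "zero \<boxplus>\<^bsub>cont_riesz X\<^esub> zero = zero"
    by (auto simp: cont_riesz_simps)
  ultimately have "\<mu> zero \<boxplus>\<^bsub>U\<^esub> \<mu> zero = vzero U \<boxplus>\<^bsub>U\<^esub> \<mu> zero"
    using \<mu>_closed[OF zero_C] by (simp add: U.zero_add)
  then show ?thesis
    by (rule U.add_right_cancel[OF \<mu>_closed[OF zero_C] U.zero_closed \<mu>_closed[OF zero_C]])
qed

definition below :: "'u \<Rightarrow> ('a \<Rightarrow> real) set" where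
  "below u = {g \<in> C. vzero U \<sqsubseteq>\<^bsub>U\<^esub> \<mu> g \<and> \<mu> g \<sqsubseteq>\<^bsub>U\<^esub> u}"

lemma below_C: "g \<in> below u \<Longrightarrow> g \<in> C"
  by (simp add: below_def)

lemma is_lub_below:
  assumes "u \<in> carrier U" "vzero U \<sqsubseteq>\<^bsub>U\<^esub> u"
  shows "is_lub U u (\<mu> ` below u)"
proof -
  have "\<mu> ` below u = {\<mu> g |g. g \<in> C \<and> vzero U \<sqsubseteq>\<^bsub>U\<^esub> \<mu> g \<and> \<mu> g \<sqsubseteq>\<^bsub>U\<^esub> u}"
    by (auto simp: below_def)
  then show ?thesis
    using completion assms by (simp add: universal_completion_def)
qed

definition cozero :: "'u \<Rightarrow> 'a set" where
  "cozero u = (\<Union>g\<in>below u. {x \<in> topspace X. 0 < g x})"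

text \<open>Regularized so as to land in the algebra \<open>RO X\<close>; disjointness of open sets
  is not affected by this.\<close>

definition support :: "'u \<Rightarrow> 'a set" where
  "support u = regularize X (cozero u)"

lemma openin_cozero: "openin X (cozero u)"
proof -
  have "openin X {x \<in> topspace X. g x \<in> {0<..}}" if "g \<in> below u" for g
    using below_C[OF that]
    by (intro openin_continuous_map_preimage[of X euclideanreal g]) (simp_all add: cont_riesz_simps)
  then show ?thesis unfolding cozero_def by (intro openin_Union) auto
qed

text \<open>If the cozero sets are disjoint, a continuous function below
  \<open>u \<sqinter> v\<close> is nowhere positive, and \<open>u \<sqinter> v\<close> is the
  supremum of such functions. Conversely, if \<open>f\<close> below \<open>u\<close> and
  \<open>g\<close> below \<open>v\<close> are both positive at \<open>x\<close>, then so is their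
  minimum, whose image is below \<open>u \<sqinter> v\<close>.\<close>

lemma disjoint_iff_support:
  assumes u: "u \<in> carrier U" "vzero U \<sqsubseteq>\<^bsub>U\<^esub> u" and v: "v \<in> carrier U" "vzero U \<sqsubseteq>\<^bsub>U\<^esub> v"
  shows "u \<sqinter>\<^bsub>U\<^esub> v = vzero U \<longleftrightarrow> support u \<inter> support v = {}"
proof -
  have m: "u \<sqinter>\<^bsub>U\<^esub> v \<in> carrier U" "vzero U \<sqsubseteq>\<^bsub>U\<^esub> u \<sqinter>\<^bsub>U\<^esub> v"
    using u v U.zero_closed by (auto intro: U.meet_closed U.meet_le)
  have "support u \<inter> support v = {} \<longleftrightarrow> cozero u \<inter> cozero v = {}"
    unfolding support_def regularize_Int[OF openin_cozero openin_cozero]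
    using regularize_increasing[OF openin_Int[OF openin_cozero[of u] openin_cozero[of v]]] by auto
  also have "\<dots> \<longleftrightarrow> u \<sqinter>\<^bsub>U\<^esub> v = vzero U"
  proof
    assume empty: "cozero u \<inter> cozero v = {}"
    have "\<mu> g \<sqsubseteq>\<^bsub>U\<^esub> vzero U" if g: "g \<in> below (u \<sqinter>\<^bsub>U\<^esub> v)" for g
    proof -
      have gC: "g \<in> C" and gm: "vzero U \<sqsubseteq>\<^bsub>U\<^esub> \<mu> g" "\<mu> g \<sqsubseteq>\<^bsub>U\<^esub> u \<sqinter>\<^bsub>U\<^esub> v"
        using g by (simp_all add: below_def)
      have "\<mu> g \<sqsubseteq>\<^bsub>U\<^esub> u" "\<mu> g \<sqsubseteq>\<^bsub>U\<^esub> v"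
        using U.le_trans[OF gm(2) U.meet_left[OF u(1) v(1)] \<mu>_closed[OF gC] m(1) u(1)]
          U.le_trans[OF gm(2) U.meet_right[OF u(1) v(1)] \<mu>_closed[OF gC] m(1) v(1)] by auto
      then have "g \<in> below u" "g \<in> below v" using gC gm by (simp_all add: below_def)
      then have "{x \<in> topspace X. 0 < g x} \<subseteq> cozero u \<inter> cozero v"
        unfolding cozero_def by blast
      then have "\<forall>x\<in>topspace X. g x \<le> zero x" using empty by force
      then show ?thesis using \<mu>_le_iff[OF gC zero_C] by (simp add: \<mu>_zero)
    qed
    moreover have "is_lub U (u \<sqinter>\<^bsub>U\<^esub> v) (\<mu> ` below (u \<sqinter>\<^bsub>U\<^esub> v))"
      by (rule is_lub_below[OF m])
    moreover have "\<mu> ` below (u \<sqinter>\<^bsub>U\<^esub> v) \<subseteq> carrier U"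
      using \<mu>_closed below_C by blast
    ultimately have "u \<sqinter>\<^bsub>U\<^esub> v \<sqsubseteq>\<^bsub>U\<^esub> vzero U"
      using U.zero_closed by (simp add: is_lub_iff)
    then show "u \<sqinter>\<^bsub>U\<^esub> v = vzero U"
      using m U.zero_closed by (intro U.le_antisym)
  next
    assume zero: "u \<sqinter>\<^bsub>U\<^esub> v = vzero U"
    show "cozero u \<inter> cozero v = {}"
    proof (rule ccontr)
      assume "cozero u \<inter> cozero v \<noteq> {}"
      then obtain x f g where x: "x \<in> topspace X" "0 < f x" "0 < g x"
        and f: "f \<in> below u" and g: "g \<in> below v"
        unfolding cozero_def by blast
      let ?h = "\<lambda>x\<in>topspace X. min (f x) (g x)"
      have fC: "f \<in> C" and gC: "g \<in> C" using f g by (simp_all add: below_C)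
      have hC: "?h \<in> C"
        using fC gC by (intro carrier_cont_riesz_restrict continuous_map_real_min) (simp_all add: cont_riesz_simps)
      have "\<mu> ?h = \<mu> f \<sqinter>\<^bsub>U\<^esub> \<mu> g"
        using \<mu>_meet[OF fC gC] meet_cont_riesz[OF fC gC] by simp
      moreover have "\<mu> f \<sqinter>\<^bsub>U\<^esub> \<mu> g \<sqsubseteq>\<^bsub>U\<^esub> u \<sqinter>\<^bsub>U\<^esub> v"
      proof -
        have *: "\<mu> f \<in> carrier U" "\<mu> g \<in> carrier U" "\<mu> f \<sqinter>\<^bsub>U\<^esub> \<mu> g \<in> carrier U"
          using fC gC by (auto intro: \<mu>_closed U.meet_closed)
        have "\<mu> f \<sqinter>\<^bsub>U\<^esub> \<mu> g \<sqsubseteq>\<^bsub>U\<^esub> u"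
          using U.le_trans[OF U.meet_left[OF *(1,2)] _ *(3,1) u(1)] f by (simp add: below_def)
        moreover have "\<mu> f \<sqinter>\<^bsub>U\<^esub> \<mu> g \<sqsubseteq>\<^bsub>U\<^esub> v"
          using U.le_trans[OF U.meet_right[OF *(1,2)] _ *(3,2) v(1)] g by (simp add: below_def)
        ultimately show ?thesis using * u v by (intro U.meet_le)
      qed
      ultimately have "\<mu> ?h \<sqsubseteq>\<^bsub>U\<^esub> \<mu> zero" using zero by (simp add: \<mu>_zero)
      then have "min (f x) (g x) \<le> 0" using x(1) \<mu>_le_iff[OF hC zero_C] by auto
      then show False using x by simp
    qed
  qed
  finally show ?thesis by blast
qed

text \<open>The element is the image of a bump inside \<open>W\<close>. Any continuous function
  below it is dominated by the bump, so it is not positive off \<open>W\<close>.\<close>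

lemma support_dense:
  assumes W: "W \<in> RO X" "W \<noteq> {}"
  shows "\<exists>u\<in>carrier U. vzero U \<sqsubseteq>\<^bsub>U\<^esub> u \<and> support u \<noteq> {} \<and> support u \<subseteq> W"
proof -
  obtain x where x: "x \<in> W" using W by blast
  have openW: "openin X W" and regW: "regularize X W = W" using W by (simp_all add: carrier_regular_opens)
  obtain g where g: "continuous_map X euclideanreal g" "g x = 1"
    "\<And>y. y \<in> topspace X \<Longrightarrow> 0 \<le> g y \<and> g y \<le> 1" "\<And>y. y \<in> topspace X \<Longrightarrow> y \<notin> W \<Longrightarrow> g y = 0"
    using continuous_bump[OF X openW x zero_le_one] by metis
  let ?g = "\<lambda>x\<in>topspace X. g x"
  have gC: "?g \<in> C" using g(1) by (rule carrier_cont_riesz_restrict)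
  have pos: "vzero U \<sqsubseteq>\<^bsub>U\<^esub> \<mu> ?g"
    using \<mu>_le_iff[OF zero_C gC] g(3) by (simp add: \<mu>_zero)
  have "cozero (\<mu> ?g) \<subseteq> W"
  proof
    fix y assume "y \<in> cozero (\<mu> ?g)"
    then obtain f where f: "f \<in> below (\<mu> ?g)" "y \<in> topspace X" "0 < f y"
      unfolding cozero_def by blast
    then have "f y \<le> g y" using \<mu>_le_iff[OF below_C[OF f(1)] gC] by (simp add: below_def)
    then show "y \<in> W" using f g(4)[of y] by force
  qed
  then have "support (\<mu> ?g) \<subseteq> W"
    using regularize_mono[of "cozero (\<mu> ?g)" W X] regW by (simp add: support_def)
  moreover have "support (\<mu> ?g) \<noteq> {}"
  proof -
    have "?g \<in> below (\<mu> ?g)" using gC pos \<mu>_closed[OF gC] by (simp add: below_def)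
    moreover have "x \<in> topspace X" using x openin_subset[OF openW] by blast
    then have "x \<in> {y \<in> topspace X. 0 < ?g y}" using g(2) by simp
    ultimately have "x \<in> cozero (\<mu> ?g)" unfolding cozero_def
      by (rule UN_I[where B = "\<lambda>g. {y \<in> topspace X. 0 < g y}"])
    then show ?thesis unfolding support_def using regularize_increasing[OF openin_cozero[of "\<mu> ?g"]] by blast
  qed
  ultimately show ?thesis using pos \<mu>_closed[OF gC] by blast
qed

end

text \<open>The positive elements of \<open>U\<close> index both families of supports:
  \<open>u\<close> has one in \<open>X\<close>, and \<open>h u\<close> has one in \<open>Y\<close>.
  Disjoint supports mean disjoint elements, a relation that \<open>h\<close> preserves and
  reflects.\<close>

lemma boolean_isomorphic_if_completions_isomorphic:
  assumes X: "completely_regular_space X" and Y: "completely_regular_space Y"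
    and U: "universal_completion (cont_riesz X) U \<mu>" and V: "universal_completion (cont_riesz Y) V \<nu>"
    and iso: "riesz_isomorphic U V"
  shows "boolean_isomorphic (regular_opens X) (regular_opens Y)"
proof -
  interpret X: function_completion X U \<mu> using X U by unfold_locales
  interpret Y: function_completion Y V \<nu> using Y V by unfold_locales
  obtain h where h: "riesz_hom U V h" and bij: "bij_betw h (carrier U) (carrier V)"
    using iso by (auto simp: riesz_isomorphic_def)
  have h_closed: "h u \<in> carrier V" if "u \<in> carrier U" for u
    using bij that by (rule bij_betwE[THEN bspec])
  have h_inj: "h u = h v \<longleftrightarrow> u = v" if "u \<in> carrier U" "v \<in> carrier U" for u v
    using bij that by (auto simp: bij_betw_def dest: inj_onD)
  have h_meet: "h (u \<sqinter>\<^bsub>U\<^esub> v) = h u \<sqinter>\<^bsub>V\<^esub> h v" if "u \<in> carrier U" "v \<in> carrier U" for u v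
    using h that unfolding riesz_hom_def by blast
  have h_zero: "h (vzero U) = vzero V"
  proof -
    have "h (vzero U \<boxplus>\<^bsub>U\<^esub> vzero U) = h (vzero U) \<boxplus>\<^bsub>V\<^esub> h (vzero U)"
      using h X.U.zero_closed unfolding riesz_hom_def by blast
    then have "h (vzero U) \<boxplus>\<^bsub>V\<^esub> h (vzero U) = vzero V \<boxplus>\<^bsub>V\<^esub> h (vzero U)"
      using X.U.zero_closed h_closed by (simp add: X.U.zero_add Y.U.zero_add)
    then show ?thesis
      by (rule Y.U.add_right_cancel[OF h_closed[OF X.U.zero_closed] Y.U.zero_closed
        h_closed[OF X.U.zero_closed]])
  qed
  have h_pos: "vzero V \<sqsubseteq>\<^bsub>V\<^esub> h u \<longleftrightarrow> vzero U \<sqsubseteq>\<^bsub>U\<^esub> u" if u: "u \<in> carrier U" for u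
  proof -
    \<comment> \<open>Positivity is written as a meet, because \<open>riesz_hom\<close> speaks of
      meets and not of the order.\<close>
    have "vzero V \<sqsubseteq>\<^bsub>V\<^esub> h u \<longleftrightarrow> vzero V \<sqinter>\<^bsub>V\<^esub> h u = vzero V"
      using Y.U.le_iff_join[OF Y.U.zero_closed h_closed[OF u]] by metis
    also have "vzero V \<sqinter>\<^bsub>V\<^esub> h u = h (vzero U \<sqinter>\<^bsub>U\<^esub> u)"
      using u X.U.zero_closed by (simp add: h_meet h_zero)
    also have "\<dots> = vzero V \<longleftrightarrow> vzero U \<sqinter>\<^bsub>U\<^esub> u = vzero U"
      using h_inj[of "vzero U \<sqinter>\<^bsub>U\<^esub> u" "vzero U"] u X.U.zero_closed
      by (simp add: h_zero X.U.meet_closed)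
    also have "\<dots> \<longleftrightarrow> vzero U \<sqsubseteq>\<^bsub>U\<^esub> u"
      using X.U.le_iff_join[OF X.U.zero_closed u] by metis
    finally show ?thesis .
  qed
  interpret paired_supports X Y "{u \<in> carrier U. vzero U \<sqsubseteq>\<^bsub>U\<^esub> u}" X.support "\<lambda>u. Y.support (h u)"
  proof
    fix u v assume "u \<in> {u \<in> carrier U. vzero U \<sqsubseteq>\<^bsub>U\<^esub> u}" "v \<in> {u \<in> carrier U. vzero U \<sqsubseteq>\<^bsub>U\<^esub> u}"
    then have uv: "u \<in> carrier U" "vzero U \<sqsubseteq>\<^bsub>U\<^esub> u" "v \<in> carrier U" "vzero U \<sqsubseteq>\<^bsub>U\<^esub> v" by auto
    have "X.support u \<inter> X.support v = {} \<longleftrightarrow> u \<sqinter>\<^bsub>U\<^esub> v = vzero U"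
      using X.disjoint_iff_support[OF uv] by simp
    also have "\<dots> \<longleftrightarrow> h u \<sqinter>\<^bsub>V\<^esub> h v = vzero V"
      using h_inj[of "u \<sqinter>\<^bsub>U\<^esub> v" "vzero U"] uv X.U.zero_closed
      by (simp add: h_meet h_zero X.U.meet_closed)
    also have "\<dots> \<longleftrightarrow> Y.support (h u) \<inter> Y.support (h v) = {}"
      using uv by (intro Y.disjoint_iff_support) (simp_all add: h_closed h_pos)
    finally show "X.support u \<inter> X.support v = {} \<longleftrightarrow> Y.support (h u) \<inter> Y.support (h v) = {}" .
  next
    fix W assume "W \<in> RO X" "W \<noteq> {}"
    then show "\<exists>u\<in>{u \<in> carrier U. vzero U \<sqsubseteq>\<^bsub>U\<^esub> u}. X.support u \<noteq> {} \<and> X.support u \<subseteq> W"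
      using X.support_dense[of W] by blast
  next
    fix Z assume "Z \<in> RO Y" "Z \<noteq> {}"
    then obtain v where v: "v \<in> carrier V" "vzero V \<sqsubseteq>\<^bsub>V\<^esub> v" "Y.support v \<noteq> {}" "Y.support v \<subseteq> Z"
      using Y.support_dense[of Z] by blast
    obtain u where u: "u \<in> carrier U" "v = h u"
      using bij v(1) unfolding bij_betw_def by blast
    then show "\<exists>u\<in>{u \<in> carrier U. vzero U \<sqsubseteq>\<^bsub>U\<^esub> u}. Y.support (h u) \<noteq> {} \<and> Y.support (h u) \<subseteq> Z"
      using v h_pos[OF u(1)] by (intro bexI[of _ u]) simp_all
  qed (simp_all add: X.support_def Y.support_def regularize_closed)
  show ?thesis by (rule boolean_isomorphic)
qed

section \<open>Transport along an isomorphism of the algebras of regular open sets\<close>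

lemma frame_reals_components:
  assumes "F \<in> frame_reals (regular_opens X)"
  shows "fst F p \<in> RO X" "snd F p \<in> RO X"
proof -
  obtain l u where lu: "F = (l, u)" by (cases F)
  have "range l \<subseteq> RO X" "range u \<subseteq> RO X"
    using assms unfolding lu frame_reals_regular_opens by blast+
  then show "fst F p \<in> RO X" "snd F p \<in> RO X"
    unfolding lu fst_conv snd_conv by blast+
qed

locale regular_open_isomorphism =
  fixes X :: "'a topology" and Y :: "'b topology" and h :: "'a set \<Rightarrow> 'b set"
  assumes bij: "bij_betw h (RO X) (RO Y)"
    and empty: "h {} = {}" and top: "h (topspace X) = topspace Y"
    and Int: "\<lbrakk>U \<in> RO X; V \<in> RO X\<rbrakk> \<Longrightarrow> h (U \<inter> V) = h U \<inter> h V"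
begin

lemma closed: "U \<in> RO X \<Longrightarrow> h U \<in> RO Y"
  using bij by (rule bij_betwE[THEN bspec])

lemma surj: "Z \<in> RO Y \<Longrightarrow> \<exists>U\<in>RO X. Z = h U"
  using bij unfolding bij_betw_def by blast

lemma eq_iff:
  assumes "U \<in> RO X" "V \<in> RO X"
  shows "h U = h V \<longleftrightarrow> U = V"
  using bij assms by (auto simp: bij_betw_def dest: inj_onD)

lemma subset_iff:
  assumes "U \<in> RO X" "V \<in> RO X"
  shows "h U \<subseteq> h V \<longleftrightarrow> U \<subseteq> V"
proof -
  have "h U \<subseteq> h V \<longleftrightarrow> h (U \<inter> V) = h U" using Int[OF assms] by blast
  also have "\<dots> \<longleftrightarrow> U \<inter> V = U"
    using assms by (intro eq_iff Int_regular_opens_closed)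
  finally show ?thesis by blast
qed

text \<open>The frame relations and the Riesz operations involve infinite joins, while an
  isomorphism of Boolean algebras is only known to respect finite ones. As \<open>h\<close> is an
  order isomorphism, it preserves all joins: the join in \<open>RO Y\<close> is pulled back to an
  upper bound \<open>W\<close> of \<open>A\<close>.\<close>

lemma regularize_Union:
  assumes A: "A \<subseteq> RO X"
  shows "h (regularize X (\<Union>A)) = regularize Y (\<Union>(h ` A))"
proof (rule equalityI)
  have opens: "openin X (\<Union>A)" "openin Y (\<Union>(h ` A))"
    using A closed by (auto simp: carrier_regular_opens intro!: openin_Union)
  obtain W where W: "W \<in> RO X" "regularize Y (\<Union>(h ` A)) = h W"
    using surj[OF regularize_closed] by blast
  have "U \<subseteq> W" if "U \<in> A" for U
  proof -
    have "h U \<subseteq> h W" using regularize_increasing[OF opens(2)] W(2) that by blast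
    then show ?thesis using subset_iff W(1) A that by blast
  qed
  then have "regularize X (\<Union>A) \<subseteq> regularize X W"
    by (intro regularize_mono) blast
  then have "regularize X (\<Union>A) \<subseteq> W" using W(1) by (simp add: carrier_regular_opens)
  then show "h (regularize X (\<Union>A)) \<subseteq> regularize Y (\<Union>(h ` A))"
    using W by (simp add: subset_iff regularize_closed)
  have "h U \<subseteq> h (regularize X (\<Union>A))" if "U \<in> A" for U
  proof -
    have "U \<subseteq> regularize X (\<Union>A)" using regularize_increasing[OF opens(1)] that by blast
    then show ?thesis using A that by (simp add: subset_iff regularize_closed subsetD)
  qed
  then have "regularize Y (\<Union>(h ` A)) \<subseteq> regularize Y (h (regularize X (\<Union>A)))"
    by (intro regularize_mono) blast
  then show "regularize Y (\<Union>(h ` A)) \<subseteq> h (regularize X (\<Union>A))"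
    using closed[OF regularize_closed, of "\<Union>A"] by (simp add: carrier_regular_opens)
qed

lemma regularize_UN:
  assumes "\<And>i. i \<in> I \<Longrightarrow> f i \<in> RO X"
  shows "h (regularize X (\<Union>i\<in>I. f i)) = regularize Y (\<Union>i\<in>I. h (f i))"
  using regularize_Union[of "f ` I"] assms by (simp add: image_image image_subset_iff)

lemma sup_eq:
  assumes "\<And>r. f r \<in> RO X"
  shows "h (\<Squnion>\<^bsub>regular_opens X\<^esub>{f r |r. Q r}) = \<Squnion>\<^bsub>regular_opens Y\<^esub>{h (f r) |r. Q r}"
proof -
  have *: "{g r |r. Q r} = g ` {r. Q r}" for g :: "_ \<Rightarrow> 'z" by auto
  have "f ` {r. Q r} \<subseteq> RO X" "(\<lambda>r. h (f r)) ` {r. Q r} \<subseteq> RO Y"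
    using assms closed by auto
  then show ?thesis
    unfolding * by (simp add: sup_regular_opens regularize_UN assms)
qed

text \<open>The composite of a frame homomorphism with \<open>h\<close>, given on the
  generators.\<close>

definition map_frame_real :: "'a set frame_real \<Rightarrow> 'b set frame_real" where
  "map_frame_real F = (\<lambda>p. h (fst F p), \<lambda>q. h (snd F q))"

lemma map_frame_real_closed:
  assumes "F \<in> frame_reals (regular_opens X)"
  shows "map_frame_real F \<in> frame_reals (regular_opens Y)"
proof -
  obtain l u where lu: "F = (l, u)" by (cases F)
  have cl: "\<And>p. l p \<in> RO X" "\<And>p. u p \<in> RO X"
    and disj: "\<And>p q. q \<le> p \<Longrightarrow> l p \<inter> u q = {}"
    and cover: "\<And>p q. p < q \<Longrightarrow> regularize X (l p \<union> u q) = topspace X"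
    and lower: "\<And>p. l p = regularize X (\<Union>q\<in>{q. p < q}. l q)"
    and upper: "\<And>p. u p = regularize X (\<Union>q\<in>{q. q < p}. u q)"
    and lower_top: "regularize X (\<Union>p. l p) = topspace X"
    and upper_top: "regularize X (\<Union>p. u p) = topspace X"
    using assms unfolding lu frame_reals_regular_opens by blast+
  have "h (l p) \<inter> h (u q) = {}" if "q \<le> p" for p q
    using Int[OF cl(1,2), of p q] disj[OF that] empty by simp
  moreover have "regularize Y (h (l p) \<union> h (u q)) = topspace Y" if "p < q" for p q
    using regularize_Union[of "{l p, u q}"] cl cover[OF that] top by simp
  moreover have "h (l p) = regularize Y (\<Union>q\<in>{q. p < q}. h (l q))" for p
    using regularize_UN[of "{q. p < q}" l] cl lower[of p] by simp
  moreover have "h (u p) = regularize Y (\<Union>q\<in>{q. q < p}. h (u q))" for p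
    using regularize_UN[of "{q. q < p}" u] cl upper[of p] by simp
  moreover have "regularize Y (\<Union>p. h (l p)) = topspace Y" "regularize Y (\<Union>p. h (u p)) = topspace Y"
    using regularize_UN[of UNIV l] regularize_UN[of UNIV u] cl lower_top upper_top top by simp_all
  moreover have "range (\<lambda>p. h (l p)) \<subseteq> RO Y"
    "range (\<lambda>p. h (u p)) \<subseteq> RO Y"
    using cl closed by auto
  ultimately show ?thesis
    unfolding lu map_frame_real_def fst_conv snd_conv frame_reals_regular_opens by blast
qed

lemma inverse: "regular_open_isomorphism Y X (inv_into (RO X) h)"
proof
  let ?k = "inv_into (RO X) h"
  have kh: "?k (h U) = U" if "U \<in> RO X" for U
    using bij that by (auto simp: bij_betw_def)
  show "bij_betw ?k (RO Y) (RO X)"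
    by (rule bij_betw_inv_into[OF bij])
  show "?k {} = {}" using kh[of "{}"] by (simp add: empty carrier_regular_opens)
  show "?k (topspace Y) = topspace X" using kh[of "topspace X"] by (simp add: top carrier_regular_opens)
  fix Z Z' assume "Z \<in> RO Y" "Z' \<in> RO Y"
  then obtain U U' where U: "U \<in> RO X" "Z = h U"
    "U' \<in> RO X" "Z' = h U'" using surj by meson
  then show "?k (Z \<inter> Z') = ?k Z \<inter> ?k Z'"
    by (simp add: kh Int_regular_opens_closed flip: Int)
qed

text \<open>The operations on frame homomorphisms are built from joins, binary meets and the two
  bounds of the algebra, all of which \<open>h\<close> preserves; composing with the inverse of
  \<open>h\<close> undoes the map.\<close>

lemma frame_real_riesz_isomorphic:
  "riesz_isomorphic (frame_real_riesz (regular_opens X)) (frame_real_riesz (regular_opens Y))"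
proof -
  let ?k = "inv_into (RO X) h"
  interpret K: regular_open_isomorphism Y X ?k by (rule inverse)
  have comps: "fst F p \<in> RO X" "snd F p \<in> RO X"
    if "F \<in> frame_reals (regular_opens X)" for F p
    using that by (rule frame_reals_components)+
  have comps': "fst F p \<in> RO Y" "snd F p \<in> RO Y"
    if "F \<in> frame_reals (regular_opens Y)" for F p
    using that by (rule frame_reals_components)+
  have kh: "?k (h U) = U" if "U \<in> RO X" for U
    using bij that by (auto simp: bij_betw_def)
  have hk: "h (?k Z) = Z" if "Z \<in> RO Y" for Z
    using bij that by (auto simp: bij_betw_def f_inv_into_f)
  have meet: "h (U \<sqinter>\<^bsub>regular_opens X\<^esub> V) = h U \<sqinter>\<^bsub>regular_opens Y\<^esub> h V"
    and meet_closed: "U \<sqinter>\<^bsub>regular_opens X\<^esub> V \<in> RO X"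
    if "U \<in> RO X" "V \<in> RO X" for U V
    using that by (simp_all add: meet_regular_opens closed Int Int_regular_opens_closed)
  have zero: "map_frame_real (frame_real_zero (regular_opens X)) = frame_real_zero (regular_opens Y)"
    by (auto simp: map_frame_real_def frame_real_zero_def bottom_regular_opens top_regular_opens
      empty top fun_eq_iff)
  have scale_pos: "map_frame_real (frame_real_scale_pos (regular_opens X) c F) =
      frame_real_scale_pos (regular_opens Y) c (map_frame_real F)"
    if "F \<in> frame_reals (regular_opens X)" for c F
    by (simp add: map_frame_real_def frame_real_scale_pos_def sup_eq comps[OF that])
  have neg: "map_frame_real (frame_real_neg F) = frame_real_neg (map_frame_real F)" for F
    by (simp add: map_frame_real_def frame_real_neg_def)
  show ?thesis
  proof (rule riesz_isomorphicI[of _ _ map_frame_real])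
    show "riesz_space (frame_real_riesz (regular_opens X))" "riesz_space (frame_real_riesz (regular_opens Y))"
      by (rule quasi_real_image.riesz_space[OF quasi_real_image_frame])+
    show "bij_betw map_frame_real (carrier (frame_real_riesz (regular_opens X)))
        (carrier (frame_real_riesz (regular_opens Y)))"
    proof (rule bij_betw_byWitness[of _ K.map_frame_real])
      show "\<forall>F\<in>carrier (frame_real_riesz (regular_opens X)). K.map_frame_real (map_frame_real F) = F"
        by (simp add: frame_real_riesz_def map_frame_real_def K.map_frame_real_def kh comps)
      show "\<forall>F\<in>carrier (frame_real_riesz (regular_opens Y)). map_frame_real (K.map_frame_real F) = F"
        by (simp add: frame_real_riesz_def map_frame_real_def K.map_frame_real_def hk comps')
    qed (auto simp: frame_real_riesz_def map_frame_real_closed K.map_frame_real_closed)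
    fix F G and c :: real
    assume "F \<in> carrier (frame_real_riesz (regular_opens X))"
    then have F: "F \<in> frame_reals (regular_opens X)" by (simp add: frame_real_riesz_def)
    show "map_frame_real (c \<boxdot>\<^bsub>frame_real_riesz (regular_opens X)\<^esub> F) =
        c \<boxdot>\<^bsub>frame_real_riesz (regular_opens Y)\<^esub> map_frame_real F"
      by (simp add: frame_real_riesz_def frame_real_scale_def zero neg scale_pos[OF F])
    assume "G \<in> carrier (frame_real_riesz (regular_opens X))"
    then have G: "G \<in> frame_reals (regular_opens X)" by (simp add: frame_real_riesz_def)
    show "map_frame_real F \<sqsubseteq>\<^bsub>frame_real_riesz (regular_opens Y)\<^esub> map_frame_real G \<longleftrightarrow>
        F \<sqsubseteq>\<^bsub>frame_real_riesz (regular_opens X)\<^esub> G"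
      by (simp add: frame_real_riesz_def frame_real_le_def map_frame_real_def le_regular_opens
        subset_iff comps[OF F] comps[OF G])
    have "h (\<Squnion>\<^bsub>regular_opens X\<^esub>{a r \<sqinter>\<^bsub>regular_opens X\<^esub> b r |r. True}) =
        \<Squnion>\<^bsub>regular_opens Y\<^esub>{h (a r) \<sqinter>\<^bsub>regular_opens Y\<^esub> h (b r) |r. True}"
      if "\<And>r. a r \<in> RO X" "\<And>r. b r \<in> RO X"
      for a b :: "rat \<Rightarrow> 'a set"
      using sup_eq[of "\<lambda>r. a r \<sqinter>\<^bsub>regular_opens X\<^esub> b r" "\<lambda>_. True"] that
      by (simp only: meet meet_closed)
    then show "map_frame_real (F \<boxplus>\<^bsub>frame_real_riesz (regular_opens X)\<^esub> G) =
        map_frame_real F \<boxplus>\<^bsub>frame_real_riesz (regular_opens Y)\<^esub> map_frame_real G"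
      unfolding frame_real_riesz_def map_frame_real_def frame_real_add_def riesz.simps fst_conv snd_conv
      using comps[OF F] comps[OF G] by simp
  qed
qed

end

lemma frame_real_riesz_isomorphic_if_boolean_isomorphic:
  assumes "boolean_isomorphic (regular_opens X) (regular_opens Y)"
  shows "riesz_isomorphic (frame_real_riesz (regular_opens X)) (frame_real_riesz (regular_opens Y))"
proof -
  obtain h where bij: "bij_betw h (RO X) (RO Y)"
    and h: "h {} = {}" "h (topspace X) = topspace Y"
    and meet: "\<forall>U\<in>RO X. \<forall>V\<in>RO X.
      h (U \<sqinter>\<^bsub>regular_opens X\<^esub> V) = h U \<sqinter>\<^bsub>regular_opens Y\<^esub> h V"
    using assms unfolding boolean_isomorphic_def bottom_regular_opens top_regular_opens by blast
  have "regular_open_isomorphism X Y h"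
  proof
    fix U V assume UV: "U \<in> RO X" "V \<in> RO X"
    then have "h U \<in> RO Y" "h V \<in> RO Y"
      using bij_betwE[OF bij] by auto
    then show "h (U \<inter> V) = h U \<inter> h V"
      using meet UV by (simp add: meet_regular_opens)
  qed (use bij h in auto)
  then show ?thesis by (rule regular_open_isomorphism.frame_real_riesz_isomorphic)
qed

text \<open>Any two realizations of the quotients will do: each is a universal completion, which
  gives one direction, and each is isomorphic to the space of frame homomorphisms, which depends
  only on the regular open sets.\<close>

lemma riesz_isomorphic_iff_boolean_isomorphic:
  assumes X: "completely_regular_space X" and Y: "completely_regular_space Y"
    and R: "quasi_real_image X R \<rho>" and S: "quasi_real_image Y S \<sigma>"
  shows "riesz_isomorphic R S \<longleftrightarrow> boolean_isomorphic (regular_opens X) (regular_opens Y)"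
proof
  assume "riesz_isomorphic R S"
  then show "boolean_isomorphic (regular_opens X) (regular_opens Y)"
    using quasi_real_image.universal_completion[OF R X] quasi_real_image.universal_completion[OF S Y]
    by (intro boolean_isomorphic_if_completions_isomorphic[OF X Y])
next
  assume "boolean_isomorphic (regular_opens X) (regular_opens Y)"
  then have "riesz_isomorphic (frame_real_riesz (regular_opens X)) (frame_real_riesz (regular_opens Y))"
    by (rule frame_real_riesz_isomorphic_if_boolean_isomorphic)
  then show "riesz_isomorphic R S"
    by (rule riesz_isomorphic_trans[OF quasi_real_images_isomorphic[OF R quasi_real_image_frame]
      riesz_isomorphic_trans[OF _ quasi_real_images_isomorphic[OF quasi_real_image_frame S]]])
qed

theorem corollary6p5:
  fixes X :: "'a topology" and Y :: "'b topology"
  assumes "completely_regular_space X" and "completely_regular_space Y"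
  shows
    "(boolean_isomorphic (regular_opens X) (regular_opens Y) \<longleftrightarrow>
        riesz_isomorphic (Hnf_riesz X) (Hnf_riesz Y)) \<and>
     (riesz_isomorphic (Hnf_riesz X) (Hnf_riesz Y) \<longleftrightarrow>
        riesz_isomorphic (NL_riesz X) (NL_riesz Y)) \<and>
     (riesz_isomorphic (NL_riesz X) (NL_riesz Y) \<longleftrightarrow>
        isomorphic_universal_completions (cont_riesz X) (cont_riesz Y))"
proof -
  have Hnf: "riesz_isomorphic (Hnf_riesz X) (Hnf_riesz Y) \<longleftrightarrow>
      boolean_isomorphic (regular_opens X) (regular_opens Y)"
    by (rule riesz_isomorphic_iff_boolean_isomorphic[OF assms quasi_real_image_Hnf quasi_real_image_Hnf])
  have NL: "riesz_isomorphic (NL_riesz X) (NL_riesz Y) \<longleftrightarrow>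
      boolean_isomorphic (regular_opens X) (regular_opens Y)"
    by (rule riesz_isomorphic_iff_boolean_isomorphic[OF assms quasi_real_image_NL quasi_real_image_NL])
  \<comment> \<open>The spaces in (3) serve as the universal completions; they are copied to the
    types that the definition prescribes.\<close>
  have "isomorphic_universal_completions (cont_riesz X) (cont_riesz Y)"
    if "riesz_isomorphic (NL_riesz X) (NL_riesz Y)"
    using quasi_real_image.universal_completion[OF quasi_real_image_NL assms(1)]
      quasi_real_image.universal_completion[OF quasi_real_image_NL assms(2)] that
    by (rule isomorphic_universal_completionsI)
  \<comment> \<open>The completions provided by (4) are arbitrary, so the supports are formed in
    them and not in the spaces of (2) or (3).\<close>
  moreover have "boolean_isomorphic (regular_opens X) (regular_opens Y)"
    if "isomorphic_universal_completions (cont_riesz X) (cont_riesz Y)"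
    using that unfolding isomorphic_universal_completions_def
    by (elim exE conjE) (rule boolean_isomorphic_if_completions_isomorphic[OF assms])
  ultimately show ?thesis using Hnf NL by blast
qed

end
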